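(* As $n\to\infty$: (i) $n^{-1}\mathbf A_n \to \mathbf F$ almost surely, in the uniform topology, where $\mathbf F=(F_{e_1},\dots,F_{e_J})$; and (ii) $\hat{\mathbf A}_n := n^{-1/2}\left(\sum_{m=1}^n \mathbf a_m - n\mathbf F\right) \Rightarrow \mathbf W^0\circ\mathbf F$ weakly, in the uniform topology, where $\mathbf W^0\circ\mathbf F$, with sample paths in $\mathcal C^J[0,\infty)$, is the $J$-dimensional Brownian bridge process with covariance function $R(t,s) = [F_{e_i,e_j}(t,s) - F_{e_i}(t)F_{e_j}(s)]_{i,j=1}^J$ for $t\le s$.
   Context: Fix $T>0$, $J\ge 1$ and labels $e_1,\dots,e_J$ (nodes receiving exogenous traffic). Let $\mathbf T_m=(T_{e_1,m},\dots,T_{e_J,m})$, $m\ge1$, be independent and identically distributed random vectors with values in $[0,T]^J$; the components of a single $\mathbf T_m$ may be dependent. $F_{e_j}(t)=\mathbb P(T_{e_j,m}\le t)$ is the (continuous) distribution function of the $j$th component, and $F_{e_i,e_j}(t,s)=\mathbb P(T_{e_i,m}\le t,\,T_{e_j,m}\le s)$. Put $\mathbf a_m(t)=(\mathbf 1_{\{T_{e_1,m}\le t\}},\dots,\mathbf 1_{\{T_{e_J,m}\le t\}})$ and $\mathbf A_n(t)=\sum_{m=1}^n\mathbf a_m(t)$, $t\ge0$. $\mathcal C^J$ is the space of continuous $\mathbb R^J$-valued functions on $[0,\infty)$. Processes $\mathbf A_n$ have right-continuous paths with left limits; convergence is with respect to uniform convergence on compact sets, with limits in $\mathcal C^J$.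 The "Brownian bridge process $\mathbf W^0\circ\mathbf F$ with covariance function $R$" means the mean-zero $\mathbb R^J$-valued Gaussian process with $\mathbb E[(\mathbf W^0\circ \mathbf F)(t)\,(\mathbf W^0\circ\mathbf F)(s)^T]=R(t,s)$ for $t\le s$. *)

theory Defs
  imports "HOL-Probability.Probability"
begin

definition marginal_df :: "'a measure \<Rightarrow> ('a \<Rightarrow> real^'j) \<Rightarrow> 'j \<Rightarrow> real \<Rightarrow> real" where
  "marginal_df M X i t = measure M {\<omega> \<in> space M. X \<omega> $ i \<le> t}"

definition joint_df :: "'a measure \<Rightarrow> ('a \<Rightarrow> real^'j) \<Rightarrow> 'j \<Rightarrow> 'j \<Rightarrow> real \<Rightarrow> real \<Rightarrow> real" where
  "joint_df M X i j t s = measure M {\<omega> \<in> space M. X \<omega> $ i \<le> t \<and> X \<omega> $ j \<le> s}"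

definition vec_df :: "'a measure \<Rightarrow> ('a \<Rightarrow> real^'j) \<Rightarrow> real \<Rightarrow> real^'j" where
  "vec_df M X t = (\<chi> i. marginal_df M X i t)"

definition arrival :: "(nat \<Rightarrow> 'a \<Rightarrow> real^'j) \<Rightarrow> nat \<Rightarrow> real \<Rightarrow> 'a \<Rightarrow> real^'j" where
  "arrival \<tau> m t \<omega> = (\<chi> i. of_bool (\<tau> m \<omega> $ i \<le> t))"

definition arrivals :: "(nat \<Rightarrow> 'a \<Rightarrow> real^'j) \<Rightarrow> nat \<Rightarrow> real \<Rightarrow> 'a \<Rightarrow> real^'j" where
  "arrivals \<tau> n t \<omega> = (\<Sum>m=1..n. arrival \<tau> m t \<omega>)"

definition scaled_arrivals ::
  "'a measure \<Rightarrow> (nat \<Rightarrow> 'a \<Rightarrow> real^'j) \<Rightarrow> nat \<Rightarrow> real \<Rightarrow> 'a \<Rightarrow> real^'j" where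
  "scaled_arrivals M \<tau> n t \<omega> =
     (1 / sqrt (real n)) *\<^sub>R (arrivals \<tau> n t \<omega> - real n *\<^sub>R vec_df M (\<tau> 1) t)"

definition bridge_cov :: "'a measure \<Rightarrow> ('a \<Rightarrow> real^'j) \<Rightarrow> real \<Rightarrow> real \<Rightarrow> real^'j^'j" where
  "bridge_cov M X t s =
     (\<chi> i j. joint_df M X i j t s - marginal_df M X i t * marginal_df M X j s)"

text \<open>A path on the half-line is a function on the reals of which only the values on
  \<open>{0..}\<close> are used. In particular a functional satisfying \<open>ucc_continuous\<close> below takes the
  same value at any two paths that agree on \<open>{0..}\<close>.\<close>

definition ucc_tendsto :: "(nat \<Rightarrow> real \<Rightarrow> 'b::metric_space) \<Rightarrow> (real \<Rightarrow> 'b) \<Rightarrow> bool" where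
  "ucc_tendsto f g \<longleftrightarrow> (\<forall>K. compact K \<and> K \<subseteq> {0..} \<longrightarrow> uniform_limit K f g sequentially)"

definition rcll_paths :: "(real \<Rightarrow> 'b::topological_space) set" where
  "rcll_paths = {f. (\<forall>t\<ge>0. (f \<longlongrightarrow> f t) (at_right t)) \<and> (\<forall>t>0. \<exists>l. (f \<longlongrightarrow> l) (at_left t))}"

definition ucc_continuous :: "((real \<Rightarrow> 'b::metric_space) \<Rightarrow> real) \<Rightarrow> bool" where
  "ucc_continuous \<Phi> \<longleftrightarrow>
     (\<forall>f\<in>rcll_paths. \<forall>\<epsilon>>0. \<exists>K \<delta>. compact K \<and> K \<subseteq> {0..} \<and> \<delta> > 0 \<and>
        (\<forall>g\<in>rcll_paths. (\<forall>t\<in>K. dist (g t) (f t) < \<delta>) \<longrightarrow> \<bar>\<Phi> g - \<Phi> f\<bar> < \<epsilon>))"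

text \<open>The space of right-continuous paths with left limits is not separable in the topology of
  uniform convergence on compact sets, and the empirical-type processes considered here are not
  Borel measurable maps into it. Weak convergence is therefore taken in the sense of
  Hoffmann-Jorgensen: outer expectations of all bounded continuous functionals converge. For
  functionals that are measurable along the sequence, in particular those measurable with
  respect to the coordinate projections, the outer expectation is the expectation.\<close>

definition outer_expectation :: "'a measure \<Rightarrow> ('a \<Rightarrow> real) \<Rightarrow> real" where
  "outer_expectation M f =
     Inf {integral\<^sup>L M U | U. integrable M U \<and> (\<forall>\<omega>\<in>space M. f \<omega> \<le> U \<omega>)}"

lemma outer_expectation_eq_integral:
  assumes "integrable M f"
  shows "outer_expectation M f = integral\<^sup>L M f"
  unfolding outer_expectation_def
  using assms by (intro cInf_eq_minimum) (auto intro: integral_mono)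

definition weakly_converges_ucc ::
  "'a measure \<Rightarrow> (nat \<Rightarrow> real \<Rightarrow> 'a \<Rightarrow> 'c::metric_space) \<Rightarrow>
   'b measure \<Rightarrow> (real \<Rightarrow> 'b \<Rightarrow> 'c) \<Rightarrow> bool" where
  "weakly_converges_ucc M X N W \<longleftrightarrow>
     (\<forall>n. \<forall>\<omega>\<in>space M. (\<lambda>t. X n t \<omega>) \<in> rcll_paths) \<and>
     (\<forall>\<omega>\<in>space N. (\<lambda>t. W t \<omega>) \<in> rcll_paths) \<and>
     (\<forall>\<Phi> :: (real \<Rightarrow> 'c) \<Rightarrow> real. bounded (\<Phi> ` rcll_paths) \<and> ucc_continuous \<Phi> \<longrightarrow>
        (\<lambda>\<omega>. \<Phi> (\<lambda>t. W t \<omega>)) \<in> borel_measurable N \<and>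
        (\<lambda>n. outer_expectation M (\<lambda>\<omega>. \<Phi> (\<lambda>t. X n t \<omega>)))
          \<longlonglongrightarrow> integral\<^sup>L N (\<lambda>\<omega>. \<Phi> (\<lambda>t. W t \<omega>)))"

text \<open>Degenerate normal distributions (variance zero) are included.\<close>

definition gaussian_rv :: "'b measure \<Rightarrow> ('b \<Rightarrow> real) \<Rightarrow> bool" where
  "gaussian_rv N Y \<longleftrightarrow> Y \<in> borel_measurable N \<and>
     ((\<exists>\<mu>. AE \<omega> in N. Y \<omega> = \<mu>) \<or>
      (\<exists>\<mu> \<sigma>. \<sigma> > 0 \<and> distributed N lborel Y (\<lambda>x. ennreal (normal_density \<mu> \<sigma> x))))"

definition gaussian_process :: "'b measure \<Rightarrow> (real \<Rightarrow> 'b \<Rightarrow> real^'j) \<Rightarrow> bool" where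
  "gaussian_process N W \<longleftrightarrow> prob_space N \<and>
     (\<forall>t\<ge>0. W t \<in> borel_measurable N) \<and>
     (\<forall>I (c :: real \<Rightarrow> real^'j). finite I \<and> I \<subseteq> {0..} \<longrightarrow>
        gaussian_rv N (\<lambda>\<omega>. \<Sum>t\<in>I. c t \<bullet> W t \<omega>))"

text \<open>The covariance is prescribed for \<open>t \<le> s\<close> only; the values for \<open>t > s\<close> are obtained by
  transposition.\<close>

definition is_bridge ::
  "'b measure \<Rightarrow> (real \<Rightarrow> 'b \<Rightarrow> real^'j) \<Rightarrow> (real \<Rightarrow> real \<Rightarrow> real^'j^'j) \<Rightarrow> bool" where
  "is_bridge N W R \<longleftrightarrow> gaussian_process N W \<and>
     (\<forall>\<omega>\<in>space N. continuous_on {0..} (\<lambda>t. W t \<omega>)) \<and>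
     (\<forall>t\<ge>0. \<forall>i. integral\<^sup>L N (\<lambda>\<omega>. W t \<omega> $ i) = 0) \<and>
     (\<forall>t\<ge>0. \<forall>s\<ge>t. \<forall>i j. integral\<^sup>L N (\<lambda>\<omega>. W t \<omega> $ i * W s \<omega> $ j) = R t s $ i $ j)"

end

theory Submission
  imports Defs
begin

text \<open>Everything rests on chaining along quantiles. Since the marginal distribution function \<open>F\<close> is
  continuous, there is a quantile function \<open>Q\<close> with \<open>Q v \<le> t \<longleftrightarrow> v \<le> F t\<close>, and the increments of the empirical process
  between \<open>Q (k / 2^l)\<close> and \<open>Q ((k + 1) / 2^l)\<close> have fourth moments of order \<open>4^-l\<close> as long as \<open>2^l \<le> n\<close>.
  Summing over \<open>l\<close> controls the modulus of continuity in mean; below the level \<open>2^-l \<approx> 1 / n\<close> the path is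
  squeezed between neighbouring quantiles by monotonicity, at the cost of a drift \<open>O(n^(-1/2))\<close>. The same
  chaining turns a Gaussian family on the dyadic quantiles into a bridge with continuous paths.

  For the weak limit, a bounded continuous functional is majorised by its Lipschitz envelopes for
  the uniform distance. On paths discretised on a grid these are continuous functions of finitely many
  coordinates, whose expectations converge because characteristic functions of linear combinations
  do (one-dimensional central limit theorem, then Stone--Weierstrass in the variables \<open>sin (x / L)\<close>);
  the discretisation error is bounded by the modulus of continuity. Applying this to \<open>\<Phi>\<close> and
  \<open>- \<Phi>\<close> gives convergence of the outer expectations.\<close>

text \<open>The functionals are continuous only for the uniform distance, the paths jump, and only
  outer expectations are available. Lipschitz envelopes reduce this to the mean of an integrable
  majorant of the modulus, which is why the chaining estimates are in mean and not in probability.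
  Second moments would not do: level \<open>l\<close> has about \<open>2^l\<close> increments, and
  moments of order \<open>2^-l\<close> add up to a constant, whereas \<open>2^l * 4^-l\<close> is
  summable. An increment over mass \<open>p\<close> has fourth moment at most
  \<open>3 * p^2 + p / n\<close>; the term \<open>p / n\<close> forbids levels with
  \<open>2^l > n\<close>. Quantiles instead of times make the increments of a level comparable for
  an arbitrary continuous marginal. Dependence between components enters only through the
  covariance, since the modulus is bounded coordinate by coordinate. Existence of the bridge is a
  separate claim, on a prescribed type of sample space; it comes from factorising the Gram matrix of
  countably many centred indicators and applying the factor to independent standard normals.\<close>

section \<open>Weak convergence from characteristic functions\<close>

text \<open>Products of exponentials are exponentials, so convergence of characteristic functions
  extends to every polynomial in the variables \<open>sin (x k / L)\<close>. These are bounded on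
  the whole space and determine \<open>x k\<close> when \<open>\<bar>x k\<bar> \<le> L\<close>; the
  bound \<open>C\<close> on second moments controls the rest and plays the part of
  tightness.\<close>

lemma weak_convergence_from_characteristic_functions:
  fixes X :: "nat \<Rightarrow> 'a \<Rightarrow> 'k::countable \<Rightarrow> real" and V :: "'b \<Rightarrow> 'k \<Rightarrow> real"
    and h :: "('k \<Rightarrow> real) \<Rightarrow> real"
  assumes M: "prob_space M" and N: "prob_space N" and I: "finite I"
    and mX: "\<And>n k. (\<lambda>\<omega>. X n \<omega> k) \<in> borel_measurable M"
    and mV: "\<And>k. (\<lambda>\<omega>. V \<omega> k) \<in> borel_measurable N"
    and X2: "\<And>n k. k \<in> I \<Longrightarrow> integrable M (\<lambda>\<omega>. (X n \<omega> k)\<^sup>2)"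
      "\<And>n k. k \<in> I \<Longrightarrow> (\<integral>\<omega>. (X n \<omega> k)\<^sup>2 \<partial>M) \<le> C"
    and V2: "\<And>k. k \<in> I \<Longrightarrow> integrable N (\<lambda>\<omega>. (V \<omega> k)\<^sup>2)"
      "\<And>k. k \<in> I \<Longrightarrow> (\<integral>\<omega>. (V \<omega> k)\<^sup>2 \<partial>N) \<le> C"
    and chf: "\<And>u. (\<lambda>n. \<integral>\<omega>. iexp (\<Sum>k\<in>I. u k * X n \<omega> k) \<partial>M)
        \<longlonglongrightarrow> (\<integral>\<omega>. iexp (\<Sum>k\<in>I. u k * V \<omega> k) \<partial>N)"
    and h: "continuous_on UNIV h" "\<And>x. \<bar>h x\<bar> \<le> B"
      "\<And>x y. (\<And>k. k \<in> I \<Longrightarrow> x k = y k) \<Longrightarrow> h x = h y"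
  shows "(\<lambda>n. \<integral>\<omega>. h (X n \<omega>) \<partial>M) \<longlonglongrightarrow> (\<integral>\<omega>. h (V \<omega>) \<partial>N)"
proof -
  interpret M: prob_space M by fact
  interpret N: prob_space N by fact
  have Xm: "X n \<in> borel_measurable M" for n
    by (intro measurable_coordinatewise_then_product mX)
  have Vm: "V \<in> borel_measurable N"
    by (intro measurable_coordinatewise_then_product mV)
  note [measurable] = mX mV
  have coord[measurable]: "(\<lambda>x. x k) \<in> borel_measurable borel" for k :: 'k
    by (rule borel_measurable_continuous_onI) simp
  have hm[measurable]: "h \<in> borel_measurable borel"
    by (rule borel_measurable_continuous_onI) (rule h)
  define e where "e u x = iexp (\<Sum>k\<in>I. u k * x k)" for u x :: "'k \<Rightarrow> real"
  have em[measurable]: "e u \<in> borel_measurable borel" for u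
    unfolding e_def by measurable
  have ne: "norm (e u x) = 1" for u x
    by (simp add: e_def)
  have edd: "e (\<lambda>k. u k + v k) x = e u x * e v x" for u v x
    by (simp add: e_def algebra_simps sum.distrib flip: exp_add)
  define bd where "bd g \<longleftrightarrow> (\<exists>b. \<forall>x. norm (g x) \<le> b)" for g :: "('k \<Rightarrow> real) \<Rightarrow> complex"
  have intM: "integrable M (\<lambda>\<omega>. g (X n \<omega>))" if "g \<in> borel_measurable borel" "bd g" for g n
  proof -
    obtain b where "\<And>x. norm (g x) \<le> b" using \<open>bd g\<close> by (auto simp: bd_def)
    then have "AE \<omega> in M. norm (g (X n \<omega>)) \<le> b" by simp
    then show ?thesis
      by (rule M.integrable_const_bound) (rule measurable_compose[OF Xm that(1)])
  qed
  have intN: "integrable N (\<lambda>\<omega>. g (V \<omega>))" if "g \<in> borel_measurable borel" "bd g" for g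
  proof -
    obtain b where "\<And>x. norm (g x) \<le> b" using \<open>bd g\<close> by (auto simp: bd_def)
    then have "AE \<omega> in N. norm (g (V \<omega>)) \<le> b" by simp
    then show ?thesis
      by (rule N.integrable_const_bound) (rule measurable_compose[OF Vm that(1)])
  qed
  note [[simproc del: measurable]]
  \<comment> \<open>Convergence is required after multiplication by every exponential
    \<open>e u\<close>; this makes the class stable under multiplication by exponentials.\<close>
  define Cs where "Cs g \<longleftrightarrow> g \<in> borel_measurable borel \<and> bd g \<and>
     (\<forall>u. (\<lambda>n. \<integral>\<omega>. g (X n \<omega>) * e u (X n \<omega>) \<partial>M) \<longlonglongrightarrow> (\<integral>\<omega>. g (V \<omega>) * e u (V \<omega>) \<partial>N))"
    for g :: "('k \<Rightarrow> real) \<Rightarrow> complex"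
  have bd_e: "bd (\<lambda>x. g x * e u x)" if "bd g" for g u
    using that by (auto simp: bd_def norm_mult ne)
  have intMe: "integrable M (\<lambda>\<omega>. g (X n \<omega>) * e u (X n \<omega>))"
    if "g \<in> borel_measurable borel" "bd g" for g u n
    by (rule intM[OF borel_measurable_times[OF that(1) em] bd_e[OF that(2)]])
  have intNe: "integrable N (\<lambda>\<omega>. g (V \<omega>) * e u (V \<omega>))"
    if "g \<in> borel_measurable borel" "bd g" for g u
    by (rule intN[OF borel_measurable_times[OF that(1) em] bd_e[OF that(2)]])
  have bd_mult: "bd (\<lambda>x. g x * f x)" if "bd g" "bd f" for g f
  proof -
    obtain a where a1: "\<And>x. norm (g x) \<le> a" using \<open>bd g\<close> by (auto simp: bd_def)
    obtain b where a2: "\<And>x. norm (f x) \<le> b"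
      using \<open>bd f\<close> by (auto simp: bd_def)
    have "norm (g x * f x) \<le> a * b" for x
      using norm_ge_zero[of "g x"] a1[of x] a2[of x] by (simp add: norm_mult mult_mono')
    then show ?thesis by (auto simp: bd_def)
  qed
  have bd_add: "bd (\<lambda>x. g x + f x)" if "bd g" "bd f" for g f
    using that unfolding bd_def by (meson add_mono order_trans norm_triangle_ineq)
  have Cs_add: "Cs (\<lambda>x. g x + f x)" if "Cs g" "Cs f" for g f
    using that unfolding Cs_def distrib_right
    by (auto simp: intMe intNe bd_add borel_measurable_add intro!: tendsto_add)
  have Cs_cmult: "Cs (\<lambda>x. c * g x)" if "Cs g" for g c
  proof -
    have "bd (\<lambda>x. c * g x)"
      using that bd_mult[of "\<lambda>_. c" g] unfolding Cs_def by (auto simp: bd_def)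
    then show ?thesis
      using that unfolding Cs_def
      by (auto simp: mult.assoc borel_measurable_times borel_measurable_const intro!: tendsto_mult)
  qed
  have Cs_e: "Cs (\<lambda>x. e v x * g x)" if "Cs g" for g v
  proof -
    have "bd (\<lambda>x. e v x * g x)"
      using that bd_e[of g v] by (simp add: Cs_def mult.commute)
    moreover have "(\<lambda>n. \<integral>\<omega>. e v (X n \<omega>) * g (X n \<omega>) * e u (X n \<omega>) \<partial>M) \<longlonglongrightarrow>
        (\<integral>\<omega>. e v (V \<omega>) * g (V \<omega>) * e u (V \<omega>) \<partial>N)" for u
    proof -
      have "e v x * g x * e u x = g x * e (\<lambda>k. u k + v k) x" for x
        by (simp add: edd mult_ac)
      then show ?thesis using that by (simp only: Cs_def)
    qed
    ultimately show ?thesis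
      using that unfolding Cs_def by (auto simp: borel_measurable_times em)
  qed
  have Cs_1: "Cs (\<lambda>_. 1)"
    using chf unfolding Cs_def e_def bd_def by (auto intro: exI[of _ 1] borel_measurable_const)
  \<comment> \<open>\<open>Cs\<close> is not visibly closed under products. Its multipliers are, by
    composition, and they supply the algebra for Stone--Weierstrass.\<close>
  define mlt where "mlt f \<longleftrightarrow> (\<forall>g. Cs g \<longrightarrow> Cs (\<lambda>x. complex_of_real (f x) * g x))"
    for f :: "('k \<Rightarrow> real) \<Rightarrow> real"
  have mlt_add: "mlt (\<lambda>x. f x + f' x)" if "mlt f" "mlt f'" for f f'
    using that Cs_add unfolding mlt_def by (simp add: distrib_right)
  have mlt_mult: "mlt (\<lambda>x. f x * f' x)" if "mlt f" "mlt f'" for f f'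
    using that unfolding mlt_def by (simp add: mult.assoc)
  have mlt_const: "mlt (\<lambda>x. c)" for c
    using Cs_cmult unfolding mlt_def by simp
  have mlt_sin: "mlt (\<lambda>x. sin (a * x k))" if "k \<in> I" for k a
    unfolding mlt_def
  proof (intro allI impI)
    fix g assume g: "Cs g"
    define v where "v b j = (if j = k then b else 0)" for b :: real and j
    have "e (v b) x = iexp (b * x k)" for b x
      using that I unfolding e_def v_def by (simp add: if_distrib[of "\<lambda>z. z * _"] sum.delta cong: if_cong)
    then have "complex_of_real (sin (a * x k)) * g x =
       (1 / (2*\<i>)) * (e (v a) x * g x + (-1) * (e (v (-a)) x * g x))" for x
      by (simp add: sin_exp_eq sin_of_real[symmetric] field_simps)
    then show "Cs (\<lambda>x. complex_of_real (sin (a * x k)) * g x)"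
      using g by (simp only:) (intro Cs_cmult Cs_add Cs_e)
  qed
  \<comment> \<open>The range of the sine variables. Coordinates outside \<open>I\<close> are pinned
    to 0, so distinct points are separated by a coordinate in \<open>I\<close>.\<close>
  define S where "S = PiE UNIV (\<lambda>k. if k \<in> I then {-1..1::real} else {0})"
  have S: "compact S"
  proof -
    have "compactin (product_topology (\<lambda>_. euclidean) UNIV) S"
      unfolding S_def compactin_PiE by auto
    then show ?thesis
      by (simp add: euclidean_product_topology)
  qed
  have B0: "0 \<le> B" using h(2)[of undefined] by linarith
  define C' where "C' = max C 0"
  have C': "0 \<le> C'" "C \<le> C'" by (auto simp: C'_def)
  show ?thesis
  proof (rule LIMSEQ_I)
    fix r :: real assume r: "0 < r"
    define \<epsilon> where "\<epsilon> = r / 8"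
    \<comment> \<open>\<open>q / L^2\<close> bounds the mean of the quadratic penalty in
      \<open>hp\<close>: \<open>2 * B / L^2\<close> times \<open>card I\<close> second moments.
      \<open>L\<close> is chosen to make it at most \<epsilon>.\<close>
    define q where "q = 2 * B * card I * C'"
    have q0: "0 \<le> q" using B0 C' by (simp add: q_def)
    define L where "L = sqrt (q / \<epsilon>) + 1"
    have eps: "\<epsilon> > 0" using r by (simp add: \<epsilon>_def)
    have L: "L > 0" using q0 eps by (simp add: L_def add_nonneg_pos)
    have "q / \<epsilon> \<le> L\<^sup>2"
    proof -
      have "q / \<epsilon> = (sqrt (q / \<epsilon>))\<^sup>2" using q0 eps by simp
      also have "\<dots> \<le> L\<^sup>2" unfolding L_def by (rule power_mono) (use q0 eps in auto)
      finally show ?thesis .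
    qed
    then have qL: "q / L\<^sup>2 \<le> \<epsilon>" using L eps by (simp add: field_simps)
    define s where "s x = (\<lambda>k. if k \<in> I then sin ((1/L) * x k) else 0)" for x :: "'k \<Rightarrow> real"
    have sS: "s x \<in> S" for x by (auto simp: s_def S_def)
    have [measurable]: "s \<in> borel_measurable borel"
      unfolding s_def by (intro measurable_coordinatewise_then_product) measurable
    define R where "R = {P. continuous_on UNIV P \<and> mlt (\<lambda>x. P (s x))}"
    interpret function_ring_on R S
    proof
      fix x y assume xy: "x \<in> S" "y \<in> S" "x \<noteq> y"
      then obtain k where k: "x k \<noteq> y k" by blast
      have "k \<in> I"
        using xy k unfolding S_def PiE_iff by (metis UNIV_I singletonD)
      then have "(\<lambda>x. x k) \<in> R"
        using mlt_sin[of k "1/L"] by (simp add: R_def s_def)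
      then show "\<exists>f\<in>R. f x \<noteq> f y" using k by (intro bexI[of _ "\<lambda>x. x k"])
    qed (use S in \<open>auto simp: R_def intro: continuous_on_subset mlt_add mlt_mult mlt_const
          intro!: continuous_intros\<close>)
    have "continuous_on S (\<lambda>y. h (\<lambda>k. L * arcsin (y k)))"
    proof (rule continuous_on_compose2[OF h(1)])
      show "continuous_on S (\<lambda>y k. L * arcsin (y k))"
      proof (intro continuous_on_coordinatewise_then_product continuous_on_mult continuous_on_const
          continuous_on_arcsin)
        fix k show "continuous_on S (\<lambda>x. x k)"
          by (rule continuous_on_subset[OF continuous_on_product_coordinates]) simp
        show "\<forall>x\<in>S. - 1 \<le> x k \<and> x k \<le> 1"
          by (auto simp: S_def PiE_iff split: if_splits dest!: spec[of _ k])
      qed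
    qed auto
    from Stone_Weierstrass_basic[OF this eps] obtain P where P: "P \<in> R"
      "\<And>y. y \<in> S \<Longrightarrow> \<bar>h (\<lambda>k. L * arcsin (y k)) - P y\<bar> < \<epsilon>" by blast
    define p where "p x = P (s x)" for x
    have [measurable]: "P \<in> borel_measurable borel"
      using P(1) by (auto simp: R_def intro: borel_measurable_continuous_onI)
    have pm[measurable]: "p \<in> borel_measurable borel"
      unfolding p_def using \<open>s \<in> borel_measurable borel\<close> \<open>P \<in> borel_measurable borel\<close>
      by (rule measurable_compose)
    have pb: "\<bar>p x\<bar> \<le> B + \<epsilon>" for x
      using P(2)[OF sS[of x]] h(2)[of "\<lambda>k. L * arcsin (s x k)"] unfolding p_def by linarith
    \<comment> \<open>If all \<open>\<bar>x k\<bar> \<le> L\<close>, then \<open>arcsin\<close>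
      inverts the sines because \<open>1 \<le> pi / 2\<close>. Otherwise some square exceeds
      \<open>L^2\<close>, and the right-hand side is at least the trivial bound
      \<open>2 * B + \<epsilon>\<close>.\<close>
    have hp: "\<bar>h x - p x\<bar> \<le> \<epsilon> + 2 * B / L\<^sup>2 * (\<Sum>k\<in>I. (x k)\<^sup>2)" for x
    proof (cases "\<forall>k\<in>I. \<bar>x k\<bar> \<le> L")
      case True
      have "h (\<lambda>k. L * arcsin (s x k)) = h x"
      proof (rule h(3))
        fix k assume k: "k \<in> I"
        have "\<bar>1/L * x k\<bar> \<le> 1" using True k L by (simp add: abs_mult)
        then have "\<bar>1/L * x k\<bar> \<le> pi / 2" using pi_half_gt_zero pi_ge_two by linarith
        then have "arcsin (sin (1/L * x k)) = 1/L * x k"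
          by (intro arcsin_sin) linarith+
        then show "L * arcsin (s x k) = x k" using k L by (simp add: s_def)
      qed
      then have "\<bar>h x - p x\<bar> \<le> \<epsilon>" using P(2)[OF sS[of x]] by (simp add: p_def)
      moreover have "0 \<le> 2 * B / L\<^sup>2 * (\<Sum>k\<in>I. (x k)\<^sup>2)"
        using B0 by (intro mult_nonneg_nonneg sum_nonneg) auto
      ultimately show ?thesis by linarith
    next
      case False
      then obtain k where k: "k \<in> I" "L < \<bar>x k\<bar>" by force
      have "L\<^sup>2 \<le> (x k)\<^sup>2" using k L by (metis abs_of_pos less_imp_le abs_le_square_iff)
      also have "\<dots> \<le> (\<Sum>k\<in>I. (x k)\<^sup>2)" using k I by (intro member_le_sum) auto
      finally have "1 \<le> (\<Sum>k\<in>I. (x k)\<^sup>2) / L\<^sup>2" using L by simp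
      then have "2 * B * 1 \<le> 2 * B * ((\<Sum>k\<in>I. (x k)\<^sup>2) / L\<^sup>2)"
        using B0 by (intro mult_left_mono) auto
      moreover have "\<bar>h x - p x\<bar> \<le> B + (B + \<epsilon>)"
        using pb[of x] h(2)[of x] by linarith
      ultimately show ?thesis by simp
    qed
    have diff: "\<bar>(\<integral>\<omega>. h (Y \<omega>) \<partial>Q) - (\<integral>\<omega>. p (Y \<omega>) \<partial>Q)\<bar> \<le> 2 * \<epsilon>"
      if Q: "prob_space Q" and Y: "Y \<in> borel_measurable Q"
        and Y2: "\<And>k. k \<in> I \<Longrightarrow> integrable Q (\<lambda>\<omega>. (Y \<omega> k)\<^sup>2)"
         "\<And>k. k \<in> I \<Longrightarrow> (\<integral>\<omega>. (Y \<omega> k)\<^sup>2 \<partial>Q) \<le> C"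
      for Q :: "'c measure" and Y
    proof -
      interpret Q: prob_space Q by fact
      have [measurable]: "(\<lambda>\<omega>. h (Y \<omega>)) \<in> borel_measurable Q" "(\<lambda>\<omega>. p (Y \<omega>)) \<in> borel_measurable Q"
        by (rule measurable_compose[OF Y]; fact)+
      have i1: "integrable Q (\<lambda>\<omega>. h (Y \<omega>))"
        by (rule Q.integrable_const_bound[of _ B]) (use h(2) \<open>(\<lambda>\<omega>. h (Y \<omega>)) \<in> borel_measurable Q\<close> in auto)
      have i2: "integrable Q (\<lambda>\<omega>. p (Y \<omega>))"
        by (rule Q.integrable_const_bound[of _ "B + \<epsilon>"]) (use pb \<open>(\<lambda>\<omega>. p (Y \<omega>)) \<in> borel_measurable Q\<close> in auto)
      have "\<bar>(\<integral>\<omega>. h (Y \<omega>) \<partial>Q) - (\<integral>\<omega>. p (Y \<omega>) \<partial>Q)\<bar> = \<bar>\<integral>\<omega>. h (Y \<omega>) - p (Y \<omega>) \<partial>Q\<bar>"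
        using i1 i2 by simp
      also have "\<dots> \<le> (\<integral>\<omega>. \<bar>h (Y \<omega>) - p (Y \<omega>)\<bar> \<partial>Q)"
        by (rule integral_abs_bound)
      also have "\<dots> \<le> (\<integral>\<omega>. \<epsilon> + 2 * B / L\<^sup>2 * (\<Sum>k\<in>I. (Y \<omega> k)\<^sup>2) \<partial>Q)"
        using i1 i2 Y2 by (intro integral_mono hp) auto
      also have "\<dots> = \<epsilon> + 2 * B / L\<^sup>2 * (\<Sum>k\<in>I. \<integral>\<omega>. (Y \<omega> k)\<^sup>2 \<partial>Q)"
        using Y2 by (simp add: Q.prob_space)
      also have "\<dots> \<le> \<epsilon> + 2 * B / L\<^sup>2 * (\<Sum>k\<in>I. C')"
        using Y2 C' B0 by (intro add_left_mono mult_left_mono sum_mono) (auto intro: order_trans)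
      also have "\<dots> = \<epsilon> + q / L\<^sup>2" by (simp add: q_def)
      finally show ?thesis using qL by simp
    qed
    have "Cs (\<lambda>x. complex_of_real (p x) * 1)"
      using P(1) Cs_1 unfolding R_def mlt_def p_def by fast
    then have "(\<lambda>n. \<integral>\<omega>. complex_of_real (p (X n \<omega>)) \<partial>M) \<longlonglongrightarrow> (\<integral>\<omega>. complex_of_real (p (V \<omega>)) \<partial>N)"
      unfolding Cs_def by (auto simp: e_def dest!: spec[of _ "\<lambda>_. 0"])
    then have "(\<lambda>n. \<integral>\<omega>. p (X n \<omega>) \<partial>M) \<longlonglongrightarrow> (\<integral>\<omega>. p (V \<omega>) \<partial>N)"
      by (simp add: tendsto_of_real_iff)
    from LIMSEQ_D[OF this eps] obtain n0 where n0:
      "\<And>n. n \<ge> n0 \<Longrightarrow> \<bar>(\<integral>\<omega>. p (X n \<omega>) \<partial>M) - (\<integral>\<omega>. p (V \<omega>) \<partial>N)\<bar> < \<epsilon>"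
      by (auto simp: real_norm_def)
    show "\<exists>n0. \<forall>n\<ge>n0. norm ((\<integral>\<omega>. h (X n \<omega>) \<partial>M) - (\<integral>\<omega>. h (V \<omega>) \<partial>N)) < r"
    proof (intro exI allI impI)
      fix n assume n: "n0 \<le> n"
      have "\<bar>(\<integral>\<omega>. h (X n \<omega>) \<partial>M) - (\<integral>\<omega>. p (X n \<omega>) \<partial>M)\<bar> \<le> 2 * \<epsilon>"
        using X2 by (intro diff M Xm) auto
      moreover have "\<bar>(\<integral>\<omega>. h (V \<omega>) \<partial>N) - (\<integral>\<omega>. p (V \<omega>) \<partial>N)\<bar> \<le> 2 * \<epsilon>"
        using V2 by (intro diff N Vm) auto
      ultimately show "norm ((\<integral>\<omega>. h (X n \<omega>) \<partial>M) - (\<integral>\<omega>. h (V \<omega>) \<partial>N)) < r"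
        using n0[OF n] r unfolding \<epsilon>_def real_norm_def by linarith
    qed
  qed
qed

section \<open>Moments of sums and empirical averages\<close>

lemma AE_summable_of_summable_integral:
  fixes f :: "nat \<Rightarrow> 'a \<Rightarrow> real"
  assumes "\<And>n. integrable M (f n)" "\<And>n \<omega>. 0 \<le> f n \<omega>" "summable (\<lambda>n. \<integral>\<omega>. f n \<omega> \<partial>M)"
  shows "AE \<omega> in M. summable (\<lambda>n. f n \<omega>)"
proof -
  have [measurable]: "f n \<in> borel_measurable M" for n using assms(1) by blast
  have "(\<integral>\<^sup>+\<omega>. (\<Sum>n. ennreal (f n \<omega>)) \<partial>M) = (\<Sum>n. \<integral>\<^sup>+\<omega>. ennreal (f n \<omega>) \<partial>M)"
    by (intro nn_integral_suminf) simp
  also have "\<dots> = (\<Sum>n. ennreal (\<integral>\<omega>. f n \<omega> \<partial>M))"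
    by (intro suminf_cong nn_integral_eq_integral) (auto simp: assms)
  also have "\<dots> = ennreal (\<Sum>n. \<integral>\<omega>. f n \<omega> \<partial>M)"
    by (intro suminf_ennreal2) (auto simp: assms)
  finally have "(\<integral>\<^sup>+\<omega>. (\<Sum>n. ennreal (f n \<omega>)) \<partial>M) \<noteq> \<infinity>" by simp
  then have "AE \<omega> in M. (\<Sum>n. ennreal (f n \<omega>)) \<noteq> \<infinity>"
    by (intro nn_integral_PInf_AE) measurable
  then show ?thesis
  proof eventually_elim
    case (elim \<omega>)
    then show ?case using summable_suminf_not_top[of "\<lambda>n. f n \<omega>"] assms(2) by simp
  qed
qed

text \<open>Induction on \<open>n\<close>, expanding the power of the old sum plus the new term.
  Independence and centring kill every cross term except the one with both exponents even; it is
  absorbed because \<open>6 * n * p^2 \<le> 3 * ((n + 1)^2 - n^2) * p^2\<close>.\<close>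

lemma (in prob_space) moments_of_sum:
  fixes Y :: "nat \<Rightarrow> 'a \<Rightarrow> real"
  assumes ind: "indep_vars (\<lambda>_. borel) Y UNIV"
    and Y1: "\<And>m \<omega>. \<bar>Y m \<omega>\<bar> \<le> 1" and Y0: "\<And>m. expectation (Y m) = 0"
    and Y2: "\<And>m. expectation (\<lambda>\<omega>. (Y m \<omega>)\<^sup>2) \<le> p" and p: "0 \<le> p"
  shows second_moment_of_sum: "expectation (\<lambda>\<omega>. (\<Sum>m<n. Y m \<omega>)\<^sup>2) \<le> n * p"
    and fourth_moment_of_sum: "expectation (\<lambda>\<omega>. (\<Sum>m<n. Y m \<omega>)^4) \<le> n * p + 3 * (n * p)\<^sup>2"
proof -
  have [measurable]: "Y m \<in> borel_measurable M" for m
    using ind by (simp add: indep_vars_def2)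
  define S where "S n \<omega> = (\<Sum>m<n. Y m \<omega>)" for n \<omega>
  have Sm[measurable]: "S n \<in> borel_measurable M" for n
    unfolding S_def by measurable
  have Sb: "\<bar>S n \<omega>\<bar> \<le> n" for n \<omega>
  proof -
    have "\<bar>S n \<omega>\<bar> \<le> (\<Sum>m<n. \<bar>Y m \<omega>\<bar>)" unfolding S_def by (rule sum_abs)
    also have "\<dots> \<le> (\<Sum>m<n. 1)" by (rule sum_mono) (rule Y1)
    finally show ?thesis by simp
  qed
  have ib: "integrable M f" if "f \<in> borel_measurable M" "\<And>\<omega>. \<bar>f \<omega>\<bar> \<le> b" for f :: "'a \<Rightarrow> real" and b
    using that by (intro integrable_const_bound[of _ b]) auto
  have iS: "integrable M (\<lambda>\<omega>. S n \<omega> ^ k)" for n k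
    by (rule ib[of _ "real n ^ k"]) (use Sb in \<open>auto simp: power_abs intro!: power_mono\<close>)
  have iY: "integrable M (\<lambda>\<omega>. Y n \<omega> ^ k)" for n k
    by (rule ib[of _ 1]) (use Y1 in \<open>auto simp: power_abs intro!: power_le_one\<close>)
  have indep: "indep_var borel (Y n) borel (S n)" for n
    unfolding S_def by (rule indep_vars_sum) (auto intro: indep_vars_subset[OF ind])
  have indk: "indep_var borel (\<lambda>\<omega>. Y n \<omega> ^ l) borel (\<lambda>\<omega>. S n \<omega> ^ k)" for n k l
    using indep_var_compose[OF indep[of n], of "\<lambda>x. x ^ l" borel "\<lambda>x. x ^ k" borel]
    by (simp add: comp_def)
  have iSY: "integrable M (\<lambda>\<omega>. S n \<omega> ^ k * Y n \<omega> ^ l)" for n k l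
    using indep_var_integrable[OF indk iY iS] by (simp add: mult.commute)
  have E: "expectation (\<lambda>\<omega>. S n \<omega> ^ k * Y n \<omega> ^ l) = expectation (\<lambda>\<omega>. S n \<omega> ^ k) * expectation (\<lambda>\<omega>. Y n \<omega> ^ l)"
    for n k l using indep_var_lebesgue_integral[OF indk iY iS] by (simp add: mult.commute)
  have S0: "expectation (S n) = 0" for n
    unfolding S_def using iY[of _ 1] by (simp add: Y0)
  have S2: "expectation (\<lambda>\<omega>. (S n \<omega>)\<^sup>2) \<le> n * p" for n
  proof (induction n)
    case (Suc n)
    have "(S (Suc n) \<omega>)\<^sup>2 = S n \<omega> ^ 2 + 2 * (S n \<omega> ^ 1 * Y n \<omega> ^ 1) + Y n \<omega> ^ 2" for \<omega>
      by (simp add: S_def power2_sum)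
    then have "expectation (\<lambda>\<omega>. (S (Suc n) \<omega>)\<^sup>2)
       = expectation (\<lambda>\<omega>. S n \<omega> ^ 2) + 2 * expectation (\<lambda>\<omega>. S n \<omega> ^ 1 * Y n \<omega> ^ 1) + expectation (\<lambda>\<omega>. Y n \<omega> ^ 2)"
      using iS[of n 2] iY[of n 2] iSY[of n 1 1] by simp
    also have "\<dots> = expectation (\<lambda>\<omega>. S n \<omega> ^ 2) + expectation (\<lambda>\<omega>. Y n \<omega> ^ 2)"
      by (subst E) (simp add: Y0)
    finally show ?case using Suc Y2[of n] by (simp add: algebra_simps)
  qed (simp add: S_def)
  have S4: "expectation (\<lambda>\<omega>. (S n \<omega>)^4) \<le> n * p + 3 * (n * p)\<^sup>2" for n
  proof (induction n)
    case (Suc n)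
    have "(S (Suc n) \<omega>)^4 = S n \<omega> ^ 4 + 4 * (S n \<omega> ^ 3 * Y n \<omega> ^ 1) + 6 * (S n \<omega> ^ 2 * Y n \<omega> ^ 2)
        + 4 * (S n \<omega> ^ 1 * Y n \<omega> ^ 3) + Y n \<omega> ^ 4" for \<omega>
      by (simp add: S_def) algebra
    then have "expectation (\<lambda>\<omega>. (S (Suc n) \<omega>)^4)
       = expectation (\<lambda>\<omega>. S n \<omega> ^ 4) + 4 * expectation (\<lambda>\<omega>. S n \<omega> ^ 3 * Y n \<omega> ^ 1)
         + 6 * expectation (\<lambda>\<omega>. S n \<omega> ^ 2 * Y n \<omega> ^ 2) + 4 * expectation (\<lambda>\<omega>. S n \<omega> ^ 1 * Y n \<omega> ^ 3)
         + expectation (\<lambda>\<omega>. Y n \<omega> ^ 4)"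
      using iS[of n 4] iY[of n 4] iSY[of n 3 1] iSY[of n 2 2] iSY[of n 1 3] by simp
    also have "\<dots> = expectation (\<lambda>\<omega>. S n \<omega> ^ 4)
         + 6 * (expectation (\<lambda>\<omega>. S n \<omega> ^ 2) * expectation (\<lambda>\<omega>. Y n \<omega> ^ 2)) + expectation (\<lambda>\<omega>. Y n \<omega> ^ 4)"
      unfolding E by (simp add: Y0 S0)
    also have "\<dots> \<le> (n * p + 3 * (n * p)\<^sup>2) + 6 * ((n * p) * p) + p"
    proof (intro add_mono mult_left_mono mult_mono Suc S2 Y2)
      have "Y n \<omega> ^ 4 \<le> (Y n \<omega>)\<^sup>2" for \<omega>
        using power_decreasing[of 2 4 "\<bar>Y n \<omega>\<bar>"] Y1[of n \<omega>] by (simp add: power_even_abs)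
      then have "expectation (\<lambda>\<omega>. Y n \<omega> ^ 4) \<le> expectation (\<lambda>\<omega>. (Y n \<omega>)\<^sup>2)"
        using iY by (intro integral_mono) auto
      then show "expectation (\<lambda>\<omega>. Y n \<omega> ^ 4) \<le> p" using Y2[of n] by linarith
    qed (use p in \<open>auto intro!: Bochner_Integration.integral_nonneg\<close>)
    also have "\<dots> \<le> real (Suc n) * p + 3 * (real (Suc n) * p)\<^sup>2"
      using p by (simp add: power2_eq_square algebra_simps)
    finally show ?case .
  qed (simp add: S_def)
  show "expectation (\<lambda>\<omega>. (\<Sum>m<n. Y m \<omega>)\<^sup>2) \<le> n * p" using S2[of n] by (simp add: S_def)
  show "expectation (\<lambda>\<omega>. (\<Sum>m<n. Y m \<omega>)^4) \<le> n * p + 3 * (n * p)\<^sup>2"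
    using S4[of n] by (simp add: S_def)
qed

section \<open>Normalised centred sums of functions of an iid sample\<close>

locale iid_sample = prob_space M for M :: "'a measure" +
  fixes \<rho> :: "nat \<Rightarrow> 'a \<Rightarrow> 'x::topological_space"
  assumes indep: "indep_vars (\<lambda>_. borel) \<rho> UNIV"
    and ident: "\<And>m. distr M borel (\<rho> m) = distr M borel (\<rho> 0)"
begin

definition mean :: "('x \<Rightarrow> real) \<Rightarrow> real" where
  "mean g = expectation (\<lambda>\<omega>. g (\<rho> 0 \<omega>))"

text \<open>Indexed by functions instead of times, so that linear combinations of coordinates of the
  empirical process have the same form. For \<open>n = 0\<close> the value is 0.\<close>

definition emp :: "nat \<Rightarrow> ('x \<Rightarrow> real) \<Rightarrow> 'a \<Rightarrow> real" where
  "emp n g \<omega> = (\<Sum>m<n. g (\<rho> m \<omega>) - mean g) / sqrt n"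

lemma rv[measurable]: "\<rho> m \<in> borel_measurable M"
  using indep by (simp add: indep_vars_def2)

lemma emp_measurable[measurable]:
  assumes [measurable]: "g \<in> borel_measurable borel"
  shows "emp n g \<in> borel_measurable M"
  unfolding emp_def by measurable

lemma integrable_sample:
  assumes [measurable]: "g \<in> borel_measurable borel" and "\<And>x. \<bar>g x\<bar> \<le> b"
  shows "integrable M (\<lambda>\<omega>. g (\<rho> m \<omega>) :: real)"
  by (rule integrable_const_bound[of _ b]) (use assms in auto)

lemma expectation_sample:
  assumes [measurable]: "g \<in> borel_measurable borel"
  shows "expectation (\<lambda>\<omega>. g (\<rho> m \<omega>)) = mean g"
proof -
  have "expectation (\<lambda>\<omega>. g (\<rho> m \<omega>)) = (\<integral>x. g x \<partial>distr M borel (\<rho> m))"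
    by (simp add: integral_distr)
  also have "\<dots> = mean g" unfolding ident[of m] mean_def by (simp add: integral_distr)
  finally show ?thesis .
qed

lemma indep_centered:
  assumes [measurable]: "g \<in> borel_measurable borel"
  shows "indep_vars (\<lambda>_. borel) (\<lambda>m \<omega>. g (\<rho> m \<omega>) - mean g) UNIV"
  by (rule indep_vars_compose2[OF indep, of _ "\<lambda>_. borel"]) measurable

text \<open>An indicator with mean at most \<open>p\<close> has variance at most \<open>p\<close>.
  In the fourth moment \<open>3 * p^2\<close> is the Gaussian part, and \<open>p / n\<close> comes
  from the fourth powers of the individual summands.\<close>

lemma emp_moments:
  assumes [measurable]: "g \<in> borel_measurable borel" and g: "\<And>x. g x \<in> {0, 1}" "mean g \<le> p"
  shows emp_second_moment: "expectation (\<lambda>\<omega>. (emp n g \<omega>)\<^sup>2) \<le> p"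
    and emp_fourth_moment: "expectation (\<lambda>\<omega>. emp n g \<omega> ^ 4) \<le> 3 * p\<^sup>2 + p / n"
proof -
  have i: "integrable M (\<lambda>\<omega>. g (\<rho> m \<omega>))" for m
    using g(1) by (intro integrable_sample[of _ 1]) (auto, metis abs_1 abs_zero empty_iff insert_iff le_less zero_le_one)
  have m: "0 \<le> mean g" "mean g \<le> 1"
  proof -
    have b: "0 \<le> g x" "g x \<le> 1" for x using g(1)[of x] by auto
    show "0 \<le> mean g" unfolding mean_def by (intro Bochner_Integration.integral_nonneg b)
    have "mean g \<le> expectation (\<lambda>_. 1)" unfolding mean_def using i b by (intro integral_mono) auto
    then show "mean g \<le> 1" by (simp add: prob_space)
  qed
  then have p: "0 \<le> p" using g(2) by linarith
  have b: "\<bar>g (\<rho> m \<omega>) - mean g\<bar> \<le> 1" for m \<omega> using m g(1)[of "\<rho> m \<omega>"] by auto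
  have 0: "expectation (\<lambda>\<omega>. g (\<rho> m \<omega>) - mean g) = 0" for m
    using i by (simp add: expectation_sample prob_space)
  have "expectation (\<lambda>\<omega>. (g (\<rho> m \<omega>) - mean g)\<^sup>2) \<le> p" for m
  proof -
    have "(g (\<rho> m \<omega>) - mean g)\<^sup>2 = g (\<rho> m \<omega>) * (1 - 2 * mean g) + (mean g)\<^sup>2" for \<omega>
      using g(1)[of "\<rho> m \<omega>"] by (auto simp: power2_eq_square algebra_simps)
    then have "expectation (\<lambda>\<omega>. (g (\<rho> m \<omega>) - mean g)\<^sup>2) = mean g * (1 - 2 * mean g) + (mean g)\<^sup>2"
      using i by (simp add: expectation_sample prob_space)
    also have "\<dots> \<le> mean g" by (simp add: power2_eq_square algebra_simps)
    finally show ?thesis using g(2) by linarith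
  qed
  note moments = indep_centered[OF assms(1)] b 0 this p
  show "expectation (\<lambda>\<omega>. (emp n g \<omega>)\<^sup>2) \<le> p"
    using second_moment_of_sum[OF moments, of n] p
    by (cases "n = 0") (simp_all add: emp_def power_divide field_simps)
  show "expectation (\<lambda>\<omega>. emp n g \<omega> ^ 4) \<le> 3 * p\<^sup>2 + p / n"
  proof (cases "n = 0")
    case False
    have s: "sqrt n ^ 4 = (real n)\<^sup>2"
      by (simp add: power4_eq_xxxx power2_eq_square)
    have "expectation (\<lambda>\<omega>. emp n g \<omega> ^ 4) = expectation (\<lambda>\<omega>. (\<Sum>m<n. g (\<rho> m \<omega>) - mean g) ^ 4) / (real n)\<^sup>2"
      by (simp add: emp_def power_divide s)
    also have "\<dots> \<le> (n * p + 3 * (n * p)\<^sup>2) / (real n)\<^sup>2"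
      using fourth_moment_of_sum[OF moments, of n] by (rule divide_right_mono) simp
    also have "\<dots> = 3 * p\<^sup>2 + p / n" using False by (simp add: field_simps power2_eq_square)
    finally show ?thesis .
  qed (simp add: emp_def)
qed

text \<open>The argument of the characteristic function is absorbed into \<open>g\<close>, since
  \<open>emp\<close> is linear in \<open>g\<close>. The central limit theorem normalises the
  variance to 1, hence the evaluation at \<sigma>; it excludes variance zero, where all summands
  vanish almost surely.\<close>

lemma emp_characteristic_function:
  assumes [measurable]: "g \<in> borel_measurable borel" and b: "\<And>x. \<bar>g x\<bar> \<le> b"
  shows "(\<lambda>n. CLINT \<omega>|M. iexp (emp n g \<omega>))
     \<longlonglongrightarrow> exp (- (mean (\<lambda>x. (g x - mean g)\<^sup>2) / 2))"
proof -
  define v where "v = mean (\<lambda>x. (g x - mean g)\<^sup>2)"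
  have i: "integrable M (\<lambda>\<omega>. g (\<rho> m \<omega>))" for m
    by (rule integrable_sample[of _ b]) (use b in auto)
  have b0: "0 \<le> b" using b[of undefined] by linarith
  have i2: "integrable M (\<lambda>\<omega>. (g (\<rho> m \<omega>) - mean g)\<^sup>2)" for m
  proof (rule integrable_sample[of _ "(b + \<bar>mean g\<bar>)\<^sup>2"])
    fix x show "\<bar>(g x - mean g)\<^sup>2\<bar> \<le> (b + \<bar>mean g\<bar>)\<^sup>2"
      using b[of x] by (simp add: abs_le_square_iff[symmetric])
  qed measurable
  have v: "expectation (\<lambda>\<omega>. (g (\<rho> m \<omega>) - mean g)\<^sup>2) = v" for m
    unfolding v_def by (rule expectation_sample) measurable
  have v0: "0 \<le> v" unfolding v_def mean_def by (intro Bochner_Integration.integral_nonneg) auto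
  have 0: "expectation (\<lambda>\<omega>. g (\<rho> m \<omega>) - mean g) = 0" for m
    using i by (simp add: expectation_sample prob_space)
  show ?thesis
  proof (cases "v = 0")
    case True
    have emp0: "AE \<omega> in M. emp n g \<omega> = 0" for n
    proof -
      have "AE \<omega> in M. (g (\<rho> m \<omega>) - mean g)\<^sup>2 = 0" for m
        using integral_nonneg_eq_0_iff_AE[OF i2] v True by simp
      then have "AE \<omega> in M. \<forall>m. (g (\<rho> m \<omega>) - mean g)\<^sup>2 = 0"
        by (simp add: AE_all_countable)
      then show ?thesis by eventually_elim (simp add: emp_def)
    qed
    have "(CLINT \<omega>|M. iexp (emp n g \<omega>)) = (CLINT \<omega>|M. 1)" for n
    proof (rule integral_cong_AE)
      show "AE \<omega> in M. iexp (emp n g \<omega>) = 1"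
        using emp0[of n] by eventually_elim simp
    qed measurable
    then show ?thesis using True by (simp add: v_def[symmetric] prob_space)
  next
    case False
    define \<sigma> where "\<sigma> = sqrt v"
    have \<sigma>: "\<sigma> > 0" "\<sigma>\<^sup>2 = v" using v0 False by (auto simp: \<sigma>_def)
    have "weak_conv_m (\<lambda>n. distr M borel (\<lambda>x. (\<Sum>i<n. g (\<rho> i x) - mean g) / sqrt (n * \<sigma>\<^sup>2))) std_normal_distribution"
    proof (rule central_limit_theorem_zero_mean)
      show "distr M borel (\<lambda>\<omega>. g (\<rho> m \<omega>) - mean g) = distr (distr M borel (\<rho> 0)) borel (\<lambda>x. g x - mean g)" for m
        unfolding ident[symmetric, of m] by (subst distr_distr) (auto simp: comp_def)
    qed (use indep_centered 0 i2 v \<sigma> in auto)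
    then have "(\<lambda>n. char (distr M borel (\<lambda>x. (\<Sum>i<n. g (\<rho> i x) - mean g) / sqrt (n * \<sigma>\<^sup>2))) \<sigma>) \<longlonglongrightarrow> char std_normal_distribution \<sigma>"
      by (intro levy_continuity1 real_dist_normal_dist real_distribution_distr) measurable
    moreover have "char std_normal_distribution \<sigma> = exp (- (v / 2))"
      by (simp add: char_std_normal_distribution \<sigma>)
    moreover have "char (distr M borel (\<lambda>x. (\<Sum>i<n. g (\<rho> i x) - mean g) / sqrt (n * \<sigma>\<^sup>2))) \<sigma> = (CLINT \<omega>|M. iexp (emp n g \<omega>))" for n
    proof -
      have "\<sigma> * (s / sqrt (n * \<sigma>\<^sup>2)) = s / sqrt n" for s
        using \<sigma>(1) by (simp add: real_sqrt_mult)
      then show ?thesis unfolding char_def emp_def by (subst integral_distr) auto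
    qed
    ultimately show ?thesis by (simp add: v_def)
  qed
qed

end

section \<open>Chaining along dyadic quantiles\<close>

definition dyad :: "nat \<Rightarrow> real \<Rightarrow> real" where
  "dyad l v = of_int \<lfloor>2 ^ l * v\<rfloor> / 2 ^ l"

lemma dyad_le: "dyad l v \<le> v" and less_dyad: "v < dyad l v + 1 / 2 ^ l"
proof -
  have "2 ^ l * v < of_int \<lfloor>2 ^ l * v\<rfloor> + 1" by linarith
  then show "v < dyad l v + 1 / 2 ^ l" by (simp add: dyad_def field_simps)
  have "of_int \<lfloor>2 ^ l * v\<rfloor> \<le> 2 ^ l * v" by linarith
  then show "dyad l v \<le> v" by (simp add: dyad_def field_simps)
qed

lemma dyad_eq_nat:
  assumes "0 \<le> v" "v \<le> 1"
  obtains k :: nat where "k \<le> 2 ^ l" "dyad l v = k / 2 ^ l" "int k = \<lfloor>2 ^ l * v\<rfloor>"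
proof
  have "0 \<le> 2 ^ l * v" "2 ^ l * v < 2 ^ l + 1" using assms by (auto intro: le_less_trans[of _ "2 ^ l"])
  then have "0 \<le> \<lfloor>2 ^ l * v\<rfloor>" "\<lfloor>2 ^ l * v\<rfloor> \<le> 2 ^ l"
    by (simp, simp only: floor_le_iff of_int_power of_int_numeral)
  then show "nat \<lfloor>2 ^ l * v\<rfloor> \<le> 2 ^ l" "dyad l v = nat \<lfloor>2 ^ l * v\<rfloor> / 2 ^ l"
    "int (nat \<lfloor>2 ^ l * v\<rfloor>) = \<lfloor>2 ^ l * v\<rfloor>"
    by (auto simp: dyad_def nat_le_iff)
qed

lemma dyad_range: "0 \<le> v \<Longrightarrow> v \<le> 1 \<Longrightarrow> dyad l v \<in> {0..1}"
  by (rule dyad_eq_nat[of v l]) (auto simp: divide_le_eq)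

text \<open>Here \<open>y\<close> is a function of the quantile level. The cell from
  \<open>1\<close> to \<open>1 + 2^-l\<close> is included: rounding level 1 gives the index
  \<open>2 ^ l\<close>, and the right neighbour of that grid point is used as well.\<close>

context
  fixes y :: "real \<Rightarrow> real" and d :: "nat \<Rightarrow> real"
  assumes incr: "\<And>l k. k \<le> 2 ^ l \<Longrightarrow> \<bar>y ((real k + 1) / 2 ^ l) - y (real k / 2 ^ l)\<bar> \<le> d l"
begin

lemma chain_bound_nonneg: "0 \<le> d l"
  using incr[of 0 l] by linarith

text \<open>Refining the rounding by one level either keeps the point (even index) or moves it by
  one fine cell (odd index).\<close>

lemma chain_step:
  assumes v: "0 \<le> v" "v \<le> 1"
  shows "\<bar>y (dyad (Suc l) v) - y (dyad l v)\<bar> \<le> d (Suc l)"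
proof -
  obtain k where k: "k \<le> 2 ^ l" "dyad l v = k / 2 ^ l" "int k = \<lfloor>2 ^ l * v\<rfloor>"
    using dyad_eq_nat[OF v] by metis
  obtain k' where k': "k' \<le> 2 ^ Suc l" "dyad (Suc l) v = k' / 2 ^ Suc l" "int k' = \<lfloor>2 ^ Suc l * v\<rfloor>"
    using dyad_eq_nat[OF v] by metis
  have "k' = 2 * k \<or> k' = 2 * k + 1"
  proof -
    have "int k \<le> 2 ^ l * v" "2 ^ l * v < int k + 1" using k(3) by linarith+
    then have "2 * int k \<le> 2 ^ Suc l * v" "2 ^ Suc l * v < 2 * int k + 2" by auto
    then have "2 * int k \<le> int k'" "int k' < 2 * int k + 2"
      unfolding k'(3) by linarith+
    then show ?thesis by linarith
  qed
  then show ?thesis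
  proof
    assume "k' = 2 * k"
    then have "dyad (Suc l) v = dyad l v" using k k' by simp
    then show ?thesis using chain_bound_nonneg by simp
  next
    assume *: "k' = 2 * k + 1"
    have "dyad l v = real (2 * k) / 2 ^ Suc l" "dyad (Suc l) v = (real (2 * k) + 1) / 2 ^ Suc l"
      using k k' * by simp_all
    then show ?thesis using incr[of "2 * k" "Suc l"] k(1) by simp
  qed
qed

lemma chain_bound:
  assumes v: "0 \<le> v" "v \<le> 1" and "l \<le> L"
  shows "\<bar>y (dyad L v) - y (dyad l v)\<bar> \<le> (\<Sum>j\<in>{l<..L}. d j)"
  using \<open>l \<le> L\<close>
proof (induction L rule: dec_induct)
  case (step n)
  have "{l<..Suc n} = insert (Suc n) {l<..n}" using step by auto
  then show ?case using chain_step[OF v, of n] step by simp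
qed simp

text \<open>Points at most one cell apart are rounded down to equal or adjacent grid points, so a
  single increment joins them.\<close>

lemma chain_close:
  assumes "0 \<le> w" "w \<le> v" "v \<le> 1" "v - w \<le> 1 / 2 ^ l"
  shows "\<bar>y (dyad l v) - y (dyad l w)\<bar> \<le> d l"
proof -
  obtain k where k: "k \<le> 2 ^ l" "dyad l v = k / 2 ^ l" "int k = \<lfloor>2 ^ l * v\<rfloor>"
    by (rule dyad_eq_nat[of v l]) (use assms in auto)
  obtain m where m: "m \<le> 2 ^ l" "dyad l w = m / 2 ^ l" "int m = \<lfloor>2 ^ l * w\<rfloor>"
    by (rule dyad_eq_nat[of w l]) (use assms in auto)
  have a: "2 ^ l * w \<le> 2 ^ l * v" "2 ^ l * v \<le> 2 ^ l * w + 1"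
    using assms by (auto simp: field_simps)
  have "int m \<le> int k" "int k \<le> int m + 1"
    using floor_mono[OF a(1)] floor_mono[OF a(2)] k m by auto
  then have "k = m \<or> k = m + 1" by linarith
  then show ?thesis
    using k m chain_bound_nonneg[of l] incr[OF m(1)] by (auto simp: add.commute)
qed

end

text \<open>The number \<open>2^(-1/4)\<close>. With \<open>r^4 = 1/2\<close>, fourth moments of
  total order \<open>2^-l\<close> divided by \<open>r^(3 * l)\<close> are of order
  \<open>r^l\<close>, so both terms of \<open>incr_bound\<close> decay at the same rate.\<close>

definition chain_rate :: real where "chain_rate = root 4 (1 / 2)"

lemma chain_rate: "0 < chain_rate" "chain_rate < 1" "chain_rate ^ 4 = 1 / 2"
  unfolding chain_rate_def by (simp, simp, rule real_root_pow_pos) simp_all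

text \<open>For \<open>\<lambda> > 0\<close> every real \<open>a\<close> satisfies \<open>\<bar>a\<bar> \<le> \<lambda> + a^4 / \<lambda>^3\<close>; taking \<open>\<lambda> = chain_rate^l\<close> turns fourth
  moments of order \<open>4^-l\<close> of \<open>2^l\<close> increments into a summable bound of their maximum.\<close>

definition incr_bound :: "(real \<Rightarrow> real) \<Rightarrow> nat \<Rightarrow> real" where
  "incr_bound y l = chain_rate ^ l
     + (\<Sum>k\<le>2 ^ l. (y ((real k + 1) / 2 ^ l) - y (real k / 2 ^ l)) ^ 4) / chain_rate ^ (3 * l)"

lemma abs_le_add_power4:
  fixes a b :: real
  assumes "0 < b"
  shows "\<bar>a\<bar> \<le> b + a ^ 4 / b ^ 3"
proof (cases "\<bar>a\<bar> \<le> b")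
  case False
  have "\<bar>a\<bar> * b ^ 3 \<le> \<bar>a\<bar> * \<bar>a\<bar> ^ 3"
    using False assms by (intro mult_left_mono power_mono) auto
  also have "\<dots> = a ^ 4" by (simp add: power_even_abs flip: power_Suc)
  finally have "\<bar>a\<bar> \<le> a ^ 4 / b ^ 3" using assms by (simp add: field_simps)
  then show ?thesis using assms by linarith
qed (use assms in \<open>simp add: add_increasing2\<close>)

lemma incr_bound:
  assumes "k \<le> 2 ^ l"
  shows "\<bar>y ((real k + 1) / 2 ^ l) - y (real k / 2 ^ l)\<bar> \<le> incr_bound y l"
proof -
  define a where "a k = y ((real k + 1) / 2 ^ l) - y (real k / 2 ^ l)" for k :: nat
  have "\<bar>a k\<bar> \<le> chain_rate ^ l + a k ^ 4 / (chain_rate ^ l) ^ 3"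
    by (rule abs_le_add_power4) (simp add: chain_rate)
  also have "\<dots> \<le> chain_rate ^ l + (\<Sum>k\<le>2 ^ l. a k ^ 4) / (chain_rate ^ l) ^ 3"
    using assms chain_rate(1)
    by (intro add_left_mono divide_right_mono member_le_sum) auto
  finally show ?thesis unfolding incr_bound_def a_def by (simp add: power_mult mult.commute)
qed

text \<open>The \<open>2^l + 1\<close> increments are counted as at most \<open>4 * 2^l\<close>, so
  they contribute \<open>16 * 2^-l = 16 * r^(4 * l)\<close> with \<open>r = chain_rate\<close>.
  Division by \<open>r^(3 * l)\<close> and the deterministic term \<open>r^l\<close> give 17 = 16 +
  1.\<close>

lemma (in prob_space) expectation_incr_bound:
  assumes int: "\<And>k. k \<le> 2 ^ l \<Longrightarrow> integrable M (\<lambda>\<omega>. (Y \<omega> ((real k + 1) / 2 ^ l) - Y \<omega> (real k / 2 ^ l)) ^ 4)"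
    and le: "\<And>k. k \<le> 2 ^ l \<Longrightarrow> expectation (\<lambda>\<omega>. (Y \<omega> ((real k + 1) / 2 ^ l) - Y \<omega> (real k / 2 ^ l)) ^ 4) \<le> 4 / 4 ^ l"
  shows integrable_incr_bound: "integrable M (\<lambda>\<omega>. incr_bound (Y \<omega>) l)"
    and "expectation (\<lambda>\<omega>. incr_bound (Y \<omega>) l) \<le> 17 * chain_rate ^ l"
proof -
  let ?r = "chain_rate"
  show "integrable M (\<lambda>\<omega>. incr_bound (Y \<omega>) l)"
    unfolding incr_bound_def using int
    by (intro Bochner_Integration.integrable_add integrable_divide Bochner_Integration.integrable_sum) auto
  have "expectation (\<lambda>\<omega>. incr_bound (Y \<omega>) l) = ?r ^ l
     + (\<Sum>k\<le>2 ^ l. expectation (\<lambda>\<omega>. (Y \<omega> ((real k + 1) / 2 ^ l) - Y \<omega> (real k / 2 ^ l)) ^ 4)) / ?r ^ (3 * l)"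
    unfolding incr_bound_def using int
    by (subst Bochner_Integration.integral_add)
       (auto intro!: Bochner_Integration.integrable_sum simp: prob_space Bochner_Integration.integral_sum)
  also have "\<dots> \<le> ?r ^ l + (\<Sum>k\<le>(2::nat) ^ l. 4 / 4 ^ l) / ?r ^ (3 * l)"
    using chain_rate(1) by (intro add_left_mono divide_right_mono sum_mono le) auto
  also have "(\<Sum>k\<le>(2::nat) ^ l. 4 / 4 ^ l) = (2 ^ l + 1) * (4 / 4 ^ l :: real)"
    by simp
  also have "\<dots> \<le> (4 * 2 ^ l) * (4 / 4 ^ l)"
  proof (intro mult_right_mono)
    show "2 ^ l + 1 \<le> (4 * 2 ^ l :: real)" using one_le_power[of "2::real" l] by linarith
  qed simp
  also have "(4 * 2 ^ l) * (4 / 4 ^ l :: real) = 16 * (1 / 2) ^ l"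
    by (simp add: power_divide power_mult_distrib[symmetric] field_simps)
  also have "?r ^ l + 16 * (1 / 2) ^ l / ?r ^ (3 * l) = 17 * ?r ^ l"
  proof -
    have "(1 / 2) ^ l = ?r ^ (4 * l)" by (simp add: power_mult chain_rate(3))
    also have "\<dots> = ?r ^ l * ?r ^ (3 * l)" by (simp flip: power_add)
    finally show ?thesis using chain_rate(1) by simp
  qed
  finally show "expectation (\<lambda>\<omega>. incr_bound (Y \<omega>) l) \<le> 17 * ?r ^ l"
    using chain_rate(1) by (simp add: divide_right_mono)
qed

text \<open>For levels in \<open>{0..1}\<close>, \<open>Q v\<close> is the least \<open>t\<close> in
  \<open>{0..T}\<close> with \<open>v \<le> F t\<close>. As continuity is assumed on
  \<open>{0..}\<close> only, \<open>F 0\<close> may be positive (an atom at 0); hence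
  \<open>max (F 0)\<close>. For \<open>v > 1\<close> the value \<open>T\<close> serves as right
  neighbour of the last quantile.\<close>

lemma exists_quantile:
  fixes F :: "real \<Rightarrow> real"
  assumes cont: "continuous_on {0..} F" and mono: "\<And>s t. 0 \<le> s \<Longrightarrow> s \<le> t \<Longrightarrow> F s \<le> F t"
    and F0: "0 \<le> F 0" and FT: "F T = 1" and T: "0 < T"
  shows "\<exists>Q. (\<forall>v. Q v \<in> {0..T}) \<and>
     (\<forall>v\<in>{0..1}. \<forall>t\<in>{0..T}. Q v \<le> t \<longleftrightarrow> v \<le> F t) \<and>
     (\<forall>v\<ge>0. F (Q v) = max (F 0) (min v 1)) \<and> (\<forall>v>1. Q v = T)"
proof -
  have F01: "F 0 \<le> 1" using mono[of 0 T] T FT by simp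
  define P where "P v q \<longleftrightarrow> q \<in> {0..T} \<and> (v \<in> {0..1} \<longrightarrow> (\<forall>t\<in>{0..T}. q \<le> t \<longleftrightarrow> v \<le> F t)) \<and>
     (0 \<le> v \<longrightarrow> F q = max (F 0) (min v 1)) \<and> (1 < v \<longrightarrow> q = T)" for v q
  have "\<exists>q. P v q" for v
  proof (cases "v \<in> {0..1}")
    case False
    then show ?thesis using T FT F01 unfolding P_def by (intro exI[of _ T]) auto
  next
    case v: True
    define S where "S = {t\<in>{0..T}. v \<le> F t}"
    have "S = {0..T} \<inter> F -` {v..}" by (auto simp: S_def)
    moreover have "closed ({0..T} \<inter> F -` {v..})"
      by (rule continuous_closed_preimage[OF continuous_on_subset[OF cont]]) auto
    ultimately have "compact S"
      by (metis Int_lower1 bounded_closed_interval bounded_subset compact_eq_bounded_closed)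
    moreover have "T \<in> S" using v T FT by (auto simp: S_def)
    ultimately obtain q where q: "q \<in> S" "\<And>t. t \<in> S \<Longrightarrow> q \<le> t"
      using compact_attains_inf[of S] by blast
    have gal: "q \<le> t \<longleftrightarrow> v \<le> F t" if "t \<in> {0..T}" for t
      using q mono[of q t] that by (auto simp: S_def)
    \<comment> \<open>Above \<open>F 0\<close> the intermediate value theorem finds a point at or
      before \<open>q\<close> where \<open>F\<close> equals \<open>v\<close>; minimality of
      \<open>q\<close> makes it \<open>q\<close> itself.\<close>
    have "F q = max (F 0) v"
    proof (cases "v \<le> F 0")
      case True
      then have "0 \<in> S" using T by (simp add: S_def)
      then have "q = 0" using q(1) q(2)[of 0] by (simp add: S_def)
      then show ?thesis using True by simp
    next
      case False
      then have "\<exists>x\<ge>0. x \<le> q \<and> F x = v"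
        using q by (intro IVT') (auto simp: S_def intro: continuous_on_subset[OF cont])
      then obtain x where x: "0 \<le> x" "x \<le> q" "F x = v" by blast
      then have "q \<le> x" using q by (intro q(2)) (auto simp: S_def)
      then show ?thesis using x False by (auto simp: max_def)
    qed
    then show ?thesis using v q gal unfolding P_def by (intro exI[of _ q]) (auto simp: S_def)
  qed
  then obtain Q where Q: "\<And>v. P v (Q v)" by metis
  show ?thesis
  proof (intro exI[of _ Q] conjI allI ballI impI)
    fix v
    show "Q v \<in> {0..T}" using Q[of v] unfolding P_def by blast
    show "Q v = T" if "1 < v" using Q[of v] that unfolding P_def by blast
    show "F (Q v) = max (F 0) (min v 1)" if "0 \<le> v" using Q[of v] that unfolding P_def by blast
    show "Q v \<le> t \<longleftrightarrow> v \<le> F t" if "v \<in> {0..1}" "t \<in> {0..T}" for t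
      using Q[of v] that unfolding P_def by blast
  qed
qed

section \<open>Paths of the form increasing part minus drift on the quantile scale\<close>

locale quantile =
  fixes F Q :: "real \<Rightarrow> real" and T :: real
  assumes F_mono: "\<And>s t. 0 \<le> s \<Longrightarrow> s \<le> t \<Longrightarrow> F s \<le> F t"
    and F_range: "\<And>t. 0 \<le> t \<Longrightarrow> F t \<in> {0..1}"
    and Q_range: "\<And>v. Q v \<in> {0..T}"
    and Q_le_iff: "\<And>v t. v \<in> {0..1} \<Longrightarrow> t \<in> {0..T} \<Longrightarrow> Q v \<le> t \<longleftrightarrow> v \<le> F t"
    and F_Q: "\<And>v. 0 \<le> v \<Longrightarrow> F (Q v) = max (F 0) (min v 1)"
    and Q_gt_1: "\<And>v. 1 < v \<Longrightarrow> Q v = T"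
begin

lemma Q_mono:
  assumes "0 \<le> v" "v \<le> w"
  shows "Q v \<le> Q w"
proof (cases "w \<le> 1")
  case True
  then have "v \<le> F (Q w)" using assms by (simp add: F_Q)
  then show ?thesis using Q_le_iff[of v "Q w"] Q_range[of w] assms True by simp
next
  case False
  then show ?thesis using Q_gt_1[of w] Q_range[of v] by simp
qed

lemma F_Q_diff: "0 \<le> v \<Longrightarrow> v \<le> w \<Longrightarrow> F (Q w) - F (Q v) \<le> w - v"
  using F_Q[of v] F_Q[of w] by linarith

lemma F_Q_dyad:
  assumes "0 \<le> t"
  shows "\<bar>F t - F (Q (dyad l (F t)))\<bar> \<le> 1 / 2 ^ l"
proof -
  have d: "dyad l (F t) \<in> {0..1}"
    using F_range[OF assms] by (intro dyad_range) auto
  then have "F (Q (dyad l (F t))) = max (F 0) (dyad l (F t))"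
    by (simp add: F_Q)
  moreover have "F 0 \<le> F t" using assms by (rule F_mono[OF order_refl])
  ultimately show ?thesis
    using dyad_le[of l "F t"] less_dyad[of "F t" l] by linarith
qed

text \<open>\<open>r\<close> stands for the counting part of the empirical process and
  \<open>c\<close> for the size of its drift: \<open>sqrt n\<close> for the normalised process, 1
  for the average.\<close>

context
  fixes x r :: "real \<Rightarrow> real" and c :: real
  assumes r_mono: "\<And>s t. 0 \<le> s \<Longrightarrow> s \<le> t \<Longrightarrow> r s \<le> r t" and c: "0 \<le> c"
    and x: "\<And>t. 0 \<le> t \<Longrightarrow> x t = r t - c * F t"
begin

text \<open>Between consecutive quantiles the monotone part \<open>r\<close> is squeezed, so the path is controlled by its
  values at the quantiles up to the drift \<open>c / 2^L\<close>.\<close>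

lemma path_near_quantile:
  assumes t: "t \<in> {0..T}"
  shows "\<bar>x t - x (Q (dyad L (F t)))\<bar>
    \<le> \<bar>x (Q (dyad L (F t) + 1 / 2 ^ L)) - x (Q (dyad L (F t)))\<bar> + c / 2 ^ L"
proof -
  define v where "v = dyad L (F t)"
  define s where "s = Q v"
  define u where "u = Q (v + 1 / 2 ^ L)"
  have v01: "v \<in> {0..1}" unfolding v_def using F_range t by (intro dyad_range) auto
  have s: "0 \<le> s" "s \<le> t"
    using Q_range Q_le_iff[OF v01 t] dyad_le[of L "F t"] by (auto simp: s_def v_def)
  \<comment> \<open>If \<open>v + 2^-L\<close> exceeds 1 then \<open>u = T\<close>. Otherwise
    \<open>F t < v + 2^-L\<close>, and \<open>Q_le_iff\<close> puts \<open>u\<close> strictly after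
    \<open>t\<close>.\<close>
  have u: "t \<le> u"
  proof (cases "v + 1 / 2 ^ L \<le> 1")
    case True
    then have "\<not> u \<le> t"
      using Q_le_iff[of "v + 1 / 2 ^ L" t] t v01 less_dyad[of "F t" L] by (auto simp: u_def v_def)
    then show ?thesis by simp
  qed (use t Q_gt_1 in \<open>auto simp: u_def\<close>)
  have "F u - F s \<le> 1 / 2 ^ L"
    unfolding u_def s_def using F_Q_diff[of v "v + 1 / 2 ^ L"] v01 by simp
  then have "c * (F u - F s) \<le> c * (1 / 2 ^ L)" using c by (rule mult_left_mono)
  then have cF: "c * F u - c * F s \<le> c / 2 ^ L" by (simp add: algebra_simps)
  have "c * F s \<le> c * F t" "c * F t \<le> c * F u"
    using s u t c by (auto intro!: mult_left_mono F_mono)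
  moreover have "r s \<le> r t" "r t \<le> r u" using s u t by (auto intro!: r_mono)
  ultimately have "\<bar>x t - x s\<bar> \<le> \<bar>x u - x s\<bar> + c / 2 ^ L"
    using x[of s] x[of t] x[of u] s u t cF by simp
  then show ?thesis by (simp add: s_def u_def v_def)
qed

text \<open>Each endpoint is moved to its level-\<open>l\<close> quantile: the squeeze leads to
  level \<open>L\<close>, the chain from there to level \<open>l\<close>. Two endpoints give the
  factor 2. The last \<open>d l\<close> joins the two level-\<open>l\<close> quantiles, whose
  indices are equal or adjacent because the masses differ by at most \<open>2^-l\<close>.\<close>

lemma path_modulus:
  assumes s: "0 \<le> s" "s \<le> t" "t \<le> T" and F: "F t - F s \<le> 1 / 2 ^ l" and L: "l \<le> L"
    and incr: "\<And>l k. k \<le> 2 ^ l \<Longrightarrow> \<bar>x (Q ((real k + 1) / 2 ^ l)) - x (Q (real k / 2 ^ l))\<bar> \<le> d l"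
  shows "\<bar>x t - x s\<bar> \<le> 2 * ((\<Sum>j\<in>{l<..L}. d j) + d L + c / 2 ^ L) + d l"
proof -
  define y where "y v = x (Q v)" for v
  have incr_y: "\<bar>y ((real k + 1) / 2 ^ l) - y (real k / 2 ^ l)\<bar> \<le> d l" if "k \<le> 2 ^ l" for l k
    unfolding y_def using incr[OF that] .
  have near: "\<bar>x t - y (dyad l (F t))\<bar> \<le> (\<Sum>j\<in>{l<..L}. d j) + d L + c / 2 ^ L"
    if t: "t \<in> {0..T}" for t
  proof -
    have F: "0 \<le> F t" "F t \<le> 1" using F_range t by auto
    obtain k :: nat where k: "k \<le> 2 ^ L" "dyad L (F t) = real k / 2 ^ L"
      using dyad_eq_nat[OF F] by metis
    then have "\<bar>y (dyad L (F t) + 1 / 2 ^ L) - y (dyad L (F t))\<bar> \<le> d L"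
      using incr_y[of k L] by (simp add: add_divide_distrib)
    then show ?thesis
      using path_near_quantile[OF t, of L] chain_bound[of y d "F t" l L, OF incr_y F L]
      unfolding y_def by linarith
  qed
  have "\<bar>y (dyad l (F t)) - y (dyad l (F s))\<bar> \<le> d l"
    using F_mono[of s t] s F F_range[of s] F_range[of t]
    by (intro chain_close[of y d, OF incr_y]) auto
  moreover have t: "t \<in> {0..T}" and s: "s \<in> {0..T}" using s by auto
  ultimately show ?thesis using near[OF t] near[OF s] by argo
qed

end
end

section \<open>Gaussian sequences\<close>

lemma (in prob_space) indep_vars_reindex:
  assumes "inj_on f I" "indep_vars M' X (f ` I)"
  shows "indep_vars (\<lambda>i. M' (f i)) (\<lambda>i. X (f i)) I"
  unfolding indep_vars_def2
proof (intro conjI ballI)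
  show "random_variable (M' (f i)) (X (f i))" if "i \<in> I" for i
    using assms that by (auto simp: indep_vars_def2)
  let ?F = "\<lambda>i. {X i -` A \<inter> space M |A. A \<in> sets (M' i)}"
  have F: "indep_sets ?F (f ` I)" using assms by (simp add: indep_vars_def2)
  show "indep_sets (\<lambda>i. ?F (f i)) I"
  proof (rule indep_setsI)
    show "?F (f i) \<subseteq> events" if "i \<in> I" for i
      using F that by (auto simp: indep_sets_def)
  next
    fix A J assume J: "J \<noteq> {}" "J \<subseteq> I" "finite J" and A: "\<forall>j\<in>J. A j \<in> ?F (f j)"
    define B where "B i = A (the_inv_into J f i)" for i
    have inj: "inj_on f J" using assms J by (auto intro: inj_on_subset)
    have B: "B (f j) = A j" if "j \<in> J" for j
      using inj that by (simp add: B_def the_inv_into_f_f)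
    have "prob (\<Inter>j\<in>f ` J. B j) = (\<Prod>j\<in>f ` J. prob (B j))"
      by (rule indep_setsD[OF F]) (use J A B in auto)
    then show "prob (\<Inter>j\<in>J. A j) = (\<Prod>j\<in>J. prob (A j))"
      using inj B by (simp add: prod.reindex)
  qed
qed

text \<open>Stated as an image of the standard normal law instead of a density, so that
  \<open>q = 0\<close>, the point mass at 0, is covered uniformly.\<close>

definition centered_normal :: "'b measure \<Rightarrow> ('b \<Rightarrow> real) \<Rightarrow> real \<Rightarrow> bool" where
  "centered_normal N Y q \<longleftrightarrow> 0 \<le> q \<and> Y \<in> borel_measurable N \<and>
     distr N borel Y = distr std_normal_distribution borel (\<lambda>x. sqrt q * x)"

lemma centered_normal_measurable: "centered_normal N Y q \<Longrightarrow> Y \<in> borel_measurable N"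
  by (simp add: centered_normal_def)

lemma char_scaled_std_normal:
  assumes "0 \<le> q"
  shows "char (distr std_normal_distribution borel (\<lambda>x. sqrt q * x)) u = exp (- (q * u\<^sup>2 / 2))"
proof -
  have "char (distr std_normal_distribution borel (\<lambda>x. sqrt q * x)) u
      = char std_normal_distribution (u * sqrt q)"
    unfolding char_def by (subst integral_distr) (auto simp: mult.assoc)
  then show ?thesis using assms by (simp add: char_std_normal_distribution power_mult_distrib mult.commute)
qed

section \<open>Centred normal variables through their characteristic functions\<close>

context prob_space
begin

lemma centered_normal_char:
  assumes "centered_normal M Y q"
  shows "(CLINT \<omega>|M. iexp (u * Y \<omega>)) = exp (- (q * u\<^sup>2 / 2))"
proof -
  have [measurable]: "Y \<in> borel_measurable M" using assms by (rule centered_normal_measurable)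
  have "(CLINT \<omega>|M. iexp (u * Y \<omega>)) = char (distr M borel Y) u"
    unfolding char_def by (subst integral_distr) auto
  then show ?thesis using assms char_scaled_std_normal[of q u] by (simp add: centered_normal_def)
qed

lemma centered_normalI_char:
  assumes q: "0 \<le> q" and [measurable]: "Y \<in> borel_measurable M"
    and "\<And>u. (CLINT \<omega>|M. iexp (u * Y \<omega>)) = exp (- (q * u\<^sup>2 / 2))"
  shows "centered_normal M Y q"
proof -
  have "char (distr M borel Y) u = (CLINT \<omega>|M. iexp (u * Y \<omega>))" for u
    unfolding char_def by (subst integral_distr) auto
  then have "char (distr M borel Y) = char (distr std_normal_distribution borel (\<lambda>x. sqrt q * x))"
    using assms char_scaled_std_normal[OF q] by (intro ext) metis
  moreover have "real_distribution (distr std_normal_distribution borel (\<lambda>x. sqrt q * x))"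
    by (intro prob_space.real_distribution_distr prob_space_normal_density) auto
  ultimately have "distr M borel Y = distr std_normal_distribution borel (\<lambda>x. sqrt q * x)"
    by (intro Levy_uniqueness real_distribution_distr) auto
  then show ?thesis using assms by (simp add: centered_normal_def)
qed

lemma centered_normal_moments:
  assumes Y: "centered_normal M Y q"
  shows "integrable M (\<lambda>\<omega>. Y \<omega> ^ k)" "expectation Y = 0" "expectation (\<lambda>\<omega>. (Y \<omega>)\<^sup>2) = q"
    "expectation (\<lambda>\<omega>. Y \<omega> ^ 4) = 3 * q\<^sup>2"
proof -
  have [measurable]: "Y \<in> borel_measurable M" using Y by (rule centered_normal_measurable)
  have d: "distr M borel Y = distr std_normal_distribution borel (\<lambda>x. sqrt q * x)" and q: "0 \<le> q"
    using Y by (auto simp: centered_normal_def)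
  have "integrable (distr M borel Y) (\<lambda>x. x ^ k)"
    unfolding d by (subst integrable_distr_eq) (auto simp: power_mult_distrib integrable_std_normal_distribution_moment)
  then show "integrable M (\<lambda>\<omega>. Y \<omega> ^ k)" by (subst (asm) integrable_distr_eq) auto
  have m: "expectation (\<lambda>\<omega>. Y \<omega> ^ k) = sqrt q ^ k * (LINT x|std_normal_distribution. x ^ k)" for k
  proof -
    have "expectation (\<lambda>\<omega>. Y \<omega> ^ k) = (LINT x|distr M borel Y. x ^ k)"
      by (subst integral_distr) auto
    also have "\<dots> = (LINT x|std_normal_distribution. (sqrt q * x) ^ k)"
      unfolding d by (subst integral_distr) auto
    finally show ?thesis by (simp add: power_mult_distrib)
  qed
  show "expectation Y = 0"
    using m[of 1] integral_std_normal_distribution_moment_odd[of 1] by simp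
  show "expectation (\<lambda>\<omega>. (Y \<omega>)\<^sup>2) = q"
    using m[of 2] std_normal_distribution_even_moments(1)[of 1] q by (simp add: fact_numeral)
  have "sqrt q ^ 4 = q\<^sup>2" using q by (simp add: power4_eq_xxxx power2_eq_square)
  then show "expectation (\<lambda>\<omega>. Y \<omega> ^ 4) = 3 * q\<^sup>2"
    using m[of 4] std_normal_distribution_even_moments(1)[of 2] by (simp add: fact_numeral)
qed

lemma centered_normal_imp_gaussian_rv:
  assumes Y: "centered_normal M Y q"
  shows "gaussian_rv M Y"
proof (cases "q = 0")
  case True
  have "AE \<omega> in M. (Y \<omega>)\<^sup>2 = 0"
    using integral_nonneg_eq_0_iff_AE[OF centered_normal_moments(1)[OF Y, of 2]]
      centered_normal_moments(3)[OF Y] True by simp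
  then show ?thesis using centered_normal_measurable[OF Y] by (auto simp: gaussian_rv_def)
next
  case False
  have q: "0 < sqrt q" using Y False by (simp add: centered_normal_def)
  have "distributed std_normal_distribution lborel (\<lambda>x. x) std_normal_density"
    by (auto simp: distributed_def distr_id2)
  from prob_space.normal_density_affine[OF prob_space_normal_density this, of "sqrt q" 0]
  have "distributed std_normal_distribution lborel (\<lambda>x. sqrt q * x) (normal_density 0 (sqrt q))"
    using q by simp
  moreover have "distr M lborel Y = distr std_normal_distribution lborel (\<lambda>x. sqrt q * x)"
    using Y by (simp add: centered_normal_def cong: distr_cong)
  ultimately have "distributed M lborel Y (normal_density 0 (sqrt q))"
    using centered_normal_measurable[OF Y] by (simp add: distributed_def)
  then show ?thesis using q centered_normal_measurable[OF Y] by (auto simp: gaussian_rv_def)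
qed

text \<open>Weak convergence is claimed for every bridge, and of an arbitrary bridge only
  \<open>gaussian_rv\<close> is known; this brings it into the form used here.\<close>

lemma gaussian_rv_imp_centered_normal:
  assumes Y: "gaussian_rv M Y" and 0: "expectation Y = 0"
  shows "centered_normal M Y (expectation (\<lambda>\<omega>. (Y \<omega>)\<^sup>2))"
proof -
  have [measurable]: "Y \<in> borel_measurable M" using Y by (simp add: gaussian_rv_def)
  consider \<mu> where "AE \<omega> in M. Y \<omega> = \<mu>"
    | \<mu> \<sigma> where "\<sigma> > 0" "distributed M lborel Y (\<lambda>x. ennreal (normal_density \<mu> \<sigma> x))"
    using Y by (auto simp: gaussian_rv_def)
  then show ?thesis
  proof cases
    case 1
    have "expectation Y = expectation (\<lambda>_. \<mu>)" by (rule integral_cong_AE) (use 1 in auto)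
    then have [simp]: "\<mu> = 0" using 0 by (simp add: prob_space)
    have "expectation (\<lambda>\<omega>. (Y \<omega>)\<^sup>2) = expectation (\<lambda>_. 0)" by (rule integral_cong_AE) (use 1 in auto)
    moreover have "centered_normal M Y 0"
    proof (rule centered_normalI_char)
      fix u
      have "(CLINT \<omega>|M. iexp (u * Y \<omega>)) = (CLINT \<omega>|M. 1)"
        by (rule integral_cong_AE) (use 1 in auto)
      then show "(CLINT \<omega>|M. iexp (u * Y \<omega>)) = exp (- (0 * u\<^sup>2 / 2))" by (simp add: prob_space)
    qed auto
    ultimately show ?thesis by simp
  next
    case 2
    have [simp]: "\<mu> = 0" using normal_distributed_expectation[OF 2] 0 by simp
    have v: "expectation (\<lambda>\<omega>. (Y \<omega>)\<^sup>2) = \<sigma>\<^sup>2" using normal_distributed_variance[OF 2] 0 by simp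
    have "distributed M lborel (\<lambda>\<omega>. Y \<omega> / \<sigma>) std_normal_density"
      using normal_standard_normal_convert[OF 2(1), of Y \<mu>] 2(2) by simp
    then have d: "distr M lborel (\<lambda>\<omega>. Y \<omega> / \<sigma>) = std_normal_distribution"
      by (simp add: distributed_def)
    have "distr std_normal_distribution borel (\<lambda>x. sqrt (\<sigma>\<^sup>2) * x) = distr M borel Y"
      unfolding d[symmetric] using 2(1) by (subst distr_distr) (auto simp: comp_def)
    then show ?thesis unfolding v by (simp add: centered_normal_def)
  qed
qed

text \<open>Dominated convergence applies to characteristic functions, which have modulus 1; the
  variance of \<open>Z\<close> is thereby identified without interchanging limits and
  moments.\<close>

lemma centered_normal_limit:
  assumes Y: "\<And>n. centered_normal M (Y n) (q n)" and [measurable]: "Z \<in> borel_measurable M"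
    and Z: "AE \<omega> in M. (\<lambda>n. Y n \<omega>) \<longlonglongrightarrow> Z \<omega>" and q: "q \<longlonglongrightarrow> r"
  shows "centered_normal M Z r"
proof (rule centered_normalI_char)
  have [measurable]: "Y n \<in> borel_measurable M" for n using Y by (rule centered_normal_measurable)
  show "0 \<le> r" using q by (rule LIMSEQ_le_const) (use Y in \<open>auto simp: centered_normal_def\<close>)
  fix u
  have "(\<lambda>n. CLINT \<omega>|M. iexp (u * Y n \<omega>)) \<longlonglongrightarrow> (CLINT \<omega>|M. iexp (u * Z \<omega>))"
  proof (rule integral_dominated_convergence[where w = "\<lambda>_. 1"])
    show "AE \<omega> in M. (\<lambda>n. iexp (u * Y n \<omega>)) \<longlonglongrightarrow> iexp (u * Z \<omega>)"
      using Z by eventually_elim (intro tendsto_intros)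
  qed auto
  moreover have "(\<lambda>n. CLINT \<omega>|M. iexp (u * Y n \<omega>)) \<longlonglongrightarrow> complex_of_real (exp (- (r * u\<^sup>2 / 2)))"
    unfolding centered_normal_char[OF Y] by (intro tendsto_intros q) simp_all
  ultimately show "(CLINT \<omega>|M. iexp (u * Z \<omega>)) = exp (- (r * u\<^sup>2 / 2))"
    by (rule LIMSEQ_unique)
qed auto

lemma centered_normal_sum:
  fixes \<zeta> :: "nat \<Rightarrow> 'a \<Rightarrow> real"
  assumes ind: "indep_vars (\<lambda>_. borel) \<zeta> UNIV" and \<zeta>: "\<And>j. centered_normal M (\<zeta> j) 1"
    and A: "finite A"
  shows "centered_normal M (\<lambda>\<omega>. \<Sum>j\<in>A. c j * \<zeta> j \<omega>) (\<Sum>j\<in>A. (c j)\<^sup>2)"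
proof (rule centered_normalI_char)
  have [measurable]: "\<zeta> j \<in> borel_measurable M" for j using \<zeta> by (rule centered_normal_measurable)
  show "(\<lambda>\<omega>. \<Sum>j\<in>A. c j * \<zeta> j \<omega>) \<in> borel_measurable M" by measurable
  show "0 \<le> (\<Sum>j\<in>A. (c j)\<^sup>2)" by (rule sum_nonneg) simp
  fix u
  have ind': "indep_vars (\<lambda>_. borel) (\<lambda>j \<omega>. c j * \<zeta> j \<omega>) A"
    by (rule indep_vars_compose2[OF indep_vars_subset[OF ind], of _ _ "\<lambda>_. borel"]) auto
  have "(CLINT \<omega>|M. iexp (u * (\<Sum>j\<in>A. c j * \<zeta> j \<omega>))) = char (distr M borel (\<lambda>\<omega>. \<Sum>j\<in>A. c j * \<zeta> j \<omega>)) u"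
    unfolding char_def by (subst integral_distr) auto
  also have "\<dots> = (\<Prod>j\<in>A. char (distr M borel (\<lambda>\<omega>. c j * \<zeta> j \<omega>)) u)"
    by (rule char_distr_sum[OF ind'])
  also have "\<dots> = (\<Prod>j\<in>A. complex_of_real (exp (- ((c j)\<^sup>2 * u\<^sup>2 / 2))))"
  proof (rule prod.cong)
    fix j assume "j \<in> A"
    have "char (distr M borel (\<lambda>\<omega>. c j * \<zeta> j \<omega>)) u = (CLINT \<omega>|M. iexp (u * c j * \<zeta> j \<omega>))"
      unfolding char_def by (subst integral_distr) (auto simp: mult.assoc)
    then show "char (distr M borel (\<lambda>\<omega>. c j * \<zeta> j \<omega>)) u = exp (- ((c j)\<^sup>2 * u\<^sup>2 / 2))"
      using centered_normal_char[OF \<zeta>, of "u * c j" j] by (simp add: power_mult_distrib mult.commute)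
  qed simp
  also have "\<dots> = exp (- ((\<Sum>j\<in>A. (c j)\<^sup>2) * u\<^sup>2 / 2))"
    using A by (simp add: exp_sum[symmetric] sum_negf sum_distrib_right sum_divide_distrib flip: of_real_prod)
  finally show "(CLINT \<omega>|M. iexp (u * (\<Sum>j\<in>A. c j * \<zeta> j \<omega>))) = exp (- ((\<Sum>j\<in>A. (c j)\<^sup>2) * u\<^sup>2 / 2))" .
qed

text \<open>Gram--Schmidt: \<open>r j a\<close> is the residual of \<open>g a\<close> after projecting out the first \<open>j\<close> functions.
  Where a residual vanishes, \<open>x / 0 = 0\<close> makes the projection step trivial.\<close>

lemma gram_cholesky:
  fixes g :: "nat \<Rightarrow> 'a \<Rightarrow> real"
  assumes g: "\<And>a. g a \<in> borel_measurable M" "\<And>a. \<exists>b. \<forall>\<omega>. \<bar>g a \<omega>\<bar> \<le> b"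
  shows "\<exists>A :: nat \<Rightarrow> nat \<Rightarrow> real. (\<forall>a j. a < j \<longrightarrow> A a j = 0) \<and>
     (\<forall>a b n. a \<le> n \<longrightarrow> expectation (\<lambda>\<omega>. g a \<omega> * g b \<omega>) = (\<Sum>j\<le>n. A a j * A b j))"
proof -
  define ip where "ip f h = expectation (\<lambda>\<omega>. f \<omega> * h \<omega>)" for f h :: "'a \<Rightarrow> real"
  define r where "r = rec_nat g (\<lambda>j r a \<omega>. r a \<omega> - ip (r a) (r j) / ip (r j) (r j) * r j \<omega>)"
  have r0: "r 0 = g" and rS: "\<And>j a. r (Suc j) a = (\<lambda>\<omega>. r j a \<omega> - ip (r j a) (r j j) / ip (r j j) (r j j) * r j j \<omega>)"
    by (auto simp: r_def)
  define S where "S j a b = ip (r j a) (r j b)" for j a b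
  have S_sym: "S j a b = S j b a" for j a b by (simp add: S_def ip_def mult.commute)
  have r: "r j a \<in> borel_measurable M \<and> (\<exists>b. \<forall>\<omega>. \<bar>r j a \<omega>\<bar> \<le> b)" for j a
  proof (induction j arbitrary: a)
    case (Suc j)
    obtain b where b: "\<And>\<omega>. \<bar>r j a \<omega>\<bar> \<le> b" using Suc[of a] by blast
    obtain b' where b': "\<And>\<omega>. \<bar>r j j \<omega>\<bar> \<le> b'" using Suc[of j] by blast
    let ?c = "ip (r j a) (r j j) / ip (r j j) (r j j)"
    have "\<bar>r j a \<omega> - ?c * r j j \<omega>\<bar> \<le> b + \<bar>?c\<bar> * b'" for \<omega>
    proof -
      have "\<bar>r j a \<omega> - ?c * r j j \<omega>\<bar> \<le> \<bar>r j a \<omega>\<bar> + \<bar>?c\<bar> * \<bar>r j j \<omega>\<bar>"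
        by (metis abs_mult abs_triangle_ineq4)
      also have "\<dots> \<le> b + \<bar>?c\<bar> * b'" by (intro add_mono b mult_left_mono b') simp
      finally show ?thesis .
    qed
    moreover have "r (Suc j) a \<in> borel_measurable M"
      unfolding rS using Suc[of a] Suc[of j] by auto
    ultimately show ?case unfolding rS by blast
  qed (use g r0 in auto)
  have int: "integrable M (\<lambda>\<omega>. r j a \<omega> * r j b \<omega>)" for j a b
  proof -
    obtain c where c: "\<And>\<omega>. \<bar>r j a \<omega>\<bar> \<le> c" using r[of j a] by blast
    obtain c' where c': "\<And>\<omega>. \<bar>r j b \<omega>\<bar> \<le> c'" using r[of j b] by blast
    have "\<bar>r j a \<omega> * r j b \<omega>\<bar> \<le> c * c'" for \<omega>
      unfolding abs_mult by (intro mult_mono' c c') auto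
    then show ?thesis
      using r[of j a] r[of j b] by (intro integrable_const_bound[of _ "c * c'"] borel_measurable_times) auto
  qed
  \<comment> \<open>A residual of norm zero vanishes almost surely and is orthogonal to everything,
    so \<open>S_Suc\<close> remains true when the pivot is 0 and the quotient is
    \<open>x / 0 = 0\<close>.\<close>
  have S_null: "S j a j = 0" if "S j j j = 0" for j a
  proof -
    have "AE \<omega> in M. r j j \<omega> * r j j \<omega> = 0"
      using integral_nonneg_eq_0_iff_AE[OF int[of j j j]] that by (simp add: S_def ip_def)
    then have "AE \<omega> in M. r j a \<omega> * r j j \<omega> = 0" by eventually_elim simp
    then have "expectation (\<lambda>\<omega>. r j a \<omega> * r j j \<omega>) = expectation (\<lambda>\<omega>. 0)"
      using r[of j a] r[of j j] by (intro integral_cong_AE borel_measurable_times) auto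
    then show ?thesis by (simp add: S_def ip_def)
  qed
  \<comment> \<open>One step of Gaussian elimination on the Gram matrix: passage to the Schur
    complement of the pivot \<open>S j j j\<close>.\<close>
  have S_Suc: "S (Suc j) a b = S j a b - S j a j * S j b j / S j j j" for j a b
  proof -
    let ?d = "S j j j"
    have "r (Suc j) a \<omega> * r (Suc j) b \<omega> = r j a \<omega> * r j b \<omega> - S j b j / ?d * (r j a \<omega> * r j j \<omega>)
        - S j a j / ?d * (r j b \<omega> * r j j \<omega>) + S j a j / ?d * (S j b j / ?d) * (r j j \<omega> * r j j \<omega>)" for \<omega>
      unfolding rS S_def by algebra
    then have "S (Suc j) a b = S j a b - S j b j / ?d * S j a j
        - S j a j / ?d * S j b j + S j a j / ?d * (S j b j / ?d) * ?d"
      unfolding S_def ip_def using int by simp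
    then show ?thesis by (cases "?d = 0") simp_all
  qed
  have S_zero: "S j a i = 0" if "i < j" for i j a
    using that
  proof (induction j arbitrary: a)
    case (Suc j)
    show ?case
    proof (cases "i = j")
      case True
      then show ?thesis using S_Suc[of j a j] S_null[of j a] by (cases "S j j j = 0") auto
    next
      case False
      then show ?thesis using S_Suc[of j a i] Suc S_sym[of j i j] by simp
    qed
  qed simp
  \<comment> \<open>Column \<open>j\<close> of the Cholesky factor. Each elimination step subtracts
    the rank-one matrix built from this column, and these subtractions add up in
    \<open>telescope\<close>.\<close>
  define A where "A a j = S j a j / sqrt (S j j j)" for a j
  have pos: "0 \<le> S j j j" for j
    unfolding S_def ip_def by (rule Bochner_Integration.integral_nonneg) auto
  have A_mult: "A a j * A b j = S j a j * S j b j / S j j j" for a b j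
    using pos[of j] by (simp add: A_def)
  have telescope: "S 0 a b = S n a b + (\<Sum>j<n. A a j * A b j)" for a b n
    by (induction n) (auto simp: S_Suc A_mult)
  show ?thesis
  proof (intro exI[of _ A] conjI allI impI)
    fix a j :: nat assume "a < j"
    then show "A a j = 0" using S_zero[of a j j] S_sym[of j a j] by (simp add: A_def)
  next
    fix a b n :: nat assume "a \<le> n"
    then have "S (Suc n) a b = 0" using S_zero[of a "Suc n" b] S_sym[of "Suc n" a b] by simp
    then show "expectation (\<lambda>\<omega>. g a \<omega> * g b \<omega>) = (\<Sum>j\<le>n. A a j * A b j)"
      using telescope[of a b "Suc n"] by (simp add: S_def r0 ip_def lessThan_Suc_atMost)
  qed
qed

end

text \<open>The sample space has the type demanded by the existence claim. Take real-indexed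
  independent random vectors, each with all components equal to one standard normal variable, and
  read off an arbitrary component (\<open>undefined\<close>) at the natural numbers.\<close>

lemma exists_iid_std_normal:
  "\<exists>(N :: (real \<Rightarrow> real ^ 'j) measure) (\<zeta> :: nat \<Rightarrow> _). prob_space N \<and>
     prob_space.indep_vars N (\<lambda>_. borel) \<zeta> UNIV \<and> (\<forall>j. centered_normal N (\<zeta> j) 1)"
proof -
  define \<nu> :: "(real ^ 'j) measure" where "\<nu> = distr std_normal_distribution borel (\<lambda>x. \<chi> i. x)"
  have vm[measurable]: "(\<lambda>x::real. \<chi> i::'j. x) \<in> borel_measurable borel"
    by (intro borel_measurable_continuous_onI continuous_intros)
  have \<nu>: "prob_space \<nu>" unfolding \<nu>_def
    by (intro prob_space.prob_space_distr prob_space_normal_density) measurable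
  define N :: "(real \<Rightarrow> real ^ 'j) measure" where "N = PiM UNIV (\<lambda>_. \<nu>)"
  interpret N: prob_space N unfolding N_def by (intro prob_space_PiM \<nu>)
  have s[measurable_cong]: "sets \<nu> = sets borel" by (simp add: \<nu>_def)
  have c: "(\<lambda>\<omega>. \<omega> x) \<in> measurable N \<nu>" for x
    unfolding N_def by (rule measurable_component_singleton) simp
  have d: "distr N \<nu> (\<lambda>\<omega>. \<omega> x) = \<nu>" for x
    unfolding N_def by (rule distr_PiM_component[OF \<nu>]) simp
  have "N.indep_vars (\<lambda>_. \<nu>) (\<lambda>x \<omega>. \<omega> x) UNIV"
  proof (subst N.indep_vars_iff_distr_eq_PiM')
    show "distr N (PiM UNIV (\<lambda>_. \<nu>)) (\<lambda>\<omega>. \<lambda>i\<in>UNIV. \<omega> i) = PiM UNIV (\<lambda>i. distr N \<nu> (\<lambda>\<omega>. \<omega> i))"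
      unfolding d by (simp add: N_def[symmetric] restrict_def distr_id)
  qed (use c in auto)
  then have "N.indep_vars (\<lambda>_. \<nu>) (\<lambda>x \<omega>. \<omega> x) (range real)"
    by (rule N.indep_vars_subset) simp
  then have "N.indep_vars (\<lambda>_. \<nu>) (\<lambda>j \<omega>. \<omega> (real j)) UNIV"
    by (rule N.indep_vars_reindex[rotated]) (simp add: inj_on_def)
  then have 1: "N.indep_vars (\<lambda>_. borel) (\<lambda>j \<omega>. \<omega> (real j) $ undefined) UNIV"
    by (rule N.indep_vars_compose2) measurable
  have 2: "centered_normal N (\<lambda>\<omega>. \<omega> (real j) $ undefined) 1" for j
  proof -
    have m: "(\<lambda>\<omega>. \<omega> (real j) $ undefined) \<in> borel_measurable N"
      by (rule measurable_compose[OF c]) measurable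
    have "distr N borel (\<lambda>\<omega>. \<omega> (real j) $ undefined) = distr (distr N \<nu> (\<lambda>\<omega>. \<omega> (real j))) borel (\<lambda>v. v $ undefined)"
      by (subst distr_distr[OF _ c]) (auto simp: comp_def)
    also have "\<dots> = distr std_normal_distribution borel (\<lambda>x. x)"
    proof -
      have "(\<lambda>x::real. \<chi> i::'j. x) \<in> measurable std_normal_distribution borel" by measurable
      then show ?thesis unfolding d unfolding \<nu>_def by (subst distr_distr) (auto simp: comp_def)
    qed
    finally show ?thesis using m by (simp add: centered_normal_def)
  qed
  show ?thesis using N.prob_space_axioms 1 2 by blast
qed

text \<open>If the Gram matrix of \<open>g\<close> is \<open>A\<close> times its transpose, then
  \<open>A\<close> applied to independent standard normals has the covariances of \<open>g\<close>.
  As \<open>A\<close> is lower triangular, each variable is a finite sum, so a product measure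
  suffices.\<close>

lemma exists_gaussian_sequence:
  fixes g :: "nat \<Rightarrow> 'a \<Rightarrow> real"
  assumes M: "prob_space M" and g: "\<And>a. g a \<in> borel_measurable M" "\<And>a. \<exists>b. \<forall>\<omega>. \<bar>g a \<omega>\<bar> \<le> b"
  shows "\<exists>(N :: (real \<Rightarrow> real ^ 'j) measure) \<xi>. prob_space N \<and>
     (\<forall>a. \<xi> a \<in> borel_measurable N) \<and>
     (\<forall>S c. finite S \<longrightarrow> centered_normal N (\<lambda>\<omega>. \<Sum>a\<in>S. c a * \<xi> a \<omega>)
        (\<Sum>a\<in>S. \<Sum>b\<in>S. c a * c b * (\<integral>\<omega>. g a \<omega> * g b \<omega> \<partial>M)))"
proof -
  obtain A where A0: "\<And>a j. a < j \<Longrightarrow> A a j = 0"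
    and A: "\<And>a b n. a \<le> n \<Longrightarrow> (\<integral>\<omega>. g a \<omega> * g b \<omega> \<partial>M) = (\<Sum>j\<le>n. A a j * A b j)"
    using prob_space.gram_cholesky[OF M, of g] g by blast
  obtain N :: "(real \<Rightarrow> real ^ 'j) measure" and \<zeta> :: "nat \<Rightarrow> _" where N: "prob_space N"
    and ind: "prob_space.indep_vars N (\<lambda>_. borel) \<zeta> UNIV" and \<zeta>: "\<And>j. centered_normal N (\<zeta> j) 1"
    using exists_iid_std_normal by blast
  interpret N: prob_space N by fact
  define \<xi> where "\<xi> a \<omega> = (\<Sum>j\<le>a. A a j * \<zeta> j \<omega>)" for a \<omega>
  have [measurable]: "\<zeta> j \<in> borel_measurable N" for j using \<zeta> by (rule centered_normal_measurable)
  have "\<xi> a \<in> borel_measurable N" for a unfolding \<xi>_def by measurable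
  moreover have "centered_normal N (\<lambda>\<omega>. \<Sum>a\<in>S. c a * \<xi> a \<omega>)
        (\<Sum>a\<in>S. \<Sum>b\<in>S. c a * c b * (\<integral>\<omega>. g a \<omega> * g b \<omega> \<partial>M))" if S: "finite S" for S c
  proof -
    obtain n where n: "S \<subseteq> {..n}" using S finite_nat_iff_bounded_le by blast
    have "\<xi> a \<omega> = (\<Sum>j\<le>n. A a j * \<zeta> j \<omega>)" if "a \<in> S" for a \<omega>
      unfolding \<xi>_def using n that by (intro sum.mono_neutral_left) (auto simp: A0)
    then have "(\<Sum>a\<in>S. c a * \<xi> a \<omega>) = (\<Sum>a\<in>S. \<Sum>j\<le>n. c a * A a j * \<zeta> j \<omega>)" for \<omega>
      by (simp add: sum_distrib_left mult.assoc)
    then have 1: "(\<Sum>a\<in>S. c a * \<xi> a \<omega>) = (\<Sum>j\<le>n. (\<Sum>a\<in>S. c a * A a j) * \<zeta> j \<omega>)" for \<omega>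
      unfolding sum_distrib_right by (simp only: sum.swap[of _ S])
    have "(\<Sum>j\<le>n. (\<Sum>a\<in>S. c a * A a j)\<^sup>2) = (\<Sum>j\<le>n. \<Sum>a\<in>S. \<Sum>b\<in>S. c a * c b * (A a j * A b j))"
      by (simp add: power2_eq_square sum_product mult_ac)
    also have "\<dots> = (\<Sum>a\<in>S. \<Sum>b\<in>S. \<Sum>j\<le>n. c a * c b * (A a j * A b j))"
      by (rule trans[OF sum.swap]) (intro sum.cong refl sum.swap)
    also have "\<dots> = (\<Sum>a\<in>S. \<Sum>b\<in>S. c a * c b * (\<integral>\<omega>. g a \<omega> * g b \<omega> \<partial>M))"
      using n by (intro sum.cong refl) (auto simp: A[of _ n] sum_distrib_left)
    finally have 2: "(\<Sum>j\<le>n. (\<Sum>a\<in>S. c a * A a j)\<^sup>2)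
        = (\<Sum>a\<in>S. \<Sum>b\<in>S. c a * c b * (\<integral>\<omega>. g a \<omega> * g b \<omega> \<partial>M))" .
    show ?thesis
      unfolding 1 2[symmetric] by (rule N.centered_normal_sum[OF ind \<zeta>]) simp
  qed
  ultimately show ?thesis using N by blast
qed

section \<open>Paths, discretisation and Lipschitz envelopes\<close>

lemma rcll_pathsI:
  assumes "\<And>t. 0 \<le> t \<Longrightarrow> (f \<longlongrightarrow> f t) (at_right t)" "\<And>t. 0 < t \<Longrightarrow> \<exists>l. (f \<longlongrightarrow> l) (at_left t)"
  shows "f \<in> rcll_paths"
  using assms by (auto simp: rcll_paths_def)

lemma rcll_paths_continuous:
  assumes "continuous_on {0..} f"
  shows "f \<in> rcll_paths"
proof (rule rcll_pathsI)
  fix t :: real assume "0 \<le> t"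
  then have "(f \<longlongrightarrow> f t) (at t within {0..})" using assms by (auto simp: continuous_on)
  then show "(f \<longlongrightarrow> f t) (at_right t)"
    by (rule tendsto_within_subset) (use \<open>0 \<le> t\<close> in auto)
next
  fix t :: real assume "0 < t"
  then have "(f \<longlongrightarrow> f t) (at t within {0..})" using assms by (auto simp: continuous_on)
  then have "(f \<longlongrightarrow> f t) (at t within {0..<t})"
    by (rule tendsto_within_subset) auto
  moreover have "at t within {0..<t} = at_left t"
    using \<open>0 < t\<close> by (intro at_within_nhd[of _ "{0<..}"]) auto
  ultimately show "\<exists>l. (f \<longlongrightarrow> l) (at_left t)" by metis
qed

lemma rcll_paths_compose2:
  assumes f: "f \<in> rcll_paths" and g: "g \<in> rcll_paths"
    and h: "\<And>F a b. (f \<longlongrightarrow> a) F \<Longrightarrow> (g \<longlongrightarrow> b) F \<Longrightarrow> ((\<lambda>t. h (f t) (g t)) \<longlongrightarrow> h a b) F"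
  shows "(\<lambda>t. h (f t) (g t)) \<in> rcll_paths"
proof (rule rcll_pathsI)
  fix t :: real assume "0 \<le> t"
  then show "((\<lambda>t. h (f t) (g t)) \<longlongrightarrow> h (f t) (g t)) (at_right t)"
    using f g by (intro h) (auto simp: rcll_paths_def)
next
  fix t :: real assume t: "0 < t"
  obtain a where a: "(f \<longlongrightarrow> a) (at_left t)" using f t unfolding rcll_paths_def by blast
  obtain b where b: "(g \<longlongrightarrow> b) (at_left t)" using g t unfolding rcll_paths_def by blast
  show "\<exists>l. ((\<lambda>t. h (f t) (g t)) \<longlongrightarrow> l) (at_left t)" by (rule exI) (rule h[OF a b])
qed

lemma rcll_paths_linear:
  fixes f g :: "real \<Rightarrow> 'b::real_normed_vector"
  assumes "f \<in> rcll_paths" "g \<in> rcll_paths"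
  shows rcll_paths_diff: "(\<lambda>t. f t - g t) \<in> rcll_paths"
    and rcll_paths_add: "(\<lambda>t. f t + g t) \<in> rcll_paths"
    and rcll_paths_scaleR: "(\<lambda>t. c *\<^sub>R f t) \<in> rcll_paths"
  using assms rcll_paths_compose2[of f g "(-)"] rcll_paths_compose2[of f g "(+)"]
    rcll_paths_compose2[of f g "\<lambda>a _. c *\<^sub>R a"]
  by (simp_all add: tendsto_diff tendsto_add tendsto_scaleR)

lemma rcll_paths_sum:
  fixes f :: "'i \<Rightarrow> real \<Rightarrow> 'b::real_normed_vector"
  assumes "\<And>i. i \<in> A \<Longrightarrow> f i \<in> rcll_paths"
  shows "(\<lambda>t. \<Sum>i\<in>A. f i t) \<in> rcll_paths"
  using assms
proof (induction A rule: infinite_finite_induct)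
  case (insert i A)
  then show ?case by (simp add: rcll_paths_linear)
qed (auto simp: rcll_paths_def)

lemma rcll_paths_vec:
  fixes f :: "'j::finite \<Rightarrow> real \<Rightarrow> real"
  assumes "\<And>i. f i \<in> rcll_paths"
  shows "(\<lambda>t. \<chi> i. f i t) \<in> rcll_paths"
proof (rule rcll_pathsI)
  fix t :: real assume "0 \<le> t"
  then show "((\<lambda>t. \<chi> i. f i t) \<longlongrightarrow> (\<chi> i. f i t)) (at_right t)"
    using assms by (intro tendsto_vec_lambda) (auto simp: rcll_paths_def)
next
  fix t :: real assume "0 < t"
  then have "\<forall>i. \<exists>l. (f i \<longlongrightarrow> l) (at_left t)" using assms by (auto simp: rcll_paths_def)
  then obtain l where l: "\<And>i. (f i \<longlongrightarrow> l i) (at_left t)" by metis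
  show "\<exists>l. ((\<lambda>t. \<chi> i. f i t) \<longlongrightarrow> l) (at_left t)" by (rule exI[of _ "\<chi> i. l i"]) (intro tendsto_vec_lambda l)
qed

lemma rcll_paths_locally_constant:
  assumes "\<And>t. 0 \<le> t \<Longrightarrow> eventually (\<lambda>s. f s = f t) (at_right t)"
    and "\<And>t. 0 < t \<Longrightarrow> \<exists>l. eventually (\<lambda>s. f s = l) (at_left t)"
  shows "f \<in> rcll_paths"
  using assms by (intro rcll_pathsI) (blast intro: tendsto_eventually)+

lemma rcll_paths_of_bool: "(\<lambda>t. of_bool (a \<le> t) :: real) \<in> rcll_paths"
proof (rule rcll_paths_locally_constant)
  fix t :: real
  show "eventually (\<lambda>s. of_bool (a \<le> s) = (of_bool (a \<le> t) :: real)) (at_right t)"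
  proof (cases "a \<le> t")
    case True
    then show ?thesis by (auto simp: eventually_at_right_field intro!: exI[of _ "t + 1"])
  next
    case False
    then show ?thesis by (auto simp: eventually_at_right_field intro!: exI[of _ a])
  qed
  show "\<exists>l::real. eventually (\<lambda>s. of_bool (a \<le> s) = l) (at_left t)"
  proof (cases "a < t")
    case True
    then show ?thesis by (intro exI[of _ 1]) (auto simp: eventually_at_left_field intro!: exI[of _ a])
  next
    case False
    then show ?thesis by (intro exI[of _ 0]) (auto simp: eventually_at_left_field intro!: exI[of _ "t - 1"])
  qed
qed

lemma rcll_paths_stop:
  assumes "f \<in> rcll_paths"
  shows "(\<lambda>t. f (min t T)) \<in> rcll_paths"
proof (rule rcll_pathsI)
  fix t :: real assume t: "0 \<le> t"
  show "((\<lambda>t. f (min t T)) \<longlongrightarrow> f (min t T)) (at_right t)"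
  proof (cases "t < T")
    case True
    then have "eventually (\<lambda>s. f s = f (min s T)) (at_right t)"
      by (auto simp: eventually_at_right_field intro!: exI[of _ T])
    moreover have "(f \<longlongrightarrow> f t) (at_right t)" using assms t by (simp add: rcll_paths_def)
    ultimately show ?thesis using True by (auto intro: Lim_transform_eventually)
  next
    case False
    then have "eventually (\<lambda>s. f (min s T) = f (min t T)) (at_right t)"
      by (auto simp: eventually_at_right_field intro!: exI[of _ "t + 1"])
    then show ?thesis by (rule tendsto_eventually)
  qed
next
  fix t :: real assume t: "0 < t"
  show "\<exists>l. ((\<lambda>t. f (min t T)) \<longlongrightarrow> l) (at_left t)"
  proof (cases "t \<le> T")
    case True
    obtain l where "(f \<longlongrightarrow> l) (at_left t)" using assms t by (auto simp: rcll_paths_def)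
    moreover have "eventually (\<lambda>s. f s = f (min s T)) (at_left t)"
      using True by (auto simp: eventually_at_left_field intro!: exI[of _ "t - 1"])
    ultimately show ?thesis by (blast intro: Lim_transform_eventually)
  next
    case False
    then have "eventually (\<lambda>s. f (min s T) = f T) (at_left t)"
      by (auto simp: eventually_at_left_field intro!: exI[of _ T])
    then show ?thesis by (blast intro: tendsto_eventually)
  qed
qed

section \<open>Continuous functionals and discretised paths\<close>

lemma ucc_continuous_cong:
  assumes "ucc_continuous \<Phi>" "f \<in> rcll_paths" "g \<in> rcll_paths" "\<And>t. 0 \<le> t \<Longrightarrow> f t = g t"
  shows "\<Phi> f = \<Phi> g"
proof (rule ccontr)
  assume "\<Phi> f \<noteq> \<Phi> g"
  then have "\<bar>\<Phi> g - \<Phi> f\<bar> > 0" by simp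
  with assms(1,2) obtain K \<delta> where K: "K \<subseteq> {0..}" "\<delta> > 0"
    "\<forall>g'\<in>rcll_paths. (\<forall>t\<in>K. dist (g' t) (f t) < \<delta>) \<longrightarrow> \<bar>\<Phi> g' - \<Phi> f\<bar> < \<bar>\<Phi> g - \<Phi> f\<bar>"
    unfolding ucc_continuous_def by metis
  moreover have "\<forall>t\<in>K. dist (g t) (f t) < \<delta>" using K assms(4) by auto
  ultimately show False using assms(3) by blast
qed

lemma ucc_continuous_tendsto:
  assumes \<Phi>: "ucc_continuous \<Phi>" and f: "\<And>n. f n \<in> rcll_paths" and g: "g \<in> rcll_paths"
    and lim: "ucc_tendsto f g"
  shows "(\<lambda>n. \<Phi> (f n)) \<longlonglongrightarrow> \<Phi> g"
proof (rule tendstoI)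
  fix e :: real assume "0 < e"
  then obtain K \<delta> where K: "compact K" "K \<subseteq> {0..}" "\<delta> > 0"
    "\<forall>g'\<in>rcll_paths. (\<forall>t\<in>K. dist (g' t) (g t) < \<delta>) \<longrightarrow> \<bar>\<Phi> g' - \<Phi> g\<bar> < e"
    using \<Phi> g unfolding ucc_continuous_def by metis
  have "\<forall>\<^sub>F n in sequentially. \<forall>t\<in>K. dist (f n t) (g t) < \<delta>"
    using lim K by (auto simp: ucc_tendsto_def uniform_limit_iff)
  then show "\<forall>\<^sub>F n in sequentially. dist (\<Phi> (f n)) (\<Phi> g) < e"
    by eventually_elim (use K f in \<open>auto simp: dist_real_def\<close>)
qed

text \<open>The grid of mesh \<open>1 / m\<close> on \<open>[0, m]\<close>, hence the cap
  \<open>m * m\<close>: it is finite, and as \<open>m\<close> grows it becomes dense and exhausts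
  the half-line. Negative times fall into cell 0.\<close>

definition cell :: "nat \<Rightarrow> real \<Rightarrow> nat" where
  "cell m t = min (nat \<lfloor>real m * t\<rfloor>) (m * m)"

definition step_path :: "nat \<Rightarrow> (real \<Rightarrow> 'b) \<Rightarrow> real \<Rightarrow> 'b" where
  "step_path m f t = f (real (cell m t) / real m)"

lemma rcll_paths_cell: "(\<lambda>t. x (cell m t)) \<in> rcll_paths"
proof (cases "m = 0")
  case True
  then show ?thesis by (auto simp: rcll_paths_def cell_def)
next
  case False
  show ?thesis
  proof (rule rcll_paths_locally_constant)
    fix t :: real
    have "eventually (\<lambda>s. \<lfloor>real m * s\<rfloor> = \<lfloor>real m * t\<rfloor>) (at_right t)"
      unfolding eventually_at_right_field
    proof (intro exI[of _ "(of_int \<lfloor>real m * t\<rfloor> + 1) / m"] conjI allI impI)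
      show "t < (of_int \<lfloor>real m * t\<rfloor> + 1) / m" using False by (simp add: field_simps) linarith
      fix s assume s: "t < s" "s < (of_int \<lfloor>real m * t\<rfloor> + 1) / m"
      have "real m * t \<le> real m * s" using s by (intro mult_left_mono) auto
      moreover have "real m * s < of_int \<lfloor>real m * t\<rfloor> + 1" using s False by (simp add: field_simps)
      ultimately show "\<lfloor>real m * s\<rfloor> = \<lfloor>real m * t\<rfloor>" by linarith
    qed
    then show "eventually (\<lambda>s. x (cell m s) = x (cell m t)) (at_right t)"
      by eventually_elim (simp add: cell_def)
    \<comment> \<open>The ceiling minus 1, in place of the floor of \<open>m * t\<close>, is right
      also when \<open>m * t\<close> is an integer and the path jumps at \<open>t\<close>.\<close>
    have "eventually (\<lambda>s. \<lfloor>real m * s\<rfloor> = \<lceil>real m * t\<rceil> - 1) (at_left t)"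
      unfolding eventually_at_left_field
    proof (intro exI[of _ "(of_int \<lceil>real m * t\<rceil> - 1) / m"] conjI allI impI)
      show "(of_int \<lceil>real m * t\<rceil> - 1) / m < t" using False by (simp add: field_simps) linarith
      fix s assume s: "(of_int \<lceil>real m * t\<rceil> - 1) / m < s" "s < t"
      have "real m * s < real m * t" using s False by (intro mult_strict_left_mono) auto
      moreover have "of_int \<lceil>real m * t\<rceil> - 1 < real m * s" using s False by (simp add: field_simps)
      ultimately show "\<lfloor>real m * s\<rfloor> = \<lceil>real m * t\<rceil> - 1" by linarith
    qed
    then have "eventually (\<lambda>s. x (cell m s) = x (min (nat (\<lceil>real m * t\<rceil> - 1)) (m * m))) (at_left t)"
      by eventually_elim (simp add: cell_def)
    then show "\<exists>l. eventually (\<lambda>s. x (cell m s) = l) (at_left t)" by blast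
  qed
qed

lemma rcll_step_path: "step_path m f \<in> rcll_paths"
  using rcll_paths_cell[of "\<lambda>k. f (real k / real m)" m] by (simp add: step_path_def[abs_def])

lemma cell_near:
  assumes "0 < m" "0 \<le> t" "t \<le> m"
  shows "real (cell m t) / m \<le> t" "t - real (cell m t) / m \<le> 1 / m"
proof -
  have "real m * t \<le> real m * real m" using assms by (intro mult_left_mono) auto
  then have "\<lfloor>real m * t\<rfloor> \<le> int (m * m)"
    by (simp add: floor_le_iff)
  then have c: "real (cell m t) = of_int \<lfloor>real m * t\<rfloor>"
    using assms unfolding cell_def by (simp add: min_def nat_le_iff)
  have "real (cell m t) \<le> real m * t" "real m * t - real (cell m t) \<le> 1"
    unfolding c by linarith+
  moreover have "t - real (cell m t) / m = (real m * t - real (cell m t)) / m"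
    using assms(1) by (simp add: diff_divide_distrib)
  ultimately show "real (cell m t) / m \<le> t" "t - real (cell m t) / m \<le> 1 / m"
    using assms(1) by (simp_all add: divide_right_mono divide_le_eq mult.commute)
qed

lemma step_path_tendsto:
  fixes f :: "real \<Rightarrow> 'b::metric_space"
  assumes f: "continuous_on {0..} f"
  shows "ucc_tendsto (\<lambda>m. step_path m f) f"
  unfolding ucc_tendsto_def
proof (intro allI impI)
  fix K :: "real set" assume K: "compact K \<and> K \<subseteq> {0..}"
  then obtain b where b: "\<And>t. t \<in> K \<Longrightarrow> \<bar>t\<bar> \<le> b"
    using compact_imp_bounded[of K] by (auto simp: bounded_iff)
  have "uniformly_continuous_on {0..b} f"
    by (intro compact_uniformly_continuous continuous_on_subset[OF f]) auto
  show "uniform_limit K (\<lambda>m. step_path m f) f sequentially"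
  proof (rule uniform_limitI)
    fix e :: real assume "0 < e"
    then obtain d where d: "d > 0" "\<And>s t. s \<in> {0..b} \<Longrightarrow> t \<in> {0..b} \<Longrightarrow> dist s t < d \<Longrightarrow> dist (f s) (f t) < e"
      using \<open>uniformly_continuous_on {0..b} f\<close> unfolding uniformly_continuous_on_def by metis
    have "\<forall>\<^sub>F m in sequentially. max 1 (max b (2 / d)) \<le> real m"
      by (rule eventually_at_top_linorderI[of "nat \<lceil>max 1 (max b (2 / d))\<rceil>"]) linarith
    then show "\<forall>\<^sub>F m in sequentially. \<forall>t\<in>K. dist (step_path m f t) (f t) < e"
    proof eventually_elim
      case (elim m)
      have m: "0 < m" "b \<le> m" "2 / d \<le> m" using elim by auto
      have md: "1 / m < d" using m d(1) by (simp add: field_simps)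
      show ?case
      proof
        fix t assume t: "t \<in> K"
        have t0: "0 \<le> t" "t \<le> b" using t K b[OF t] by auto
        have "t \<le> m" using t0 m by simp
        from cell_near[OF m(1) t0(1) this] show "dist (step_path m f t) (f t) < e"
          unfolding step_path_def using t0 md by (intro d(2)) (auto simp: dist_real_def abs_if)
      qed
    qed
  qed
qed

text \<open>Rebuilds a step path from its grid values; it turns a path functional into an ordinary
  function of coordinates, to which finite-dimensional convergence applies.\<close>

definition coord_path :: "nat \<Rightarrow> (nat \<times> 'j::finite \<Rightarrow> real) \<Rightarrow> real \<Rightarrow> real ^ 'j" where
  "coord_path m x t = (\<chi> i. x (cell m t, i))"

lemma rcll_coord_path: "coord_path m x \<in> rcll_paths"
  using rcll_paths_cell[of "\<lambda>k. \<chi> i. x (k, i)" m] by (simp add: coord_path_def[abs_def])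

lemma step_path_eq_coord_path:
  fixes f :: "real \<Rightarrow> real ^ 'j::finite"
  shows "step_path m f = coord_path m (\<lambda>(k, i). f (real k / real m) $ i)"
  by (auto simp: step_path_def coord_path_def vec_eq_iff)

text \<open>A step path reads only the indices \<open>k \<le> m * m\<close>; convergence of finitely
  many coordinates is uniform, hence uniform in time.\<close>

lemma continuous_on_coord_path:
  fixes \<Phi> :: "(real \<Rightarrow> real ^ 'j::finite) \<Rightarrow> real"
  assumes \<Phi>: "ucc_continuous \<Phi>"
  shows "continuous_on UNIV (\<lambda>x. \<Phi> (coord_path m x))"
proof (rule continuous_on_sequentiallyI)
  fix x :: "nat \<Rightarrow> nat \<times> 'j \<Rightarrow> real" and a
  assume x: "x \<longlonglongrightarrow> a"
  have coord: "(\<lambda>n. x n k) \<longlonglongrightarrow> a k" for k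
    by (rule continuous_on_tendsto_compose[OF continuous_on_product_coordinates x]) auto
  have "ucc_tendsto (\<lambda>n. coord_path m (x n)) (coord_path m a)"
    unfolding ucc_tendsto_def
  proof (intro allI impI uniform_limitI)
    fix K :: "real set" and e :: real assume e: "0 < e"
    have "\<forall>\<^sub>F n in sequentially. \<forall>k\<in>{..m * m}. dist (\<chi> i. x n (k, i)) (\<chi> i. a (k, i)) < e"
      by (intro eventually_ball_finite ballI tendstoD[OF tendsto_vec_lambda[OF coord] e]) simp
    then show "\<forall>\<^sub>F n in sequentially. \<forall>t\<in>K. dist (coord_path m (x n) t) (coord_path m a t) < e"
      by eventually_elim (auto simp: coord_path_def cell_def)
  qed
  then show "(\<lambda>n. \<Phi> (coord_path m (x n))) \<longlonglongrightarrow> \<Phi> (coord_path m a)"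
    by (intro ucc_continuous_tendsto[OF \<Phi>] rcll_coord_path)
qed

lemma measurable_step_path:
  fixes W :: "real \<Rightarrow> 'b \<Rightarrow> real ^ 'j::finite"
  assumes \<Phi>: "ucc_continuous \<Phi>" and W: "\<And>t. 0 \<le> t \<Longrightarrow> W t \<in> borel_measurable N"
  shows "(\<lambda>\<omega>. \<Phi> (step_path m (\<lambda>t. W t \<omega>))) \<in> borel_measurable N"
proof -
  have "(\<lambda>\<omega> (k, i). W (real k / real m) \<omega> $ i) \<in> borel_measurable N"
  proof (rule measurable_coordinatewise_then_product)
    fix ki :: "nat \<times> 'j"
    have "W (real (fst ki) / real m) \<in> borel_measurable N" by (rule W) simp
    then have "(\<lambda>\<omega>. W (real (fst ki) / real m) \<omega> $ snd ki) \<in> borel_measurable N"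
      by (rule measurable_compose) measurable
    then show "(\<lambda>\<omega>. case ki of (k, i) \<Rightarrow> W (real k / real m) \<omega> $ i) \<in> borel_measurable N"
      by (simp add: case_prod_beta)
  qed
  moreover have "(\<lambda>x. \<Phi> (coord_path m x)) \<in> borel_measurable borel"
    by (rule borel_measurable_continuous_onI[OF continuous_on_coord_path[OF \<Phi>]])
  ultimately show ?thesis unfolding step_path_eq_coord_path by (rule measurable_compose)
qed

text \<open>A continuous path is the locally uniform limit of its discretisations, each a function
  of finitely many coordinates. Thus measurability of the coordinates suffices although the path
  space is not separable.\<close>

lemma measurable_ucc_continuous:
  fixes W :: "real \<Rightarrow> 'b \<Rightarrow> real ^ 'j::finite"
  assumes \<Phi>: "ucc_continuous \<Phi>" and W: "\<And>t. 0 \<le> t \<Longrightarrow> W t \<in> borel_measurable N"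
    and cont: "\<And>\<omega>. \<omega> \<in> space N \<Longrightarrow> continuous_on {0..} (\<lambda>t. W t \<omega>)"
  shows "(\<lambda>\<omega>. \<Phi> (\<lambda>t. W t \<omega>)) \<in> borel_measurable N"
proof (rule borel_measurable_LIMSEQ_real)
  show "(\<lambda>\<omega>. \<Phi> (step_path m (\<lambda>t. W t \<omega>))) \<in> borel_measurable N" for m
    by (rule measurable_step_path[OF \<Phi> W])
  show "(\<lambda>m. \<Phi> (step_path m (\<lambda>t. W t \<omega>))) \<longlonglongrightarrow> \<Phi> (\<lambda>t. W t \<omega>)" if "\<omega> \<in> space N" for \<omega>
    by (intro ucc_continuous_tendsto[OF \<Phi>] rcll_step_path rcll_paths_continuous cont step_path_tendsto that)
qed

text \<open>Sup-convolution: the least \<open>k\<close>-Lipschitz majorant, for the uniform distance on \<open>[0, T]\<close>, of \<open>\<Phi>\<close>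
  applied to the path stopped at \<open>T\<close>.\<close>

definition lip_env :: "((real \<Rightarrow> 'b::metric_space) \<Rightarrow> real) \<Rightarrow> real \<Rightarrow> real \<Rightarrow> (real \<Rightarrow> 'b) \<Rightarrow> real" where
  "lip_env \<Phi> T k f = Sup {\<Phi> (\<lambda>t. g (min t T)) - k * e | g e.
     g \<in> rcll_paths \<and> 0 \<le> e \<and> (\<forall>t\<in>{0..T}. dist (f t) (g t) \<le> e)}"

context
  fixes \<Phi> :: "(real \<Rightarrow> 'b::metric_space) \<Rightarrow> real" and T B :: real
  assumes \<Phi>: "ucc_continuous \<Phi>" and bound: "\<And>f. f \<in> rcll_paths \<Longrightarrow> \<bar>\<Phi> f\<bar> \<le> B" and T: "0 \<le> T"
begin

lemma stop_le: "f \<in> rcll_paths \<Longrightarrow> \<bar>\<Phi> (\<lambda>t. f (min t T))\<bar> \<le> B"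
  by (intro bound rcll_paths_stop)

lemma lip_env_upper:
  assumes "0 \<le> k" "g \<in> rcll_paths" "0 \<le> e" "\<And>t. t \<in> {0..T} \<Longrightarrow> dist (f t) (g t) \<le> e"
  shows "\<Phi> (\<lambda>t. g (min t T)) - k * e \<le> lip_env \<Phi> T k f"
  unfolding lip_env_def
proof (rule cSup_upper)
  show "bdd_above {\<Phi> (\<lambda>t. g (min t T)) - k * e |g e.
     g \<in> rcll_paths \<and> 0 \<le> e \<and> (\<forall>t\<in>{0..T}. dist (f t) (g t) \<le> e)}"
  proof (rule bdd_aboveI[of _ B], safe)
    fix g :: "real \<Rightarrow> 'b" and e :: real assume "g \<in> rcll_paths" "0 \<le> e"
    then show "\<Phi> (\<lambda>t. g (min t T)) - k * e \<le> B"
      using stop_le[of g] mult_nonneg_nonneg[OF \<open>0 \<le> k\<close> \<open>0 \<le> e\<close>] by linarith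
  qed
  show "\<Phi> (\<lambda>t. g (min t T)) - k * e \<in> {\<Phi> (\<lambda>t. g (min t T)) - k * e |g e.
     g \<in> rcll_paths \<and> 0 \<le> e \<and> (\<forall>t\<in>{0..T}. dist (f t) (g t) \<le> e)}"
    by (intro CollectI exI[of _ g] exI[of _ e] conjI refl ballI assms)
qed

lemma lip_env_least:
  assumes f: "f \<in> rcll_paths"
    and "\<And>g e. g \<in> rcll_paths \<Longrightarrow> 0 \<le> e \<Longrightarrow> (\<And>t. t \<in> {0..T} \<Longrightarrow> dist (f t) (g t) \<le> e) \<Longrightarrow>
      \<Phi> (\<lambda>t. g (min t T)) - k * e \<le> c"
  shows "lip_env \<Phi> T k f \<le> c"
  unfolding lip_env_def
proof (rule cSup_least)
  show "{\<Phi> (\<lambda>t. g (min t T)) - k * e |g e.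
     g \<in> rcll_paths \<and> 0 \<le> e \<and> (\<forall>t\<in>{0..T}. dist (f t) (g t) \<le> e)} \<noteq> {}"
    using f by (auto intro!: exI[of _ f] exI[of _ "0::real"])
qed (use assms in auto)

lemma lip_env_ge: "0 \<le> k \<Longrightarrow> f \<in> rcll_paths \<Longrightarrow> \<Phi> (\<lambda>t. f (min t T)) \<le> lip_env \<Phi> T k f"
  using lip_env_upper[of k f 0 f] by simp

lemma lip_env_bound:
  assumes "0 \<le> k" "f \<in> rcll_paths"
  shows "\<bar>lip_env \<Phi> T k f\<bar> \<le> B"
proof -
  have "lip_env \<Phi> T k f \<le> B"
  proof (rule lip_env_least[OF assms(2)])
    fix g :: "real \<Rightarrow> 'b" and e :: real assume "g \<in> rcll_paths" "0 \<le> e"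
    then show "\<Phi> (\<lambda>t. g (min t T)) - k * e \<le> B"
      using stop_le[of g] mult_nonneg_nonneg[OF \<open>0 \<le> k\<close> \<open>0 \<le> e\<close>] by linarith
  qed
  then show ?thesis using lip_env_ge[OF assms] stop_le[OF assms(2)] by linarith
qed

text \<open>A competitor at distance \<open>e\<close> from \<open>f\<close> is one at distance
  \<open>d + e\<close> from \<open>f'\<close>, so the penalties differ by
  \<open>k * d\<close>.\<close>

lemma lip_env_lipschitz:
  assumes k: "0 \<le> k" and f: "f \<in> rcll_paths" and d: "\<And>t. t \<in> {0..T} \<Longrightarrow> dist (f t) (f' t) \<le> d" and "0 \<le> d"
  shows "lip_env \<Phi> T k f \<le> lip_env \<Phi> T k f' + k * d"
proof (rule lip_env_least[OF f])
  fix g :: "real \<Rightarrow> 'b" and e :: real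
  assume g: "g \<in> rcll_paths" "0 \<le> e" "\<And>t. t \<in> {0..T} \<Longrightarrow> dist (f t) (g t) \<le> e"
  have "\<Phi> (\<lambda>t. g (min t T)) - k * (d + e) \<le> lip_env \<Phi> T k f'"
  proof (rule lip_env_upper[OF k g(1)])
    fix t assume t: "t \<in> {0..T}"
    show "dist (f' t) (g t) \<le> d + e"
      using dist_triangle[of "f' t" "g t" "f t"] d[OF t] g(3)[OF t] by (simp add: dist_commute)
  qed (use g \<open>0 \<le> d\<close> in auto)
  then show "\<Phi> (\<lambda>t. g (min t T)) - k * e \<le> lip_env \<Phi> T k f' + k * d"
    by (simp add: algebra_simps)
qed

lemma ucc_continuous_lip_env:
  assumes k: "0 \<le> k"
  shows "ucc_continuous (lip_env \<Phi> T k)"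
  unfolding ucc_continuous_def
proof (intro ballI allI impI)
  fix f :: "real \<Rightarrow> 'b" and \<epsilon> :: real assume f: "f \<in> rcll_paths" and e: "0 < \<epsilon>"
  define \<delta> where "\<delta> = \<epsilon> / (k + 1)"
  have d: "0 < \<delta>" "k * \<delta> < \<epsilon>" using e k by (auto simp: \<delta>_def field_simps)
  show "\<exists>K \<delta>. compact K \<and> K \<subseteq> {0..} \<and> 0 < \<delta> \<and>
     (\<forall>g\<in>rcll_paths. (\<forall>t\<in>K. dist (g t) (f t) < \<delta>) \<longrightarrow> \<bar>lip_env \<Phi> T k g - lip_env \<Phi> T k f\<bar> < \<epsilon>)"
  proof (intro exI[of _ "{0..T}"] exI[of _ \<delta>] conjI ballI impI)
    fix g :: "real \<Rightarrow> 'b" assume g: "g \<in> rcll_paths" and near: "\<forall>t\<in>{0..T}. dist (g t) (f t) < \<delta>"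
    have "lip_env \<Phi> T k g \<le> lip_env \<Phi> T k f + k * \<delta>"
      using near d by (intro lip_env_lipschitz k g) (auto intro: less_imp_le)
    moreover have "lip_env \<Phi> T k f \<le> lip_env \<Phi> T k g + k * \<delta>"
      using near d by (intro lip_env_lipschitz k f) (auto intro: less_imp_le simp: dist_commute)
    ultimately show "\<bar>lip_env \<Phi> T k g - lip_env \<Phi> T k f\<bar> < \<epsilon>" using d by linarith
  qed (use d in auto)
qed

text \<open>Competitors closer than the \<delta> of continuity gain at most \<epsilon>; the others
  pay at least \<open>k * \<delta> \<ge> 2 * B\<close>, the whole range of \<open>\<Phi>\<close>.
  Stopping at \<open>T\<close> brings every point of \<open>K\<close> into \<open>[0, T]\<close>,
  where distances are measured.\<close>

lemma lip_env_tendsto: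
  assumes f: "f \<in> rcll_paths"
  shows "(\<lambda>k::nat. lip_env \<Phi> T (real k) f) \<longlonglongrightarrow> \<Phi> (\<lambda>t. f (min t T))"
proof (rule LIMSEQ_I)
  fix r :: real assume r: "0 < r"
  define \<epsilon> where "\<epsilon> = r / 2"
  have "0 < \<epsilon>" using r by (simp add: \<epsilon>_def)
  then obtain K \<delta> where K: "K \<subseteq> {0..}" "\<delta> > 0"
    "\<forall>g\<in>rcll_paths. (\<forall>t\<in>K. dist (g t) (f (min t T)) < \<delta>) \<longrightarrow> \<bar>\<Phi> g - \<Phi> (\<lambda>t. f (min t T))\<bar> < \<epsilon>"
    using \<Phi> rcll_paths_stop[OF f, of T] unfolding ucc_continuous_def by metis
  have "lip_env \<Phi> T (real k) f \<le> \<Phi> (\<lambda>t. f (min t T)) + \<epsilon>" if k: "2 * B / \<delta> \<le> real k" for k :: nat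
  proof (rule lip_env_least[OF f])
    fix g :: "real \<Rightarrow> 'b" and e :: real
    assume g: "g \<in> rcll_paths" "0 \<le> e" "\<And>t. t \<in> {0..T} \<Longrightarrow> dist (f t) (g t) \<le> e"
    show "\<Phi> (\<lambda>t. g (min t T)) - real k * e \<le> \<Phi> (\<lambda>t. f (min t T)) + \<epsilon>"
    proof (cases "e < \<delta>")
      case True
      have "\<forall>t\<in>K. dist (g (min t T)) (f (min t T)) < \<delta>"
      proof
        fix t assume "t \<in> K"
        then have "min t T \<in> {0..T}" using K(1) T by auto
        then show "dist (g (min t T)) (f (min t T)) < \<delta>" using g(3) True by (metis dist_commute le_less_trans)
      qed
      then have "\<bar>\<Phi> (\<lambda>t. g (min t T)) - \<Phi> (\<lambda>t. f (min t T))\<bar> < \<epsilon>"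
        by (rule mp[OF bspec[OF K(3) rcll_paths_stop[OF g(1)]]])
      moreover have "0 \<le> real k * e" using g by simp
      ultimately show ?thesis by linarith
    next
      case False
      have "2 * B \<le> real k * \<delta>" using k K(2) by (simp add: field_simps)
      also have "\<dots> \<le> real k * e" using False by (intro mult_left_mono) auto
      finally show ?thesis using stop_le[OF g(1)] stop_le[OF f] \<open>0 < \<epsilon>\<close> by linarith
    qed
  qed
  then have "norm (lip_env \<Phi> T (real k) f - \<Phi> (\<lambda>t. f (min t T))) < r" if "nat \<lceil>2 * B / \<delta>\<rceil> \<le> k" for k
  proof -
    have "2 * B / \<delta> \<le> real k" using that by linarith
    then show ?thesis using \<open>2 * B / \<delta> \<le> real k \<Longrightarrow> _\<close> lip_env_ge[of "real k" f] f r by (simp add: \<epsilon>_def)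
  qed
  then show "\<exists>n0. \<forall>k\<ge>n0. norm (lip_env \<Phi> T (real k) f - \<Phi> (\<lambda>t. f (min t T))) < r" by blast
qed

end

section \<open>Outer expectations\<close>

context prob_space
begin

lemma outer_expectation_le:
  assumes U: "integrable M U" "\<And>\<omega>. \<omega> \<in> space M \<Longrightarrow> f \<omega> \<le> U \<omega>"
    and B: "\<And>\<omega>. \<omega> \<in> space M \<Longrightarrow> - B \<le> f \<omega>"
  shows "outer_expectation M f \<le> expectation U"
  unfolding outer_expectation_def
proof (rule cInf_lower)
  show "bdd_below {expectation U |U. integrable M U \<and> (\<forall>\<omega>\<in>space M. f \<omega> \<le> U \<omega>)}"
  proof (rule bdd_belowI[of _ "- B"], safe)
    fix U' assume U': "integrable M U'" "\<forall>\<omega>\<in>space M. f \<omega> \<le> U' \<omega>"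
    have "expectation (\<lambda>_. - B) \<le> expectation U'"
      by (intro integral_mono U') (use B U' in \<open>auto intro: order_trans\<close>)
    then show "- B \<le> expectation U'" by (simp add: prob_space)
  qed
qed (use U in auto)

text \<open>A majorant of \<open>f\<close> plus a majorant of \<open>- f\<close> is nonnegative.
  Hence upper bounds for \<open>\<Phi>\<close> and for \<open>- \<Phi>\<close> enclose the outer
  expectation from both sides.\<close>

lemma outer_expectation_ge:
  assumes "\<And>\<omega>. \<omega> \<in> space M \<Longrightarrow> \<bar>f \<omega>\<bar> \<le> B"
  shows "- outer_expectation M (\<lambda>\<omega>. - f \<omega>) \<le> outer_expectation M f"
  unfolding outer_expectation_def[of M f]
proof (rule cInf_greatest)
  have "integrable M (\<lambda>_. B)" by simp
  then show "{expectation U |U. integrable M U \<and> (\<forall>\<omega>\<in>space M. f \<omega> \<le> U \<omega>)} \<noteq> {}"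
    using assms by (auto intro!: exI[of _ "\<lambda>_. B"] dest: abs_le_D1)
  fix c assume "c \<in> {expectation U |U. integrable M U \<and> (\<forall>\<omega>\<in>space M. f \<omega> \<le> U \<omega>)}"
  then obtain U where U: "c = expectation U" "integrable M U" "\<And>\<omega>. \<omega> \<in> space M \<Longrightarrow> f \<omega> \<le> U \<omega>" by auto
  have "- c \<le> outer_expectation M (\<lambda>\<omega>. - f \<omega>)"
    unfolding outer_expectation_def
  proof (rule cInf_greatest)
    show "{expectation U |U. integrable M U \<and> (\<forall>\<omega>\<in>space M. - f \<omega> \<le> U \<omega>)} \<noteq> {}"
      using assms \<open>integrable M (\<lambda>_. B)\<close> by (auto intro!: exI[of _ "\<lambda>_. B"] dest: abs_le_D2)
    fix d assume "d \<in> {expectation U |U. integrable M U \<and> (\<forall>\<omega>\<in>space M. - f \<omega> \<le> U \<omega>)}"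
    then obtain V where V: "d = expectation V" "integrable M V" "\<And>\<omega>. \<omega> \<in> space M \<Longrightarrow> - f \<omega> \<le> V \<omega>" by auto
    have "expectation (\<lambda>\<omega>. - U \<omega>) \<le> expectation V"
      using U V by (intro integral_mono) force+
    then show "- c \<le> d" using U V by simp
  qed
  then show "- outer_expectation M (\<lambda>\<omega>. - f \<omega>) \<le> c" by linarith
qed

end

text \<open>An integrable majorant \<open>U n\<close> stands in for the supremum of the
  discretisation error over all times: it is what an upper bound of an outer expectation uses, and
  measurability of the supremum does not arise.\<close>

definition modulus_dominated ::
  "'a measure \<Rightarrow> (nat \<Rightarrow> real \<Rightarrow> 'a \<Rightarrow> 'b::metric_space) \<Rightarrow> real \<Rightarrow> nat \<Rightarrow> real \<Rightarrow> bool" where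
  "modulus_dominated M X T m \<epsilon> \<longleftrightarrow> (\<exists>U. \<forall>\<^sub>F n in sequentially. integrable M (U n) \<and>
     (\<forall>\<omega>\<in>space M. \<forall>t\<in>{0..T}. dist (X n t \<omega>) (step_path m (\<lambda>t. X n t \<omega>) t) \<le> U n \<omega>) \<and>
     (\<integral>\<omega>. U n \<omega> \<partial>M) \<le> \<epsilon>)"

section \<open>Finite-dimensional convergence and a small modulus imply weak convergence\<close>

locale ucc_weak_convergence = M: prob_space M + N: prob_space N
  for M :: "'a measure" and N :: "'b measure" +
  fixes X :: "nat \<Rightarrow> real \<Rightarrow> 'a \<Rightarrow> real ^ 'j::finite" and W :: "real \<Rightarrow> 'b \<Rightarrow> real ^ 'j"
    and T :: real
  assumes T: "0 \<le> T"
    and mX: "\<And>n t. 0 \<le> t \<Longrightarrow> X n t \<in> borel_measurable M"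
    and rX: "\<And>n \<omega>. \<omega> \<in> space M \<Longrightarrow> (\<lambda>t. X n t \<omega>) \<in> rcll_paths"
    and mW: "\<And>t. 0 \<le> t \<Longrightarrow> W t \<in> borel_measurable N"
    and cW: "\<And>\<omega>. \<omega> \<in> space N \<Longrightarrow> continuous_on {0..} (\<lambda>t. W t \<omega>)"
    and XT: "\<And>n t \<omega>. \<omega> \<in> space M \<Longrightarrow> T \<le> t \<Longrightarrow> X n t \<omega> = X n T \<omega>"
    and WT: "AE \<omega> in N. \<forall>t\<ge>T. W t \<omega> = W T \<omega>"
    and fidi: "\<And>m (h :: (nat \<times> 'j \<Rightarrow> real) \<Rightarrow> real) B. continuous_on UNIV h \<Longrightarrow> (\<And>x. \<bar>h x\<bar> \<le> B) \<Longrightarrow>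
        (\<And>x y. (\<And>k i. k \<le> m * m \<Longrightarrow> x (k, i) = y (k, i)) \<Longrightarrow> h x = h y) \<Longrightarrow>
        (\<lambda>n. \<integral>\<omega>. h (\<lambda>(k, i). X n (real k / real m) \<omega> $ i) \<partial>M)
           \<longlonglongrightarrow> (\<integral>\<omega>. h (\<lambda>(k, i). W (real k / real m) \<omega> $ i) \<partial>N)"
    and tight: "\<And>\<epsilon>. 0 < \<epsilon> \<Longrightarrow> \<forall>\<^sub>F m in sequentially. modulus_dominated M X T m \<epsilon>"
begin

text \<open>Four errors of \<open>\<epsilon> / 4\<close>: the envelope and then the grid, both for
  \<open>W\<close>; the convergence of the discretised means; and \<open>k\<close> times the mean
  modulus of \<open>X n\<close>. The order matters: \<open>k\<close> depends on \<open>W\<close>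
  alone, the mesh \<open>m\<close> is adapted to \<open>k\<close>, and only then does
  \<open>n\<close> grow.\<close>

lemma upper_bound:
  assumes \<Phi>: "ucc_continuous \<Phi>" and B: "\<And>f. f \<in> rcll_paths \<Longrightarrow> \<bar>\<Phi> f\<bar> \<le> B"
    and \<epsilon>: "0 < \<epsilon>"
  shows "\<forall>\<^sub>F n in sequentially. outer_expectation M (\<lambda>\<omega>. \<Phi> (\<lambda>t. X n t \<omega>)) \<le> (\<integral>\<omega>. \<Phi> (\<lambda>t. W t \<omega>) \<partial>N) + \<epsilon>"
proof -
  let ?E = "\<lambda>k. lip_env \<Phi> T k"
  note env_cont = ucc_continuous_lip_env[OF \<Phi> B T]
  note env_bound = lip_env_bound[OF \<Phi> B T]
  have rW: "(\<lambda>t. W t \<omega>) \<in> rcll_paths" if "\<omega> \<in> space N" for \<omega>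
    by (rule rcll_paths_continuous[OF cW[OF that]])
  have mEW: "(\<lambda>\<omega>. ?E (real k) (\<lambda>t. W t \<omega>)) \<in> borel_measurable N" for k :: nat
    by (rule measurable_ucc_continuous[OF env_cont mW cW]) auto
  have mW0: "(\<lambda>\<omega>. \<Phi> (\<lambda>t. W t \<omega>)) \<in> borel_measurable N"
    by (rule measurable_ucc_continuous[OF \<Phi> mW cW])
  have "(\<lambda>k. \<integral>\<omega>. ?E (real k) (\<lambda>t. W t \<omega>) \<partial>N) \<longlonglongrightarrow> (\<integral>\<omega>. \<Phi> (\<lambda>t. W t \<omega>) \<partial>N)"
  proof (rule integral_dominated_convergence[where w = "\<lambda>_. B"])
    show "AE \<omega> in N. (\<lambda>k. ?E (real k) (\<lambda>t. W t \<omega>)) \<longlonglongrightarrow> \<Phi> (\<lambda>t. W t \<omega>)"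
    proof (rule AE_mp[OF WT AE_I2], intro impI)
      fix \<omega> assume elim: "\<forall>t\<ge>T. W t \<omega> = W T \<omega>" "\<omega> \<in> space N"
      \<comment> \<open>The envelopes converge to \<open>\<Phi>\<close> of the stopped path, and
        almost every path of \<open>W\<close> is constant after \<open>T\<close>.\<close>
      have "\<Phi> (\<lambda>t. W (min t T) \<omega>) = \<Phi> (\<lambda>t. W t \<omega>)"
      proof (rule ucc_continuous_cong[OF \<Phi>])
        show "(\<lambda>t. W (min t T) \<omega>) \<in> rcll_paths" by (rule rcll_paths_stop[OF rW[OF elim(2)]])
        show "W (min t T) \<omega> = W t \<omega>" for t
          using elim(1)[rule_format, of t] by (cases "t \<le> T") auto
      qed (rule rW[OF elim(2)])
      then show "(\<lambda>k. ?E (real k) (\<lambda>t. W t \<omega>)) \<longlonglongrightarrow> \<Phi> (\<lambda>t. W t \<omega>)"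
        using lip_env_tendsto[OF \<Phi> B T rW[OF elim(2)]] by simp
    qed
    show "AE \<omega> in N. norm (?E (real k) (\<lambda>t. W t \<omega>)) \<le> B" for k
      by (rule AE_I2) (simp add: env_bound rW)
  qed (use mEW mW0 in auto)
  from tendstoD[OF this, of "\<epsilon> / 4"] \<epsilon>
  have "\<forall>\<^sub>F k in sequentially. dist (\<integral>\<omega>. ?E (real k) (\<lambda>t. W t \<omega>) \<partial>N) (\<integral>\<omega>. \<Phi> (\<lambda>t. W t \<omega>) \<partial>N) < \<epsilon> / 4 \<and> 0 < k"
    by (simp add: eventually_conj eventually_gt_at_top)
  then obtain k :: nat where k: "0 < k"
    and Ek: "(\<integral>\<omega>. ?E (real k) (\<lambda>t. W t \<omega>) \<partial>N) \<le> (\<integral>\<omega>. \<Phi> (\<lambda>t. W t \<omega>) \<partial>N) + \<epsilon> / 4"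
    by (auto simp: dist_real_def abs_if eventually_sequentially split: if_splits)
  have k0: "0 \<le> real k" by simp
  let ?W = "\<lambda>m. \<integral>\<omega>. ?E k (step_path m (\<lambda>t. W t \<omega>)) \<partial>N"
  let ?X = "\<lambda>m n. \<integral>\<omega>. ?E k (step_path m (\<lambda>t. X n t \<omega>)) \<partial>M"
  have "?W \<longlonglongrightarrow> (\<integral>\<omega>. ?E k (\<lambda>t. W t \<omega>) \<partial>N)"
  proof (rule integral_dominated_convergence[where w = "\<lambda>_. B"])
    show "AE \<omega> in N. (\<lambda>m. ?E k (step_path m (\<lambda>t. W t \<omega>))) \<longlonglongrightarrow> ?E k (\<lambda>t. W t \<omega>)"
      by (rule AE_I2) (intro ucc_continuous_tendsto[OF env_cont[OF _ k0]] rcll_step_path rW step_path_tendsto cW)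
    show "AE \<omega> in N. norm (?E k (step_path m (\<lambda>t. W t \<omega>))) \<le> B" for m
      by (rule AE_I2) (simp add: env_bound rcll_step_path)
    show "(\<lambda>\<omega>. ?E k (step_path m (\<lambda>t. W t \<omega>))) \<in> borel_measurable N" for m
      by (rule measurable_step_path[OF env_cont mW]) auto
  qed (use mEW in auto)
  from tendstoD[OF this, of "\<epsilon> / 4"] \<epsilon>
  have "\<forall>\<^sub>F m in sequentially. dist (?W m) (\<integral>\<omega>. ?E k (\<lambda>t. W t \<omega>) \<partial>N) < \<epsilon> / 4" by simp
  moreover have "0 < \<epsilon> / (4 * real k)" using \<epsilon> k by simp
  note tight[OF this]
  ultimately have "\<forall>\<^sub>F m in sequentially. dist (?W m) (\<integral>\<omega>. ?E k (\<lambda>t. W t \<omega>) \<partial>N) < \<epsilon> / 4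
     \<and> modulus_dominated M X T m (\<epsilon> / (4 * real k))"
    by (rule eventually_conj)
  from eventually_happens'[OF sequentially_bot this] obtain m U where
    dm: "dist (?W m) (\<integral>\<omega>. ?E k (\<lambda>t. W t \<omega>) \<partial>N) < \<epsilon> / 4"
    and U: "\<forall>\<^sub>F n in sequentially. integrable M (U n) \<and>
      (\<forall>\<omega>\<in>space M. \<forall>t\<in>{0..T}. dist (X n t \<omega>) (step_path m (\<lambda>t. X n t \<omega>) t) \<le> U n \<omega>) \<and>
      (\<integral>\<omega>. U n \<omega> \<partial>M) \<le> \<epsilon> / (4 * real k)"
    unfolding modulus_dominated_def by blast
  have Em: "?W m \<le> (\<integral>\<omega>. ?E k (\<lambda>t. W t \<omega>) \<partial>N) + \<epsilon> / 4"
    using dm unfolding dist_real_def by linarith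
  have mEX: "(\<lambda>\<omega>. ?E k (step_path m (\<lambda>t. X n t \<omega>))) \<in> borel_measurable M" for n
    by (rule measurable_step_path[OF env_cont mX]) auto
  have iEX: "integrable M (\<lambda>\<omega>. ?E k (step_path m (\<lambda>t. X n t \<omega>)))" for n
    by (rule M.integrable_const_bound[of _ B]) (auto simp: mEX env_bound rcll_step_path)
  have "?X m \<longlonglongrightarrow> ?W m"
    unfolding step_path_eq_coord_path
  proof (rule fidi[of "\<lambda>x. ?E k (coord_path m x)" B m])
    show "continuous_on UNIV (\<lambda>x. ?E k (coord_path m x))"
      by (rule continuous_on_coord_path[OF env_cont]) auto
    show "\<bar>?E k (coord_path m x)\<bar> \<le> B" for x
      by (rule env_bound) (auto simp: rcll_coord_path)
    show "?E k (coord_path m x) = ?E k (coord_path m y)"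
      if "\<And>k i. k \<le> m * m \<Longrightarrow> x (k, i) = y (k, i)" for x y :: "nat \<times> 'j \<Rightarrow> real"
    proof -
      have "coord_path m x = coord_path m y"
        using that by (auto simp: coord_path_def cell_def fun_eq_iff vec_eq_iff)
      then show ?thesis by simp
    qed
  qed
  from tendstoD[OF this, of "\<epsilon> / 4"] \<epsilon>
  have "\<forall>\<^sub>F n in sequentially. dist (?X m n) (?W m) < \<epsilon> / 4" by simp
  then show ?thesis
    using U
  proof eventually_elim
    case (elim n)
    then have U: "integrable M (U n)" "\<And>\<omega> t. \<omega> \<in> space M \<Longrightarrow> t \<in> {0..T} \<Longrightarrow>
        dist (X n t \<omega>) (step_path m (\<lambda>t. X n t \<omega>) t) \<le> U n \<omega>" "(\<integral>\<omega>. U n \<omega> \<partial>M) \<le> \<epsilon> / (4 * real k)"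
      by auto
    have "outer_expectation M (\<lambda>\<omega>. \<Phi> (\<lambda>t. X n t \<omega>))
        \<le> (\<integral>\<omega>. ?E k (step_path m (\<lambda>t. X n t \<omega>)) + real k * U n \<omega> \<partial>M)"
    proof (rule M.outer_expectation_le)
      fix \<omega> assume \<omega>: "\<omega> \<in> space M"
      have "\<Phi> (\<lambda>t. X n t \<omega>) = \<Phi> (\<lambda>t. X n (min t T) \<omega>)"
      proof (rule ucc_continuous_cong[OF \<Phi>])
        show "(\<lambda>t. X n (min t T) \<omega>) \<in> rcll_paths" by (rule rcll_paths_stop[OF rX[OF \<omega>]])
        show "X n t \<omega> = X n (min t T) \<omega>" for t
          using XT[OF \<omega>, of t n] by (cases "t \<le> T") auto
      qed (rule rX[OF \<omega>])
      also have "\<dots> \<le> ?E k (\<lambda>t. X n t \<omega>)"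
        by (rule lip_env_ge[OF \<Phi> B T]) (auto simp: rX \<omega>)
      also have "\<dots> \<le> ?E k (step_path m (\<lambda>t. X n t \<omega>)) + real k * U n \<omega>"
      proof (rule lip_env_lipschitz[OF \<Phi> B T])
        have "0 \<le> dist (X n T \<omega>) (step_path m (\<lambda>t. X n t \<omega>) T)" by simp
        also have "\<dots> \<le> U n \<omega>" using U(2)[OF \<omega>, of T] T by simp
        finally show "0 \<le> U n \<omega>" .
      qed (auto simp: rX \<omega> intro!: U(2))
      finally show "\<Phi> (\<lambda>t. X n t \<omega>) \<le> ?E k (step_path m (\<lambda>t. X n t \<omega>)) + real k * U n \<omega>" .
      show "- B \<le> \<Phi> (\<lambda>t. X n t \<omega>)" using B[OF rX[OF \<omega>, of n]] by linarith
    qed (use iEX U in auto)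
    also have "\<dots> = ?X m n + real k * (\<integral>\<omega>. U n \<omega> \<partial>M)"
      using iEX U by simp
    also have "real k * (\<integral>\<omega>. U n \<omega> \<partial>M) \<le> real k * (\<epsilon> / (4 * real k))"
      using U(3) by (intro mult_left_mono) auto
    also have "real k * (\<epsilon> / (4 * real k)) = \<epsilon> / 4" using k by simp
    finally have "outer_expectation M (\<lambda>\<omega>. \<Phi> (\<lambda>t. X n t \<omega>)) \<le> ?X m n + \<epsilon> / 4"
      by simp
    moreover have "?X m n \<le> ?W m + \<epsilon> / 4"
      using elim(1) unfolding dist_real_def by linarith
    ultimately show ?case using Em Ek by linarith
  qed
qed

theorem weakly_converges_ucc: "weakly_converges_ucc M X N W"
  unfolding weakly_converges_ucc_def
proof (intro conjI allI ballI impI)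
  show "(\<lambda>t. X n t \<omega>) \<in> rcll_paths" if "\<omega> \<in> space M" for n \<omega> by (rule rX[OF that])
  show rW: "(\<lambda>t. W t \<omega>) \<in> rcll_paths" if "\<omega> \<in> space N" for \<omega>
    by (rule rcll_paths_continuous[OF cW[OF that]])
  fix \<Phi> :: "(real \<Rightarrow> real ^ 'j) \<Rightarrow> real"
  assume "bounded (\<Phi> ` rcll_paths) \<and> ucc_continuous \<Phi>"
  then obtain B where \<Phi>: "ucc_continuous \<Phi>" and B: "\<And>f. f \<in> rcll_paths \<Longrightarrow> \<bar>\<Phi> f\<bar> \<le> B"
    by (auto simp: bounded_iff)
  show "(\<lambda>\<omega>. \<Phi> (\<lambda>t. W t \<omega>)) \<in> borel_measurable N"
    by (rule measurable_ucc_continuous[OF \<Phi> mW cW])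
  have \<Phi>': "ucc_continuous (\<lambda>f. - \<Phi> f)"
    using \<Phi> unfolding ucc_continuous_def by (simp add: abs_minus_commute)
  show "(\<lambda>n. outer_expectation M (\<lambda>\<omega>. \<Phi> (\<lambda>t. X n t \<omega>))) \<longlonglongrightarrow> (\<integral>\<omega>. \<Phi> (\<lambda>t. W t \<omega>) \<partial>N)"
  proof (rule tendstoI)
    fix e :: real assume e: "0 < e"
    have 1: "\<forall>\<^sub>F n in sequentially. outer_expectation M (\<lambda>\<omega>. \<Phi> (\<lambda>t. X n t \<omega>)) \<le> (\<integral>\<omega>. \<Phi> (\<lambda>t. W t \<omega>) \<partial>N) + e / 2"
      by (rule upper_bound[OF \<Phi> B]) (use e in auto)
    have 2: "\<forall>\<^sub>F n in sequentially. outer_expectation M (\<lambda>\<omega>. - \<Phi> (\<lambda>t. X n t \<omega>)) \<le> (\<integral>\<omega>. - \<Phi> (\<lambda>t. W t \<omega>) \<partial>N) + e / 2"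
      by (rule upper_bound[OF \<Phi>', of B]) (use e B in auto)
    from 1 2 show "\<forall>\<^sub>F n in sequentially. dist (outer_expectation M (\<lambda>\<omega>. \<Phi> (\<lambda>t. X n t \<omega>))) (\<integral>\<omega>. \<Phi> (\<lambda>t. W t \<omega>) \<partial>N) < e"
    proof eventually_elim
      case (elim n)
      have "- outer_expectation M (\<lambda>\<omega>. - \<Phi> (\<lambda>t. X n t \<omega>)) \<le> outer_expectation M (\<lambda>\<omega>. \<Phi> (\<lambda>t. X n t \<omega>))"
        by (rule M.outer_expectation_ge) (rule B[OF rX])
      then show ?case using elim e by (simp add: dist_real_def)
    qed
  qed
qed

end

section \<open>Oscillation of the empirical process\<close>

lemma dist_vec_le_sum_abs: "dist x y \<le> (\<Sum>i\<in>UNIV. \<bar>x $ i - y $ i\<bar>)" for x y :: "real ^ 'j"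
  using norm_le_l1_cart[of "x - y"] by (simp add: dist_norm)

definition below :: "'j \<Rightarrow> real \<Rightarrow> real ^ 'j \<Rightarrow> real" where
  "below i t x = of_bool (x $ i \<le> t)"

lemma below_measurable[measurable]: "below i t \<in> borel_measurable borel"
  unfolding below_def by measurable

lemma below_range: "below i t x \<in> {0, 1}" "\<bar>below i t x\<bar> \<le> 1"
  by (auto simp: below_def)

locale arrival_sample = iid_sample M \<rho>
  for M :: "'a measure" and \<rho> :: "nat \<Rightarrow> 'a \<Rightarrow> real ^ 'j" +
  fixes T :: real
  assumes T: "0 < T"
    and range: "\<And>m \<omega> i. \<omega> \<in> space M \<Longrightarrow> \<rho> m \<omega> $ i \<in> {0..T}"
    and cont: "\<And>i. continuous_on {0..} (marginal_df M (\<rho> 0) i)"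
begin

abbreviation F :: "'j \<Rightarrow> real \<Rightarrow> real" where "F \<equiv> marginal_df M (\<rho> 0)"

lemma integrable_below: "integrable M (\<lambda>\<omega>. below i t (\<rho> m \<omega>))"
  by (rule integrable_sample[OF below_measurable below_range(2)])

lemma mean_below: "mean (below i t) = F i t"
proof -
  have "mean (below i t) = expectation (indicator {\<omega> \<in> space M. \<rho> 0 \<omega> $ i \<le> t})"
    unfolding mean_def below_def by (intro Bochner_Integration.integral_cong) (auto simp: indicator_def)
  then show ?thesis by (simp add: marginal_df_def)
qed

lemma mean_below_mult: "mean (\<lambda>x. below i t x * below j s x) = joint_df M (\<rho> 0) i j t s"
proof -
  have "mean (\<lambda>x. below i t x * below j s x)
      = expectation (indicator {\<omega> \<in> space M. \<rho> 0 \<omega> $ i \<le> t \<and> \<rho> 0 \<omega> $ j \<le> s})"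
    unfolding mean_def below_def by (intro Bochner_Integration.integral_cong) (auto simp: indicator_def)
  then show ?thesis by (simp add: joint_df_def)
qed

lemma F_mono: "s \<le> t \<Longrightarrow> F i s \<le> F i t"
  unfolding marginal_df_def by (intro finite_measure_mono) (auto, measurable)

lemma F_range: "F i t \<in> {0..1}"
  by (simp add: marginal_df_def)

lemma F_top: "T \<le> t \<Longrightarrow> F i t = 1"
proof -
  assume "T \<le> t"
  then have "{\<omega> \<in> space M. \<rho> 0 \<omega> $ i \<le> t} = space M" using range[of _ 0 i] by force
  then show ?thesis by (simp add: marginal_df_def prob_space)
qed

definition Q :: "'j \<Rightarrow> real \<Rightarrow> real" where
  "Q i = (SOME q. quantile (F i) q T)"

lemma quantile_Q: "quantile (F i) (Q i) T"
proof -
  obtain q where "(\<forall>v. q v \<in> {0..T}) \<and>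
     (\<forall>v\<in>{0..1}. \<forall>t\<in>{0..T}. q v \<le> t \<longleftrightarrow> v \<le> F i t) \<and>
     (\<forall>v\<ge>0. F i (q v) = max (F i 0) (min v 1)) \<and> (\<forall>v>1. q v = T)"
    using exists_quantile[OF cont[of i], of T] F_mono F_range[of i 0] F_top T by auto
  then have "quantile (F i) q T"
    using F_mono F_range by unfold_locales auto
  then show ?thesis unfolding Q_def by (rule someI[where P = "\<lambda>q. quantile (F i) q T"])
qed

abbreviation emp_path :: "nat \<Rightarrow> real \<Rightarrow> 'a \<Rightarrow> real ^ 'j" where
  "emp_path n t \<omega> \<equiv> \<chi> i. emp n (below i t) \<omega>"

text \<open>Exhibits the path as an increasing part minus \<open>sqrt n * F i t\<close>, the shape
  to which the quantile squeeze applies.\<close>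

lemma emp_below: "emp n (below i t) \<omega> = (\<Sum>m<n. below i t (\<rho> m \<omega>)) / sqrt n - sqrt n * F i t"
proof (cases "n = 0")
  case False
  have "real n * F i t / sqrt n = sqrt n * F i t"
    using False by (simp add: field_simps)
  then show ?thesis
    by (simp add: emp_def mean_below sum_subtractf diff_divide_distrib)
qed (simp add: emp_def)

lemma emp_below_top: "\<omega> \<in> space M \<Longrightarrow> T \<le> t \<Longrightarrow> emp n (below i t) \<omega> = 0"
proof -
  assume *: "\<omega> \<in> space M" "T \<le> t"
  have "below i t (\<rho> m \<omega>) = 1" for m
    using range[OF *(1), of m i] *(2) by (simp add: below_def)
  then show ?thesis using *(2) by (simp add: emp_def mean_below F_top)
qed

lemma emp_diff:
  "emp n (below i t) \<omega> - emp n (below i s) \<omega> = emp n (\<lambda>x. below i t x - below i s x) \<omega>"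
proof -
  have "mean (\<lambda>x. below i t x - below i s x) = mean (below i t) - mean (below i s)"
    unfolding mean_def by (rule Bochner_Integration.integral_diff) (rule integrable_below)+
  then show ?thesis
    unfolding emp_def diff_divide_distrib[symmetric] sum_subtractf[symmetric]
    by (intro arg_cong[where f = "\<lambda>x. x / sqrt n"] sum.cong) auto
qed

text \<open>The increment from \<open>s\<close> to \<open>t\<close> is the empirical sum of the
  indicator of \<open>(s, t]\<close> in coordinate \<open>i\<close>, whose mean is
  \<open>F i t - F i s\<close>.\<close>

lemma emp_increment_moment:
  assumes "s \<le> t" "F i t - F i s \<le> p"
  shows "integrable M (\<lambda>\<omega>. (emp n (below i t) \<omega> - emp n (below i s) \<omega>) ^ 4)"
    and "expectation (\<lambda>\<omega>. (emp n (below i t) \<omega> - emp n (below i s) \<omega>) ^ 4) \<le> 3 * p\<^sup>2 + p / n"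
proof -
  let ?g = "\<lambda>x. below i t x - below i s x"
  have g: "?g \<in> borel_measurable borel" by measurable
  have g01: "?g x \<in> {0, 1}" for x using assms(1) by (auto simp: below_def)
  have "mean ?g = F i t - F i s"
    unfolding mean_below[symmetric] unfolding mean_def
    by (rule Bochner_Integration.integral_diff) (rule integrable_below)+
  then show "expectation (\<lambda>\<omega>. (emp n (below i t) \<omega> - emp n (below i s) \<omega>) ^ 4) \<le> 3 * p\<^sup>2 + p / n"
    unfolding emp_diff using assms by (intro emp_fourth_moment[OF g g01]) simp
  have b: "\<bar>emp n ?g \<omega>\<bar> \<le> (\<Sum>m<n. 1 + \<bar>mean ?g\<bar>) / sqrt n" for \<omega>
    unfolding emp_def abs_divide
  proof -
    have "\<bar>?g (\<rho> m \<omega>) - mean ?g\<bar> \<le> 1 + \<bar>mean ?g\<bar>" for m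
      using g01[of "\<rho> m \<omega>"] by auto
    then have "\<bar>\<Sum>m<n. ?g (\<rho> m \<omega>) - mean ?g\<bar> \<le> (\<Sum>m<n. 1 + \<bar>mean ?g\<bar>)"
      by (intro order_trans[OF sum_abs] sum_mono)
    then show "\<bar>\<Sum>m<n. ?g (\<rho> m \<omega>) - mean ?g\<bar> / \<bar>sqrt n\<bar> \<le> (\<Sum>m<n. 1 + \<bar>mean ?g\<bar>) / sqrt n"
      by (simp add: divide_right_mono)
  qed
  have "\<bar>emp n ?g \<omega> ^ 4\<bar> \<le> ((\<Sum>m<n. 1 + \<bar>mean ?g\<bar>) / sqrt n) ^ 4" for \<omega>
    unfolding power_abs by (rule power_mono[OF b]) simp
  then show "integrable M (\<lambda>\<omega>. (emp n (below i t) \<omega> - emp n (below i s) \<omega>) ^ 4)"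
    unfolding emp_diff using g
    by (intro integrable_const_bound[of _ "((\<Sum>m<n. 1 + \<bar>mean ?g\<bar>) / sqrt n) ^ 4"] AE_I2) auto
qed

definition osc :: "nat \<Rightarrow> 'j \<Rightarrow> 'a \<Rightarrow> nat \<Rightarrow> real" where
  "osc n i \<omega> l = incr_bound (\<lambda>v. emp n (below i (Q i v)) \<omega>) l"

lemma expectation_osc:
  assumes "2 ^ l \<le> n"
  shows "integrable M (\<lambda>\<omega>. osc n i \<omega> l)" "expectation (\<lambda>\<omega>. osc n i \<omega> l) \<le> 17 * chain_rate ^ l"
proof -
  interpret q: quantile "F i" "Q i" T by (rule quantile_Q)
  let ?a = "\<lambda>k. Q i (real k / 2 ^ l)" and ?b = "\<lambda>k. Q i ((real k + 1) / 2 ^ l)"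
  have *: "?a k \<le> ?b k" "F i (?b k) - F i (?a k) \<le> 1 / 2 ^ l" for k
    using q.F_Q_diff[of "real k / 2 ^ l" "(real k + 1) / 2 ^ l"]
    by (auto intro!: q.Q_mono simp: divide_right_mono diff_divide_distrib[symmetric])
  have m: "integrable M (\<lambda>\<omega>. (emp n (below i (?b k)) \<omega> - emp n (below i (?a k)) \<omega>) ^ 4)"
    "expectation (\<lambda>\<omega>. (emp n (below i (?b k)) \<omega> - emp n (below i (?a k)) \<omega>) ^ 4)
      \<le> 3 * (1 / 2 ^ l)\<^sup>2 + 1 / 2 ^ l / real n" for k
    by (rule emp_increment_moment[OF *])+
  \<comment> \<open>Here \<open>2 ^ l \<le> n\<close> enters: with \<open>p = 2^-l\<close> it gives
    \<open>p / n \<le> p^2\<close>, and 4 = 3 + 1.\<close>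
  have "3 * (1 / 2 ^ l)\<^sup>2 + 1 / 2 ^ l / real n \<le> 4 / (4::real) ^ l"
  proof -
    have n: "(2::real) ^ l \<le> real n" using assms by (metis of_nat_le_iff of_nat_numeral of_nat_power)
    then have "0 < real n" by (rule less_le_trans[rotated]) simp
    then have "1 / real n \<le> 1 / 2 ^ l" using n by (intro divide_left_mono) auto
    then have "1 / 2 ^ l * (1 / real n) \<le> 1 / 2 ^ l * (1 / (2::real) ^ l)" by (intro mult_left_mono) auto
    moreover have "(1 / (2::real) ^ l)\<^sup>2 = 1 / 4 ^ l" "1 / 2 ^ l * (1 / (2::real) ^ l) = 1 / 4 ^ l"
      by (simp_all add: power2_eq_square flip: power_mult_distrib)
    ultimately show ?thesis by simp
  qed
  then have "expectation (\<lambda>\<omega>. (emp n (below i (?b k)) \<omega> - emp n (below i (?a k)) \<omega>) ^ 4) \<le> 4 / 4 ^ l" for k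
    using m(2)[of k] by linarith
  then show "integrable M (\<lambda>\<omega>. osc n i \<omega> l)" "expectation (\<lambda>\<omega>. osc n i \<omega> l) \<le> 17 * chain_rate ^ l"
    unfolding osc_def using m(1)
    by (auto intro!: expectation_incr_bound[where Y = "\<lambda>\<omega> v. emp n (below i (Q i v)) \<omega>"])
qed

lemma emp_modulus:
  assumes "0 \<le> s" "s \<le> t" "t \<le> T" "F i t - F i s \<le> 1 / 2 ^ l" "l \<le> L"
  shows "\<bar>emp n (below i t) \<omega> - emp n (below i s) \<omega>\<bar>
    \<le> 2 * ((\<Sum>j\<in>{l<..L}. osc n i \<omega> j) + osc n i \<omega> L + sqrt n / 2 ^ L) + osc n i \<omega> l"
proof -
  interpret q: quantile "F i" "Q i" T by (rule quantile_Q)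
  show ?thesis
  proof (rule q.path_modulus[where x = "\<lambda>t. emp n (below i t) \<omega>" and c = "sqrt n" and r = "\<lambda>t. (\<Sum>m<n. below i t (\<rho> m \<omega>)) / sqrt n"])
    show "(\<Sum>m<n. below i s (\<rho> m \<omega>)) / sqrt n \<le> (\<Sum>m<n. below i t (\<rho> m \<omega>)) / sqrt n" if "s \<le> t" for s t
      using that by (intro divide_right_mono sum_mono) (auto simp: below_def)
    show "\<bar>emp n (below i (Q i ((real k + 1) / 2 ^ l))) \<omega> - emp n (below i (Q i (real k / 2 ^ l))) \<omega>\<bar>
      \<le> osc n i \<omega> l" if "k \<le> 2 ^ l" for l k
      unfolding osc_def by (rule incr_bound[OF that])
  qed (use assms in \<open>auto simp: emp_below\<close>)
qed

lemma sum_chain_rate: "(\<Sum>j\<in>{l<..L}. chain_rate ^ j) \<le> chain_rate ^ l / (1 - chain_rate)"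
proof (cases "l \<le> L")
  case True
  have "(\<Sum>j\<in>{l<..L}. chain_rate ^ j) \<le> (\<Sum>j\<in>{l..L}. chain_rate ^ j)"
    using chain_rate by (intro sum_mono2) auto
  also have "\<dots> = (chain_rate ^ l - chain_rate ^ Suc L) / (1 - chain_rate)"
    using chain_rate True by (subst sum_gp) auto
  also have "\<dots> \<le> chain_rate ^ l / (1 - chain_rate)"
    using chain_rate by (intro divide_right_mono) auto
  finally show ?thesis .
qed (use chain_rate in simp)

text \<open>The coarse level \<open>l\<close> is chosen for a small geometric tail, then the mesh so
  that a cell carries mass at most \<open>2^-l\<close> in every coordinate. The finest level
  \<open>L n\<close> is the integer part of the binary logarithm of \<open>n\<close>: fine enough
  for a drift \<open>sqrt n / 2^L \<le> 2 / sqrt n\<close>, coarse enough for the moment bound at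
  every level used.\<close>

lemma tight:
  assumes \<epsilon>: "0 < \<epsilon>"
  shows "\<forall>\<^sub>F m in sequentially. modulus_dominated M emp_path T m \<epsilon>"
proof -
  let ?r = chain_rate
  \<comment> \<open>Mean oscillations of size \<open>17 * r^j\<close> in \<open>emp_modulus\<close>:
    \<open>2 * 17 / (1 - r)\<close> for the chain, \<open>2 * 17\<close> for the finest level and 17
    for level \<open>l\<close>.\<close>
  define C where "C = 34 / (1 - ?r) + 51"
  define c where "c = real CARD('j)"
  have c: "0 < c" by (simp add: c_def)
  have "(\<lambda>l. c * (C * ?r ^ l)) \<longlonglongrightarrow> c * (C * 0)"
    using chain_rate by (intro tendsto_intros LIMSEQ_realpow_zero) auto
  then have "\<forall>\<^sub>F l in sequentially. c * (C * ?r ^ l) < \<epsilon> / 2"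
    using \<epsilon> by (intro order_tendstoD(2)) auto
  then obtain l where l: "c * (C * ?r ^ l) < \<epsilon> / 2"
    using eventually_happens'[OF sequentially_bot] by blast
  have "\<forall>\<^sub>F m in sequentially. \<forall>i. \<forall>t\<in>{0..T}. F i t - F i (real (cell m t) / m) \<le> 1 / 2 ^ l \<and> real (cell m t) / m \<le> t"
  proof -
    have "\<forall>\<^sub>F m in sequentially. \<forall>t\<in>{0..T}. F i t - F i (real (cell m t) / m) \<le> 1 / 2 ^ l" for i
    proof -
      have "uniform_limit {0..T} (\<lambda>m. step_path m (F i)) (F i) sequentially"
        using step_path_tendsto[OF cont[of i]] unfolding ucc_tendsto_def by (auto dest!: spec[of _ "{0..T}"])
      from uniform_limitD[OF this, of "1 / 2 ^ l"]
      have "\<forall>\<^sub>F m in sequentially. \<forall>t\<in>{0..T}. dist (step_path m (F i) t) (F i t) < 1 / 2 ^ l" by simp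
      then show ?thesis
        by eventually_elim (auto simp: step_path_def dist_real_def abs_less_iff intro!: less_imp_le)
    qed
    then have "\<forall>\<^sub>F m in sequentially. \<forall>i\<in>UNIV. \<forall>t\<in>{0..T}. F i t - F i (real (cell m t) / m) \<le> 1 / 2 ^ l"
      by (intro eventually_ball_finite) auto
    moreover have "\<forall>\<^sub>F m in sequentially. max 1 (nat \<lceil>T\<rceil>) \<le> m" by (rule eventually_ge_at_top)
    ultimately show ?thesis
    proof eventually_elim
      case (elim m)
      have "real (cell m t) / m \<le> t" if "t \<in> {0..T}" for t
      proof (rule cell_near)
        show "0 < m" "0 \<le> t" "t \<le> real m" using elim(2) that by (auto simp: nat_le_iff ceiling_le_iff)
      qed
      then show ?case using elim by auto
    qed
  qed
  then show ?thesis
  proof eventually_elim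
    case (elim m)
    note cells = elim
    have "\<exists>k. 0 < n \<longrightarrow> 2 ^ k \<le> n \<and> n < 2 ^ Suc k" for n :: nat
      using ex_power_ivl1[of 2 n] by (cases "n = 0") auto
    then obtain L where L: "\<And>n :: nat. 0 < n \<Longrightarrow> 2 ^ L n \<le> n \<and> n < 2 ^ Suc (L n)" by metis
    define U where "U n \<omega> = (\<Sum>i\<in>UNIV. 2 * ((\<Sum>j\<in>{l<..L n}. osc n i \<omega> j) + osc n i \<omega> (L n) + sqrt n / 2 ^ L n) + osc n i \<omega> l)" for n \<omega>
    \<comment> \<open>Twice the drift bound \<open>2 / sqrt n\<close>, for each of the
      \<open>c\<close> coordinates.\<close>
    have "(\<lambda>n. c * (4 / sqrt (real n))) \<longlonglongrightarrow> c * 0"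
      by (intro tendsto_intros filterlim_compose[OF sqrt_at_top filterlim_real_sequentially]
           tendsto_divide_0[OF tendsto_const] filterlim_at_top_imp_at_infinity)
    then have "\<forall>\<^sub>F n in sequentially. c * (4 / sqrt (real n)) < \<epsilon> / 2"
      using \<epsilon> by (intro order_tendstoD(2)) auto
    moreover have "\<forall>\<^sub>F n in sequentially. 2 ^ l \<le> n" by (rule eventually_ge_at_top)
    ultimately have "\<forall>\<^sub>F n in sequentially. integrable M (U n) \<and>
      (\<forall>\<omega>\<in>space M. \<forall>t\<in>{0..T}. dist (emp_path n t \<omega>)
        (step_path m (\<lambda>t. emp_path n t \<omega>) t) \<le> U n \<omega>) \<and> expectation (U n) \<le> \<epsilon>"
    proof eventually_elim
      case (elim n)
      have n: "0 < n" using elim(2) by (metis gr0I le_zero_eq power_not_zero zero_neq_numeral)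
      have k: "2 ^ L n \<le> n" "n < 2 ^ Suc (L n)" using L[OF n] by auto
      then have "(2::nat) ^ l < 2 ^ Suc (L n)" using elim(2) by linarith
      then have lL: "l \<le> L n" by (simp only: power_strict_increasing_iff less_Suc_eq_le one_less_numeral_iff semiring_norm)
      have jn: "2 ^ j \<le> n" if "j \<le> L n" for j
        using power_increasing[OF that, of "2::nat"] k(1) by linarith
      note osc_int = expectation_osc(1)[OF jn] and osc_le = expectation_osc(2)[OF jn]
      have iU: "integrable M (U n)"
        unfolding U_def using osc_int lL
        by (intro Bochner_Integration.integrable_sum Bochner_Integration.integrable_add
            integrable_mult_right integrable_const) auto
      have dom: "dist (emp_path n t \<omega>) (step_path m (\<lambda>t. emp_path n t \<omega>) t) \<le> U n \<omega>"
        if "t \<in> {0..T}" for \<omega> t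
      proof -
        have "dist (emp_path n t \<omega>) (step_path m (\<lambda>t. emp_path n t \<omega>) t)
          \<le> (\<Sum>i\<in>UNIV. \<bar>emp n (below i t) \<omega> - emp n (below i (real (cell m t) / m)) \<omega>\<bar>)"
          using dist_vec_le_sum_abs[of "emp_path n t \<omega>" "\<chi> i. emp n (below i (real (cell m t) / m)) \<omega>"]
          by (simp add: step_path_def)
        also have "\<dots> \<le> U n \<omega>"
          unfolding U_def using that cells[rule_format, OF that] lL by (intro sum_mono emp_modulus) auto
        finally show ?thesis .
      qed
      have "sqrt n / 2 ^ L n \<le> 2 / sqrt n"
      proof -
        have "sqrt n * sqrt n = real n" by simp
        also have "real n \<le> real (2 ^ Suc (L n))" using k(2) by (intro of_nat_mono) simp
        finally have "sqrt n * sqrt n \<le> 2 * 2 ^ L n" by simp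
        then show ?thesis using n by (simp add: field_simps)
      qed
      moreover have "(\<Sum>j\<in>{l<..L n}. expectation (\<lambda>\<omega>. osc n i \<omega> j)) \<le> 17 * (?r ^ l / (1 - ?r))" for i
      proof -
        have "(\<Sum>j\<in>{l<..L n}. expectation (\<lambda>\<omega>. osc n i \<omega> j)) \<le> (\<Sum>j\<in>{l<..L n}. 17 * ?r ^ j)"
          by (intro sum_mono osc_le) auto
        also have "\<dots> \<le> 17 * (?r ^ l / (1 - ?r))"
          using sum_chain_rate[of l "L n"] by (simp add: sum_distrib_left[symmetric])
        finally show ?thesis .
      qed
      moreover have "expectation (\<lambda>\<omega>. osc n i \<omega> (L n)) \<le> 17 * ?r ^ l" for i
      proof -
        have "?r ^ L n \<le> ?r ^ l" using lL chain_rate by (intro power_decreasing) auto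
        then show ?thesis using osc_le[of "L n" i] by simp
      qed
      moreover have "expectation (\<lambda>\<omega>. osc n i \<omega> l) \<le> 17 * ?r ^ l" for i
        using osc_le[OF lL] .
      ultimately have *: "2 * ((\<Sum>j\<in>{l<..L n}. expectation (\<lambda>\<omega>. osc n i \<omega> j)) + expectation (\<lambda>\<omega>. osc n i \<omega> (L n)) + sqrt n / 2 ^ L n)
          + expectation (\<lambda>\<omega>. osc n i \<omega> l)
        \<le> 2 * (17 * (?r ^ l / (1 - ?r)) + 17 * ?r ^ l + 2 / sqrt n) + 17 * ?r ^ l" for i
        by (intro add_mono mult_left_mono) auto
      have "expectation (U n) = (\<Sum>i\<in>UNIV. 2 * ((\<Sum>j\<in>{l<..L n}. expectation (\<lambda>\<omega>. osc n i \<omega> j)) + expectation (\<lambda>\<omega>. osc n i \<omega> (L n)) + sqrt n / 2 ^ L n)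
          + expectation (\<lambda>\<omega>. osc n i \<omega> l))"
      proof -
        define S where "S i \<omega> = (\<Sum>j\<in>{l<..L n}. osc n i \<omega> j)" for i \<omega>
        have S: "integrable M (S i)" "expectation (S i) = (\<Sum>j\<in>{l<..L n}. expectation (\<lambda>\<omega>. osc n i \<omega> j))" for i
          unfolding S_def using osc_int by (auto intro: Bochner_Integration.integral_sum)
        show ?thesis
          unfolding U_def S_def[symmetric] using osc_int[of "L n"] osc_int[OF lL] S by (simp add: prob_space)
      qed
      also have "\<dots> \<le> (\<Sum>i\<in>(UNIV::'j set). 2 * (17 * (?r ^ l / (1 - ?r)) + 17 * ?r ^ l + 2 / sqrt n) + 17 * ?r ^ l)"
        by (intro sum_mono *)
      also have "\<dots> = c * (C * ?r ^ l) + c * (4 / sqrt n)"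
        by (simp add: c_def C_def algebra_simps)
      finally have "expectation (U n) \<le> \<epsilon>" using l elim(1) by linarith
      then show ?case using iU dom by blast
    qed
    then show ?case unfolding modulus_dominated_def by blast
  qed
qed

end

section \<open>Finite-dimensional convergence and uniform strong law\<close>

context arrival_sample
begin

abbreviation R :: "real \<Rightarrow> real \<Rightarrow> real ^ 'j ^ 'j" where "R \<equiv> bridge_cov M (\<rho> 0)"

lemma R_eq: "R t s $ i $ j = joint_df M (\<rho> 0) i j t s - F i t * F j s"
  by (simp add: bridge_cov_def)

lemma R_sym: "R t s $ i $ j = R s t $ j $ i"
  by (simp add: R_eq joint_df_def conj_commute mult.commute)

lemma R_diag: "R t t $ i $ i = F i t - (F i t)\<^sup>2"
  by (simp add: R_eq joint_df_def marginal_df_def power2_eq_square)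

lemma emp_below_bound: "\<bar>emp n (below i t) \<omega>\<bar> \<le> 2 * sqrt n"
proof -
  let ?s = "\<Sum>m<n. below i t (\<rho> m \<omega>)"
  have "0 \<le> ?s" by (intro sum_nonneg) (simp add: below_def)
  moreover have "?s \<le> (\<Sum>m<n. 1)" by (intro sum_mono) (simp add: below_def)
  ultimately have "0 \<le> ?s / sqrt n" "?s / sqrt n \<le> real n / sqrt n" by (auto intro!: divide_right_mono)
  moreover have "0 \<le> sqrt n * F i t" "sqrt n * F i t \<le> sqrt n * 1"
    using F_range[of i t] by (simp, intro mult_left_mono) auto
  ultimately show ?thesis unfolding emp_below by (simp add: real_div_sqrt)
qed

lemma integrable_below_mult: "integrable M (\<lambda>\<omega>. below i t (\<rho> m \<omega>) * below j s (\<rho> m \<omega>))"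
  by (rule integrable_sample[of "\<lambda>x. below i t x * below j s x" 1]) (auto simp: below_def)

lemma covariance_below:
  "expectation (\<lambda>\<omega>. (below i t (\<rho> 0 \<omega>) - F i t) * (below j s (\<rho> 0 \<omega>) - F j s)) = R t s $ i $ j"
proof -
  have "(below i t (\<rho> 0 \<omega>) - F i t) * (below j s (\<rho> 0 \<omega>) - F j s)
     = below i t (\<rho> 0 \<omega>) * below j s (\<rho> 0 \<omega>) - F j s * below i t (\<rho> 0 \<omega>)
       - F i t * below j s (\<rho> 0 \<omega>) + F i t * F j s" for \<omega>
    by (simp add: algebra_simps)
  then show ?thesis
    using integrable_below integrable_below_mult mean_below[unfolded mean_def] mean_below_mult[unfolded mean_def]
    by (simp add: prob_space R_eq)
qed

text \<open>\<open>K\<close> only labels pairs of a time \<open>tm k\<close> and a coordinate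
  \<open>ix k\<close>, with repetitions allowed; it is later a whole grid or a singleton.\<close>

context
  fixes K :: "'k set" and u :: "'k \<Rightarrow> real" and tm :: "'k \<Rightarrow> real" and ix :: "'k \<Rightarrow> 'j"
  assumes K: "finite K"
begin

lemma mean_combination: "mean (\<lambda>x. \<Sum>k\<in>K. u k * below (ix k) (tm k) x) = (\<Sum>k\<in>K. u k * F (ix k) (tm k))"
  unfolding mean_def using integrable_below mean_below[unfolded mean_def] by simp

lemma emp_combination:
  "(\<Sum>k\<in>K. u k * emp n (below (ix k) (tm k)) \<omega>) = emp n (\<lambda>x. \<Sum>k\<in>K. u k * below (ix k) (tm k) x) \<omega>"
proof -
  have "(\<Sum>k\<in>K. u k * emp n (below (ix k) (tm k)) \<omega>)
      = (\<Sum>k\<in>K. \<Sum>m<n. u k * (below (ix k) (tm k) (\<rho> m \<omega>) - F (ix k) (tm k))) / sqrt n"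
    by (simp add: emp_def mean_below sum_divide_distrib sum_distrib_left)
  also have "\<dots> = (\<Sum>m<n. \<Sum>k\<in>K. u k * (below (ix k) (tm k) (\<rho> m \<omega>) - F (ix k) (tm k))) / sqrt n"
    by (subst sum.swap) (rule refl)
  finally show ?thesis by (simp add: emp_def mean_combination right_diff_distrib sum_subtractf)
qed

lemma variance_combination:
  "mean (\<lambda>x. ((\<Sum>k\<in>K. u k * below (ix k) (tm k) x) - mean (\<lambda>x. \<Sum>k\<in>K. u k * below (ix k) (tm k) x))\<^sup>2)
    = (\<Sum>k\<in>K. \<Sum>l\<in>K. u k * u l * R (tm k) (tm l) $ ix k $ ix l)"
proof -
  define c where "c k = F (ix k) (tm k)" for k
  have int: "integrable M (\<lambda>\<omega>. (below (ix k) (tm k) (\<rho> 0 \<omega>) - c k) * (below (ix l) (tm l) (\<rho> 0 \<omega>) - c l))" for k l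
    by (rule integrable_sample[of "\<lambda>x. (below (ix k) (tm k) x - c k) * (below (ix l) (tm l) x - c l)"
          "(1 + \<bar>c k\<bar>) * (1 + \<bar>c l\<bar>)"])
       (auto simp: abs_mult below_def intro!: mult_mono)
  have cov: "expectation (\<lambda>\<omega>. (below (ix k) (tm k) (\<rho> 0 \<omega>) - c k) * (below (ix l) (tm l) (\<rho> 0 \<omega>) - c l))
      = R (tm k) (tm l) $ ix k $ ix l" for k l
    unfolding c_def by (rule covariance_below)
  have "((\<Sum>k\<in>K. u k * below (ix k) (tm k) x) - (\<Sum>k\<in>K. u k * c k))\<^sup>2
      = (\<Sum>k\<in>K. \<Sum>l\<in>K. u k * u l * ((below (ix k) (tm k) x - c k) * (below (ix l) (tm l) x - c l)))" for x
  proof -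
    have "(\<Sum>k\<in>K. u k * below (ix k) (tm k) x) - (\<Sum>k\<in>K. u k * c k) = (\<Sum>k\<in>K. u k * (below (ix k) (tm k) x - c k))"
      by (simp add: sum_subtractf right_diff_distrib)
    then show ?thesis
      unfolding power2_eq_square by (simp only: sum_product) (intro sum.cong refl; simp only: mult_ac)
  qed
  then show ?thesis
    unfolding mean_combination c_def[symmetric]
    unfolding mean_def using int by (simp add: cov)
qed

lemma emp_combination_characteristic_function:
  "(\<lambda>n. CLINT \<omega>|M. iexp (\<Sum>k\<in>K. u k * emp n (below (ix k) (tm k)) \<omega>))
    \<longlonglongrightarrow> exp (- ((\<Sum>k\<in>K. \<Sum>l\<in>K. u k * u l * R (tm k) (tm l) $ ix k $ ix l) / 2))"
  unfolding emp_combination variance_combination[symmetric]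
proof (rule emp_characteristic_function[where b = "\<Sum>k\<in>K. \<bar>u k\<bar>"])
  show "\<bar>\<Sum>k\<in>K. u k * below (ix k) (tm k) x\<bar> \<le> (\<Sum>k\<in>K. \<bar>u k\<bar>)" for x
    by (intro order_trans[OF sum_abs] sum_mono) (auto simp: abs_mult below_def)
qed measurable

text \<open>A centred normal law is determined by its variance, so \<open>R\<close> fixes the
  finite-dimensional laws of every bridge.\<close>

lemma bridge_combination_normal:
  assumes W: "is_bridge N W R" and tm: "\<And>k. k \<in> K \<Longrightarrow> 0 \<le> tm k"
  shows "centered_normal N (\<lambda>\<omega>. \<Sum>k\<in>K. u k * W (tm k) \<omega> $ ix k)
     (\<Sum>k\<in>K. \<Sum>l\<in>K. u k * u l * R (tm k) (tm l) $ ix k $ ix l)"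
proof -
  interpret N: prob_space N using W by (simp add: is_bridge_def gaussian_process_def)
  have gauss: "gaussian_rv N (\<lambda>\<omega>. \<Sum>t\<in>I. c t \<bullet> W t \<omega>)" if "finite I" "I \<subseteq> {0..}" for I c
    using W that by (auto simp: is_bridge_def gaussian_process_def)
  have mean0: "N.expectation (\<lambda>\<omega>. W t \<omega> $ i) = 0" if "0 \<le> t" for t i
    using W that by (auto simp: is_bridge_def)
  have single: "centered_normal N (\<lambda>\<omega>. W t \<omega> $ i) (N.expectation (\<lambda>\<omega>. (W t \<omega> $ i)\<^sup>2))" if "0 \<le> t" for t i
    using N.gaussian_rv_imp_centered_normal[OF _ mean0[OF that]] gauss[of "{t}" "\<lambda>_. axis i 1"] that
    by (simp add: inner_axis')
  have m[measurable]: "(\<lambda>\<omega>. W (tm k) \<omega> $ i) \<in> borel_measurable N" if "k \<in> K" for k i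
    by (rule centered_normal_measurable[OF single[OF tm[OF that]]])
  have powers: "integrable N (\<lambda>\<omega>. (W (tm k) \<omega> $ i) ^ n)" if "k \<in> K" for k i n
    by (rule N.centered_normal_moments(1)[OF single[OF tm[OF that]]])
  \<comment> \<open>\<open>is_bridge\<close> prescribes the integral of the product, but a
    nonintegrable product would have integral 0 by convention. Integrability comes from the normal
    marginals.\<close>
  have int2: "integrable N (\<lambda>\<omega>. W (tm k) \<omega> $ i * W (tm l) \<omega> $ j)" if "k \<in> K" "l \<in> K" for k l i j
  proof (rule Bochner_Integration.integrable_bound)
    show "integrable N (\<lambda>\<omega>. (W (tm k) \<omega> $ i)\<^sup>2 + (W (tm l) \<omega> $ j)\<^sup>2)"
      using powers[of _ _ 2] that by (intro Bochner_Integration.integrable_add)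
    have "\<bar>a * b\<bar> \<le> a\<^sup>2 + b\<^sup>2" for a b :: real
      using sum_squares_bound[of "\<bar>a\<bar>" "\<bar>b\<bar>"] mult_nonneg_nonneg[of "\<bar>a\<bar>" "\<bar>b\<bar>"]
      unfolding abs_mult power2_abs by linarith
    then show "AE \<omega> in N. norm (W (tm k) \<omega> $ i * W (tm l) \<omega> $ j) \<le> norm ((W (tm k) \<omega> $ i)\<^sup>2 + (W (tm l) \<omega> $ j)\<^sup>2)"
      by simp
  qed (use m that in auto)
  have cov: "N.expectation (\<lambda>\<omega>. W (tm k) \<omega> $ i * W (tm l) \<omega> $ j) = R (tm k) (tm l) $ i $ j"
    if "k \<in> K" "l \<in> K" for k l i j
  proof (cases "tm k \<le> tm l")
    case True
    then show ?thesis using W tm that by (simp add: is_bridge_def)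
  next
    case False
    then have "N.expectation (\<lambda>\<omega>. W (tm l) \<omega> $ j * W (tm k) \<omega> $ i) = R (tm l) (tm k) $ j $ i"
      using W tm that by (simp add: is_bridge_def)
    then show ?thesis using R_sym by (simp add: mult.commute)
  qed
  let ?Y = "\<lambda>\<omega>. \<Sum>k\<in>K. u k * W (tm k) \<omega> $ ix k"
  \<comment> \<open>\<open>gaussian_process\<close> speaks of sums over distinct times, so the
    labels with equal time are gathered in one coefficient vector.\<close>
  define c where "c t = (\<Sum>k | k \<in> K \<and> tm k = t. u k *\<^sub>R (axis (ix k) 1 :: real ^ 'j))" for t
  have "?Y \<omega> = (\<Sum>t\<in>tm ` K. c t \<bullet> W t \<omega>)" for \<omega>
  proof -
    have "?Y \<omega> = (\<Sum>t\<in>tm ` K. \<Sum>k | k \<in> K \<and> tm k = t. u k * W (tm k) \<omega> $ ix k)"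
      by (rule sum.image_gen[OF K])
    also have "\<dots> = (\<Sum>t\<in>tm ` K. c t \<bullet> W t \<omega>)"
      by (intro sum.cong refl) (auto simp: c_def inner_sum_left inner_axis')
    finally show ?thesis .
  qed
  then have g: "gaussian_rv N ?Y"
    using gauss[of "tm ` K" c] K tm by auto
  have "N.expectation ?Y = 0"
    using mean0[OF tm] powers[of _ _ 1] by simp
  moreover have "N.expectation (\<lambda>\<omega>. (?Y \<omega>)\<^sup>2) = (\<Sum>k\<in>K. \<Sum>l\<in>K. u k * u l * R (tm k) (tm l) $ ix k $ ix l)"
  proof -
    have "(?Y \<omega>)\<^sup>2 = (\<Sum>k\<in>K. \<Sum>l\<in>K. u k * u l * (W (tm k) \<omega> $ ix k * W (tm l) \<omega> $ ix l))" for \<omega>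
      by (simp add: power2_eq_square sum_product mult_ac)
    then show ?thesis using int2 by (simp add: cov)
  qed
  ultimately show ?thesis using N.gaussian_rv_imp_centered_normal[OF g] by simp
qed

end

text \<open>From \<open>T\<close> on the variance \<open>F - F^2\<close> is 0. Null sets are
  collected over rational times only; every \<open>t \<ge> T\<close> is a limit of larger rationals,
  and continuity of the paths does the rest.\<close>

lemma bridge_zero_after:
  assumes W: "is_bridge N W R"
  shows "AE \<omega> in N. \<forall>t\<ge>T. W t \<omega> = 0"
proof -
  interpret N: prob_space N using W by (simp add: is_bridge_def gaussian_process_def)
  have "AE \<omega> in N. W t \<omega> $ i = 0" if "T \<le> t" for t i
  proof -
    have "centered_normal N (\<lambda>\<omega>. W t \<omega> $ i) (R t t $ i $ i)"
      using bridge_combination_normal[of "{()}" N W "\<lambda>_. t" "\<lambda>_. 1" "\<lambda>_. i"] W that T by simp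
    then have n: "centered_normal N (\<lambda>\<omega>. W t \<omega> $ i) 0"
      using that by (simp add: R_diag F_top)
    have "AE \<omega> in N. (W t \<omega> $ i)\<^sup>2 = 0"
      using integral_nonneg_eq_0_iff_AE[OF N.centered_normal_moments(1)[OF n, of 2]]
        N.centered_normal_moments(3)[OF n] by simp
    then show ?thesis by simp
  qed
  then have "AE \<omega> in N. \<forall>t\<in>\<rat> \<inter> {T..}. \<forall>i\<in>UNIV. W t \<omega> $ i = 0"
    by (intro AE_ball_countable[THEN iffD2] ballI AE_finite_allI countable_Int1 countable_rat) auto
  then show ?thesis
  proof (rule AE_mp[OF _ AE_I2], intro impI allI)
    fix \<omega> t assume \<omega>: "\<omega> \<in> space N" and 0: "\<forall>t\<in>\<rat> \<inter> {T..}. \<forall>i\<in>UNIV. W t \<omega> $ i = 0" and t: "T \<le> t"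
    have "\<exists>q\<in>\<rat>. t < q \<and> q < t + 1 / Suc n" for n
      by (rule Rats_dense_in_real) simp
    then obtain q where q: "\<And>n. q n \<in> \<rat>" "\<And>n. t < q n" "\<And>n. q n < t + 1 / Suc n" by metis
    have "(\<lambda>n. t + 1 / real (Suc n)) \<longlonglongrightarrow> t + 0"
      by (intro tendsto_intros LIMSEQ_Suc[OF lim_1_over_n])
    then have "(\<lambda>n. t + 1 / real (Suc n)) \<longlonglongrightarrow> t" by simp
    then have "q \<longlonglongrightarrow> t"
      by (rule tendsto_sandwich[OF always_eventually[OF allI[OF less_imp_le[OF q(2)]]]
            always_eventually[OF allI[OF less_imp_le[OF q(3)]]] tendsto_const])
    moreover have "continuous_on {0..} (\<lambda>t. W t \<omega>)" using W \<omega> by (simp add: is_bridge_def)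
    moreover have qT: "q n \<in> \<rat> \<inter> {T..}" for n using q(1)[of n] q(2)[of n] t by simp
    then have "\<forall>\<^sub>F n in sequentially. q n \<in> {0..}" using T by (intro always_eventually) (auto intro: order_trans[of _ T])
    ultimately have "(\<lambda>n. W (q n) \<omega>) \<longlonglongrightarrow> W t \<omega>"
      using t T by (intro continuous_on_tendsto_compose[where s = "{0..}" and f = "\<lambda>t. W t \<omega>"]) auto
    moreover have "W (q n) \<omega> = 0" for n
      using 0 qT[of n] by (simp add: vec_eq_iff)
    ultimately show "W t \<omega> = 0" by (simp add: LIMSEQ_const_iff)
  qed
qed

text \<open>The variances \<open>F - F^2\<close> are at most 1, and the empirical characteristic
  functions converge to the one that \<open>R\<close> determines, so the first lemma applies with
  \<open>C = 1\<close>. For \<open>m = 0\<close> every grid time is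
  \<open>k / 0 = 0\<close>.\<close>

lemma fidi:
  fixes h :: "(nat \<times> 'j \<Rightarrow> real) \<Rightarrow> real"
  assumes W: "is_bridge N W R" and h: "continuous_on UNIV h" "\<And>x. \<bar>h x\<bar> \<le> B"
    "\<And>x y. (\<And>k i. k \<le> m * m \<Longrightarrow> x (k, i) = y (k, i)) \<Longrightarrow> h x = h y"
  shows "(\<lambda>n. \<integral>\<omega>. h (\<lambda>(k, i). emp n (below i (real k / real m)) \<omega>) \<partial>M)
    \<longlonglongrightarrow> (\<integral>\<omega>. h (\<lambda>(k, i). W (real k / real m) \<omega> $ i) \<partial>N)"
proof -
  interpret N: prob_space N using W by (simp add: is_bridge_def gaussian_process_def)
  let ?t = "\<lambda>k. real (fst k) / real m"
  have single: "centered_normal N (\<lambda>\<omega>. W (?t k) \<omega> $ snd k) (R (?t k) (?t k) $ snd k $ snd k)" for k :: "nat \<times> 'j"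
    using bridge_combination_normal[of "{()}" N W "\<lambda>_. ?t k" "\<lambda>_. 1" "\<lambda>_. snd k"] W by simp
  have "(\<lambda>n. \<integral>\<omega>. h (\<lambda>k. emp n (below (snd k) (?t k)) \<omega>) \<partial>M) \<longlonglongrightarrow> (\<integral>\<omega>. h (\<lambda>k. W (?t k) \<omega> $ snd k) \<partial>N)"
  proof (rule weak_convergence_from_characteristic_functions[where I = "{..m * m} \<times> (UNIV :: 'j set)"
        and C = 1 and h = h and B = B and X = "\<lambda>n \<omega> k. emp n (below (snd k) (?t k)) \<omega>" and V = "\<lambda>\<omega> k. W (?t k) \<omega> $ snd k"])
    fix u :: "nat \<times> 'j \<Rightarrow> real"
    let ?I = "{..m * m} \<times> (UNIV :: 'j set)"
    have "(CLINT \<omega>|N. iexp (1 * (\<Sum>k\<in>?I. u k * W (?t k) \<omega> $ snd k)))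
       = exp (- ((\<Sum>k\<in>?I. \<Sum>l\<in>?I. u k * u l * R (?t k) (?t l) $ snd k $ snd l) * 1\<^sup>2 / 2))"
      by (rule N.centered_normal_char[OF bridge_combination_normal[OF _ W]]) auto
    then show "(\<lambda>n. CLINT \<omega>|M. iexp (\<Sum>k\<in>?I. u k * emp n (below (snd k) (?t k)) \<omega>))
        \<longlonglongrightarrow> (CLINT \<omega>|N. iexp (\<Sum>k\<in>?I. u k * W (?t k) \<omega> $ snd k))"
      using emp_combination_characteristic_function[of ?I u snd ?t] by simp
  next
    fix k :: "nat \<times> 'j"
    show "(\<lambda>\<omega>. W (?t k) \<omega> $ snd k) \<in> borel_measurable N"
      by (rule centered_normal_measurable[OF single])
    show "integrable N (\<lambda>\<omega>. (W (?t k) \<omega> $ snd k)\<^sup>2)"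
      by (rule N.centered_normal_moments(1)[OF single])
    have "R (?t k) (?t k) $ snd k $ snd k \<le> 1"
      using F_range[of "snd k" "?t k"] zero_le_power2[of "F (snd k) (?t k)"]
      unfolding R_diag atLeastAtMost_iff by linarith
    then show "N.expectation (\<lambda>\<omega>. (W (?t k) \<omega> $ snd k)\<^sup>2) \<le> 1"
      using N.centered_normal_moments(3)[OF single[of k]] by simp
    fix n
    show "emp n (below (snd k) (?t k)) \<in> borel_measurable M" by measurable
    show "expectation (\<lambda>\<omega>. (emp n (below (snd k) (?t k)) \<omega>)\<^sup>2) \<le> 1"
      by (rule emp_second_moment[OF below_measurable below_range(1)]) (use F_range in \<open>auto simp: mean_below\<close>)
    show "integrable M (\<lambda>\<omega>. (emp n (below (snd k) (?t k)) \<omega>)\<^sup>2)"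
    proof (rule integrable_const_bound[of _ "(2 * sqrt n)\<^sup>2"])
      show "AE \<omega> in M. norm ((emp n (below (snd k) (?t k)) \<omega>)\<^sup>2) \<le> (2 * sqrt n)\<^sup>2"
        unfolding real_norm_def power_abs by (intro AE_I2 power_mono emp_below_bound) simp
    qed measurable
  next
    show "h x = h y" if "\<And>k. k \<in> {..m * m} \<times> (UNIV :: 'j set) \<Longrightarrow> x k = y k" for x y
      by (rule h(3)) (use that in auto)
  qed (simp_all add: prob_space_axioms N.prob_space_axioms h(1,2))
  then show ?thesis unfolding case_prod_beta' .
qed

text \<open>Fourth moments of the normalised sum are at most 4 = 3 + 1, so fourth powers of the
  averages have means of order \<open>n^-2\<close>. Their sum is finite almost surely, and its terms
  tend to 0.\<close>

lemma emp_strong_law: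
  "AE \<omega> in M. (\<lambda>n. emp n (below i t) \<omega> / sqrt n) \<longlonglongrightarrow> 0"
proof -
  let ?f = "\<lambda>n \<omega>. (emp n (below i t) \<omega>) ^ 4 / (real n)\<^sup>2"
  have m: "integrable M (\<lambda>\<omega>. emp n (below i t) \<omega> ^ 4)" "expectation (\<lambda>\<omega>. emp n (below i t) \<omega> ^ 4) \<le> 4" for n
  proof -
    have "\<bar>emp n (below i t) \<omega> ^ 4\<bar> \<le> (2 * sqrt n) ^ 4" for \<omega>
      unfolding power_abs by (rule power_mono[OF emp_below_bound]) simp
    then show "integrable M (\<lambda>\<omega>. emp n (below i t) \<omega> ^ 4)"
      by (intro integrable_const_bound[of _ "(2 * sqrt n) ^ 4"] AE_I2) auto
    have "expectation (\<lambda>\<omega>. emp n (below i t) \<omega> ^ 4) \<le> 3 * 1\<^sup>2 + 1 / real n"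
      by (rule emp_fourth_moment[OF below_measurable below_range(1)]) (use F_range[of i t] in \<open>auto simp: mean_below\<close>)
    also have "1 / real n \<le> 1" by (cases "n = 0") auto
    finally show "expectation (\<lambda>\<omega>. emp n (below i t) \<omega> ^ 4) \<le> 4" by simp
  qed
  have "AE \<omega> in M. summable (\<lambda>n. ?f n \<omega>)"
  proof (rule AE_summable_of_summable_integral)
    show "integrable M (?f n)" for n using m by simp
    show "0 \<le> ?f n \<omega>" for n \<omega> by simp
    have "summable (\<lambda>n. 4 * inverse ((real n)\<^sup>2))"
      by (intro summable_mult inverse_power_summable) simp
    then show "summable (\<lambda>n. expectation (?f n))"
    proof (rule summable_comparison_test'[where N = 0])
      fix n
      have "0 \<le> expectation (?f n)" by (intro Bochner_Integration.integral_nonneg) simp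
      moreover have "expectation (?f n) \<le> 4 * inverse ((real n)\<^sup>2)"
        using m(2)[of n] by (simp add: divide_right_mono inverse_eq_divide)
      ultimately show "norm (expectation (?f n)) \<le> 4 * inverse ((real n)\<^sup>2)" by simp
    qed
  qed
  then show ?thesis
  proof eventually_elim
    case (elim \<omega>)
    have "(emp n (below i t) \<omega> / sqrt n) ^ 4 = ?f n \<omega>" for n
      by (simp add: power_divide power4_eq_xxxx power2_eq_square)
    then have "(\<lambda>n. (emp n (below i t) \<omega> / sqrt n) ^ 4) \<longlonglongrightarrow> 0"
      using summable_LIMSEQ_zero[OF elim] by simp
    then show ?case by simp
  qed
qed

text \<open>The pointwise law holds at countably many quantiles off one null set; between neighbours
  the squeeze with drift 1 leaves an error \<open>2^-L\<close>. The whole half-line is covered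
  because the difference vanishes after \<open>T\<close>.\<close>

lemma glivenko_cantelli:
  "AE \<omega> in M. uniform_limit {0..} (\<lambda>n t. \<chi> i. emp n (below i t) \<omega> / sqrt n) (\<lambda>_. 0) sequentially"
proof -
  have "AE \<omega> in M. \<forall>i. \<forall>L k. (\<lambda>n. emp n (below i (Q i (real k / 2 ^ L))) \<omega> / sqrt n) \<longlonglongrightarrow> 0"
    using AE_all_countable emp_strong_law by (simp add: AE_all_countable)
  then show ?thesis
  proof (rule AE_mp[OF _ AE_I2], intro impI)
    fix \<omega> assume \<omega>: "\<omega> \<in> space M"
      and lim: "\<forall>i. \<forall>L k. (\<lambda>n. emp n (below i (Q i (real k / 2 ^ L))) \<omega> / sqrt n) \<longlonglongrightarrow> 0"
    show "uniform_limit {0..} (\<lambda>n t. \<chi> i. emp n (below i t) \<omega> / sqrt n) (\<lambda>_. 0) sequentially"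
    proof (rule uniform_limitI)
      fix e :: real assume e: "0 < e"
      \<comment> \<open>Each coordinate will be at most \<open>4 * \<epsilon>\<close>: one
        \<epsilon> for the value at the quantile, two for the increment to its neighbour, one for
        the drift. The sum over coordinates is \<open>e / 2\<close>.\<close>
      define \<epsilon> where "\<epsilon> = e / (8 * real CARD('j))"
      have eps: "0 < \<epsilon>" using e by (simp add: \<epsilon>_def)
      obtain L where L: "(1 / 2) ^ L < \<epsilon>" using real_arch_pow_inv[OF eps, of "1 / 2"] by auto
      \<comment> \<open>Index \<open>2 ^ L + 1\<close> is the right neighbour of the last grid
        level; its quantile is \<open>T\<close>.\<close>
      have "\<forall>\<^sub>F n in sequentially. \<forall>i\<in>UNIV. \<forall>k\<in>{..2 ^ L + 1}.
          dist (emp n (below i (Q i (real k / 2 ^ L))) \<omega> / sqrt n) 0 < \<epsilon>"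
        by (intro eventually_ball_finite ballI) (use lim eps in \<open>auto simp only: finite finite_atMost intro!: tendstoD\<close>)
      moreover have "\<forall>\<^sub>F n in sequentially. 0 < n" by (rule eventually_gt_at_top)
      ultimately show "\<forall>\<^sub>F n in sequentially. \<forall>t\<in>{0..}. dist (\<chi> i. emp n (below i t) \<omega> / sqrt n) 0 < e"
      proof eventually_elim
        case (elim n)
        define x where "x i t = emp n (below i t) \<omega> / sqrt n" for i t
        have xk: "\<bar>x i (Q i (real k / 2 ^ L))\<bar> \<le> \<epsilon>" if "k \<le> 2 ^ L + 1" for i k
          using elim(1) that by (auto simp: x_def dist_real_def intro: less_imp_le)
        have x: "\<bar>x i t\<bar> \<le> 4 * \<epsilon>" if "0 \<le> t" for i t
        proof (cases "t \<le> T")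
          case True
          interpret q: quantile "F i" "Q i" T by (rule quantile_Q)
          let ?v = "dyad L (F i t)"
          obtain k where k: "k \<le> 2 ^ L" "?v = real k / 2 ^ L"
            by (rule dyad_eq_nat[of "F i t" L]) (use F_range[of i t] in auto)
          have "\<bar>x i t - x i (Q i ?v)\<bar> \<le> \<bar>x i (Q i (?v + 1 / 2 ^ L)) - x i (Q i ?v)\<bar> + 1 / 2 ^ L"
          proof (rule q.path_near_quantile[where r = "\<lambda>t. (\<Sum>m<n. below i t (\<rho> m \<omega>)) / n" and c = 1 and x = "x i"])
            show "(\<Sum>m<n. below i s (\<rho> m \<omega>)) / n \<le> (\<Sum>m<n. below i t (\<rho> m \<omega>)) / n" if "s \<le> t" for s t
              using that by (intro divide_right_mono sum_mono) (auto simp: below_def)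
            show "x i t = (\<Sum>m<n. below i t (\<rho> m \<omega>)) / n - 1 * F i t" for t
              using elim(2) by (simp add: x_def emp_below diff_divide_distrib)
          qed (use that True in auto)
          moreover have "?v + 1 / 2 ^ L = real (k + 1) / 2 ^ L" using k by (simp add: add_divide_distrib)
          moreover have "\<bar>x i (Q i ?v)\<bar> \<le> \<epsilon>" using xk[of k i] k by simp
          moreover have "\<bar>x i (Q i (real (k + 1) / 2 ^ L))\<bar> \<le> \<epsilon>" using xk[of "k + 1" i] k by simp
          moreover have "1 / 2 ^ L < \<epsilon>" using L by (simp add: power_one_over)
          ultimately show ?thesis by (simp only:)
        next
          case False
          then show ?thesis using emp_below_top[OF \<omega>, of t n i] eps by (simp add: x_def)
        qed
        show ?case
        proof
          fix t :: real assume "t \<in> {0..}"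
          have "dist (\<chi> i. emp n (below i t) \<omega> / sqrt n) 0 \<le> (\<Sum>i\<in>UNIV. \<bar>x i t\<bar>)"
            using dist_vec_le_sum_abs[of "\<chi> i. x i t" 0] by (simp add: x_def)
          also have "\<dots> \<le> (\<Sum>i\<in>(UNIV::'j set). 4 * \<epsilon>)" using x \<open>t \<in> {0..}\<close> by (intro sum_mono) auto
          also have "\<dots> = e / 2" by (simp add: \<epsilon>_def)
          finally show "dist (\<chi> i. emp n (below i t) \<omega> / sqrt n) 0 < e" using e by simp
        qed
      qed
    qed
  qed
qed

end

section \<open>Existence of a continuous bridge\<close>

context
  fixes y :: "real \<Rightarrow> real" and d :: "nat \<Rightarrow> real"
  assumes incr: "\<And>l k. k \<le> 2 ^ l \<Longrightarrow> \<bar>y ((real k + 1) / 2 ^ l) - y (real k / 2 ^ l)\<bar> \<le> d l"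
    and sum: "summable d"
begin

lemma chain_convergent:
  assumes v: "0 \<le> v" "v \<le> 1"
  shows "convergent (\<lambda>l. y (dyad l v))"
proof -
  have "summable (\<lambda>l. y (dyad (Suc l) v) - y (dyad l v))"
  proof (rule summable_comparison_test')
    show "summable (\<lambda>l. d (Suc l))" using sum by (simp add: summable_Suc_iff)
    show "norm (y (dyad (Suc l) v) - y (dyad l v)) \<le> d (Suc l)" if "0 \<le> l" for l
      using chain_step[of y d, OF incr v] by simp
  qed
  then have "convergent (\<lambda>n. \<Sum>l<n. y (dyad (Suc l) v) - y (dyad l v))"
    by (simp add: summable_iff_convergent)
  then have "convergent (\<lambda>n. y (dyad n v) - y (dyad 0 v))"
    by (simp only: sum_lessThan_telescope[of "\<lambda>l. y (dyad l v)"])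
  then show ?thesis by (simp add: convergent_diff_const_right_iff)
qed

lemma chain_limit:
  assumes v: "0 \<le> v" "v \<le> 1"
  shows "\<bar>lim (\<lambda>l. y (dyad l v)) - y (dyad l v)\<bar> \<le> (\<Sum>j. d (j + Suc l))"
proof (rule tendsto_upperbound)
  have "(\<lambda>L. y (dyad L v)) \<longlonglongrightarrow> lim (\<lambda>l. y (dyad l v))"
    using chain_convergent[OF v] by (simp add: convergent_LIMSEQ_iff)
  then show "(\<lambda>L. \<bar>y (dyad L v) - y (dyad l v)\<bar>) \<longlonglongrightarrow> \<bar>lim (\<lambda>l. y (dyad l v)) - y (dyad l v)\<bar>"
    by (intro tendsto_intros)
  show "\<forall>\<^sub>F L in sequentially. \<bar>y (dyad L v) - y (dyad l v)\<bar> \<le> (\<Sum>j. d (j + Suc l))"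
  proof (rule eventually_sequentiallyI)
    fix L assume L: "l \<le> L"
    have "\<bar>y (dyad L v) - y (dyad l v)\<bar> \<le> (\<Sum>j\<in>{l<..L}. d j)"
      by (rule chain_bound[of y d, OF incr v L])
    also have "(\<Sum>j\<in>{l<..L}. d j) = (\<Sum>j<L - l. d (j + Suc l))"
      by (rule sum.reindex_bij_witness[of _ "\<lambda>j. j + Suc l" "\<lambda>j. j - Suc l"]) auto
    also have "\<dots> \<le> (\<Sum>j. d (j + Suc l))"
      using chain_bound_nonneg[of y d, OF incr] sum
      by (intro sum_le_suminf) (auto simp: summable_iff_shift simp del: add_Suc_right)
    finally show "\<bar>y (dyad L v) - y (dyad l v)\<bar> \<le> (\<Sum>j. d (j + Suc l))" .
  qed
qed simp

text \<open>The continuity part of the Kolmogorov--Chentsov argument: for arguments within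
  \<open>2^-l\<close> the limits differ by two tails of \<open>d\<close> and one increment
  \<open>d l\<close>, each below \<open>e / 4\<close>.\<close>

lemma continuous_on_chain_limit: "continuous_on {0..1} (\<lambda>v. lim (\<lambda>l. y (dyad l v)))"
proof -
  let ?f = "\<lambda>v. lim (\<lambda>l. y (dyad l v))"
  have "uniformly_continuous_on {0..1} ?f"
    unfolding uniformly_continuous_on_def
  proof (intro allI impI)
    fix e :: real assume e: "0 < e"
    obtain n0 where n0: "\<And>n. n0 \<le> n \<Longrightarrow> norm (\<Sum>i. d (i + n)) < e / 4"
      using suminf_exist_split[of "e / 4" d] e sum by auto
    have "\<forall>\<^sub>F l in sequentially. d l < e / 4"
      using summable_LIMSEQ_zero[OF sum] e by (intro order_tendstoD(2)) auto
    then obtain n1 where n1: "\<And>n. n1 \<le> n \<Longrightarrow> d n < e / 4"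
      by (auto simp: eventually_sequentially)
    define l where "l = max n0 n1"
    have "n0 \<le> Suc l" "n1 \<le> l" by (auto simp: l_def)
    from n0[OF this(1)] n1[OF this(2)] have tail: "(\<Sum>j. d (j + Suc l)) < e / 4" and dl: "d l < e / 4"
      unfolding real_norm_def by linarith+
    have close: "\<bar>?f v - ?f w\<bar> < e" if "0 \<le> w" "w \<le> v" "v \<le> 1" "v - w \<le> 1 / 2 ^ l" for v w
    proof -
      have "\<bar>y (dyad l v) - y (dyad l w)\<bar> \<le> d l"
        by (rule chain_close[of y d, OF incr that])
      then show ?thesis
        using chain_limit[of v l] chain_limit[of w l] that tail dl by linarith
    qed
    show "\<exists>\<delta>>0. \<forall>v\<in>{0..1}. \<forall>w\<in>{0..1}. dist w v < \<delta> \<longrightarrow> dist (?f w) (?f v) < e"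
    proof (intro exI[of _ "1 / 2 ^ l"] conjI ballI impI)
      fix v w :: real assume vw: "v \<in> {0..1}" "w \<in> {0..1}" "dist w v < 1 / 2 ^ l"
      show "dist (?f w) (?f v) < e"
      proof (cases "w \<le> v")
        case True
        then show ?thesis using close[of w v] vw by (simp add: dist_real_def abs_minus_commute)
      next
        case False
        then show ?thesis using close[of v w] vw by (simp add: dist_real_def)
      qed
    qed simp
  qed
  then show ?thesis by (rule uniformly_continuous_imp_continuous)
qed

end

lemma summable_chain_rate: "summable (\<lambda>l. 17 * chain_rate ^ l)"
  using chain_rate by (intro summable_mult summable_geometric) simp

lemma sum_fibre:
  fixes u :: "'k \<Rightarrow> real"
  assumes "finite K"
  shows "(\<Sum>a\<in>e ` K. (\<Sum>k | k \<in> K \<and> e k = a. u k) * f a) = (\<Sum>k\<in>K. u k * f (e k))"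
proof -
  have "(\<Sum>k\<in>K. u k * f (e k)) = (\<Sum>a\<in>e ` K. \<Sum>k | k \<in> K \<and> e k = a. u k * f (e k))"
    by (rule sum.image_gen[OF assms])
  also have "\<dots> = (\<Sum>a\<in>e ` K. (\<Sum>k | k \<in> K \<and> e k = a. u k) * f a)"
    unfolding sum_distrib_right by (intro sum.cong refl) auto
  finally show ?thesis by simp
qed

text \<open>\<open>e\<close> need not be injective: labels with the same image are merged into one
  coefficient.\<close>

lemma centered_normal_reindex:
  assumes "\<And>S c. finite S \<Longrightarrow> centered_normal N (\<lambda>\<omega>. \<Sum>a\<in>S. c a * \<xi> a \<omega>) (\<Sum>a\<in>S. \<Sum>b\<in>S. c a * c b * G a b)"
    and K: "finite K"
  shows "centered_normal N (\<lambda>\<omega>. \<Sum>k\<in>K. u k * \<xi> (e k) \<omega>) (\<Sum>k\<in>K. \<Sum>l\<in>K. u k * u l * G (e k) (e l))"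
proof -
  define c where "c a = (\<Sum>k | k \<in> K \<and> e k = a. u k)" for a
  have "(\<Sum>a\<in>e ` K. c a * \<xi> a \<omega>) = (\<Sum>k\<in>K. u k * \<xi> (e k) \<omega>)" for \<omega>
    unfolding c_def by (rule sum_fibre[OF K])
  moreover have "(\<Sum>a\<in>e ` K. \<Sum>b\<in>e ` K. c a * c b * G a b) = (\<Sum>k\<in>K. \<Sum>l\<in>K. u k * u l * G (e k) (e l))"
  proof -
    have "(\<Sum>a\<in>e ` K. \<Sum>b\<in>e ` K. c a * c b * G a b) = (\<Sum>a\<in>e ` K. c a * (\<Sum>b\<in>e ` K. c b * G a b))"
      by (simp add: sum_distrib_left mult.assoc)
    also have "\<dots> = (\<Sum>a\<in>e ` K. c a * (\<Sum>l\<in>K. u l * G a (e l)))"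
      unfolding c_def by (simp only: sum_fibre[OF K])
    also have "\<dots> = (\<Sum>k\<in>K. u k * (\<Sum>l\<in>K. u l * G (e k) (e l)))"
      unfolding c_def by (rule sum_fibre[OF K])
    finally show ?thesis by (simp add: sum_distrib_left mult.assoc)
  qed
  ultimately show ?thesis using assms(1)[of "e ` K" c] K by simp
qed

section \<open>The bridge as a limit along dyadic quantiles\<close>

context arrival_sample
begin

text \<open>For numbers in \<open>{0, 1}\<close> a difference of products is at most the sum of the
  differences, and the mean distance of two nested indicators is the difference of their
  means.\<close>

lemma joint_df_diff_le:
  "\<bar>joint_df M (\<rho> 0) i j t s - joint_df M (\<rho> 0) i j t' s'\<bar> \<le> \<bar>F i t - F i t'\<bar> + \<bar>F j s - F j s'\<bar>"
proof -
  have L1: "expectation (\<lambda>\<omega>. \<bar>below i t (\<rho> 0 \<omega>) - below i t' (\<rho> 0 \<omega>)\<bar>) = \<bar>F i t - F i t'\<bar>" for i t t'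
  proof (cases "t \<le> t'")
    case True
    then have "\<bar>below i t x - below i t' x\<bar> = below i t' x - below i t x" for x by (auto simp: below_def)
    then have "expectation (\<lambda>\<omega>. \<bar>below i t (\<rho> 0 \<omega>) - below i t' (\<rho> 0 \<omega>)\<bar>) = F i t' - F i t"
      using integrable_below mean_below[unfolded mean_def] by simp
    then show ?thesis using F_mono[OF True, of i] by simp
  next
    case False
    then have "\<bar>below i t x - below i t' x\<bar> = below i t x - below i t' x" for x by (auto simp: below_def)
    then have "expectation (\<lambda>\<omega>. \<bar>below i t (\<rho> 0 \<omega>) - below i t' (\<rho> 0 \<omega>)\<bar>) = F i t - F i t'"
      using integrable_below mean_below[unfolded mean_def] by simp
    then show ?thesis using F_mono[of t' t i] False by simp
  qed
  have "\<bar>joint_df M (\<rho> 0) i j t s - joint_df M (\<rho> 0) i j t' s'\<bar>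
    = \<bar>expectation (\<lambda>\<omega>. below i t (\<rho> 0 \<omega>) * below j s (\<rho> 0 \<omega>) - below i t' (\<rho> 0 \<omega>) * below j s' (\<rho> 0 \<omega>))\<bar>"
    using integrable_below_mult mean_below_mult[unfolded mean_def] by simp
  also have "\<dots> \<le> expectation (\<lambda>\<omega>. \<bar>below i t (\<rho> 0 \<omega>) * below j s (\<rho> 0 \<omega>) - below i t' (\<rho> 0 \<omega>) * below j s' (\<rho> 0 \<omega>)\<bar>)"
    by (rule integral_abs_bound)
  also have "\<dots> \<le> expectation (\<lambda>\<omega>. \<bar>below i t (\<rho> 0 \<omega>) - below i t' (\<rho> 0 \<omega>)\<bar> + \<bar>below j s (\<rho> 0 \<omega>) - below j s' (\<rho> 0 \<omega>)\<bar>)"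
  proof (rule integral_mono)
    fix \<omega>
    show "\<bar>below i t (\<rho> 0 \<omega>) * below j s (\<rho> 0 \<omega>) - below i t' (\<rho> 0 \<omega>) * below j s' (\<rho> 0 \<omega>)\<bar>
      \<le> \<bar>below i t (\<rho> 0 \<omega>) - below i t' (\<rho> 0 \<omega>)\<bar> + \<bar>below j s (\<rho> 0 \<omega>) - below j s' (\<rho> 0 \<omega>)\<bar>"
      by (auto simp: below_def)
  qed (use integrable_below integrable_below_mult in auto)
  also have "\<dots> = \<bar>F i t - F i t'\<bar> + \<bar>F j s - F j s'\<bar>"
    using integrable_below by (simp add: L1)
  finally show ?thesis .
qed

lemma F_Q_dyad_tendsto:
  assumes "0 \<le> t"
  shows "(\<lambda>l. F i (Q i (dyad l (F i t)))) \<longlonglongrightarrow> F i t"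
proof -
  interpret q: quantile "F i" "Q i" T by (rule quantile_Q)
  have "(\<lambda>l. (1 / 2) ^ l :: real) \<longlonglongrightarrow> 0" by (rule LIMSEQ_realpow_zero) auto
  then have "(\<lambda>l. F i (Q i (dyad l (F i t))) - F i t) \<longlonglongrightarrow> 0"
    by (rule Lim_null_comparison[rotated])
       (use q.F_Q_dyad[OF assms] in \<open>simp add: power_one_over abs_minus_commute\<close>)
  then show ?thesis by (simp add: Lim_null[symmetric])
qed

lemma R_Q_dyad_tendsto:
  assumes t: "0 \<le> t" and s: "0 \<le> s"
  shows "(\<lambda>l. R (Q i (dyad l (F i t))) (Q j (dyad l (F j s))) $ i $ j) \<longlonglongrightarrow> R t s $ i $ j"
  unfolding R_eq
proof (intro tendsto_diff tendsto_mult F_Q_dyad_tendsto t s)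
  let ?t = "\<lambda>l. Q i (dyad l (F i t))" and ?s = "\<lambda>l. Q j (dyad l (F j s))"
  have "(\<lambda>l. \<bar>F i (?t l) - F i t\<bar> + \<bar>F j (?s l) - F j s\<bar>) \<longlonglongrightarrow> \<bar>F i t - F i t\<bar> + \<bar>F j s - F j s\<bar>"
    by (intro tendsto_intros F_Q_dyad_tendsto t s)
  then have "(\<lambda>l. \<bar>F i (?t l) - F i t\<bar> + \<bar>F j (?s l) - F j s\<bar>) \<longlonglongrightarrow> 0" by simp
  then have "(\<lambda>l. joint_df M (\<rho> 0) i j (?t l) (?s l) - joint_df M (\<rho> 0) i j t s) \<longlonglongrightarrow> 0"
    by (rule Lim_null_comparison[rotated]) (simp add: joint_df_diff_le)
  then show "(\<lambda>l. joint_df M (\<rho> 0) i j (?t l) (?s l)) \<longlonglongrightarrow> joint_df M (\<rho> 0) i j t s"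
    by (simp add: Lim_null[symmetric])
qed

text \<open>A Gaussian sequence with the covariances of centred indicators at rational quantile
  levels is extended to all times by the chain limit at level \<open>F i t\<close>. Continuity of
  \<open>F\<close> gives continuous paths, and the limit along dyadic levels keeps normality and
  yields the covariance \<open>R\<close>.\<close>

lemma bridge_exists: "\<exists>(N :: (real \<Rightarrow> real ^ 'j) measure) W. is_bridge N W R"
proof -
  \<comment> \<open>Coordinate and rational level are coded in one natural number, since
    \<open>exists_gaussian_sequence\<close> provides a sequence.\<close>
  define idx :: "nat \<Rightarrow> 'j \<times> rat" where "idx = from_nat"
  define g where "g a \<omega> = below (fst (idx a)) (Q (fst (idx a)) (of_rat (snd (idx a)))) (\<rho> 0 \<omega>)
      - F (fst (idx a)) (Q (fst (idx a)) (of_rat (snd (idx a))))" for a \<omega>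
  have gm: "g a \<in> borel_measurable M" for a unfolding g_def by measurable
  have gb: "\<exists>b. \<forall>\<omega>. \<bar>g a \<omega>\<bar> \<le> b" for a
  proof -
    have "\<bar>below i t x - F i t\<bar> \<le> 1" for i t x
      using F_range[of i t] by (auto simp: below_def)
    then show ?thesis unfolding g_def by blast
  qed
  obtain N :: "(real \<Rightarrow> real ^ 'j) measure" and \<xi> where *: "prob_space N \<and>
     (\<forall>a. \<xi> a \<in> borel_measurable N) \<and>
     (\<forall>S c. finite S \<longrightarrow> centered_normal N (\<lambda>\<omega>. \<Sum>a\<in>S. c a * \<xi> a \<omega>)
        (\<Sum>a\<in>S. \<Sum>b\<in>S. c a * c b * expectation (\<lambda>\<omega>. g a \<omega> * g b \<omega>)))"
    using exists_gaussian_sequence[OF prob_space_axioms, of g, OF gm gb] by (elim exE) (rule that)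
  then have N: "prob_space N" and \<xi>m: "\<And>a. \<xi> a \<in> borel_measurable N" by auto
  have \<xi>: "centered_normal N (\<lambda>\<omega>. \<Sum>a\<in>S. c a * \<xi> a \<omega>)
        (\<Sum>a\<in>S. \<Sum>b\<in>S. c a * c b * expectation (\<lambda>\<omega>. g a \<omega> * g b \<omega>))" if "finite S" for S c
    using * that by blast
  interpret N: prob_space N by fact
  \<comment> \<open>The code of a real level. For irrational \<open>v\<close> it is arbitrary; the
    identities below are asserted at rational levels, which include all dyadic ones.\<close>
  define e where "e i v = to_nat (i, inv of_rat v :: rat)" for i :: 'j and v :: real
  define y where "y i v = \<xi> (e i v)" for i v
  have ym[measurable]: "y i v \<in> borel_measurable N" for i v unfolding y_def by (rule \<xi>m)
  have idx: "idx (e i v) = (i, inv of_rat v)" for i v by (simp add: idx_def e_def)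
  have rat: "of_rat (inv of_rat v :: rat) = v" if "v \<in> \<rat>" for v :: real
    using that by (intro f_inv_into_f) (simp add: Rats_def)
  have dyad_rat: "dyad l v \<in> \<rat>" for l v by (simp add: dyad_def)
  have normal: "centered_normal N (\<lambda>\<omega>. \<Sum>k\<in>K. u k * y (ix k) (v k) \<omega>)
      (\<Sum>k\<in>K. \<Sum>l\<in>K. u k * u l * R (Q (ix k) (v k)) (Q (ix l) (v l)) $ ix k $ ix l)"
    if K: "finite K" and v: "\<And>k. k \<in> K \<Longrightarrow> v k \<in> \<rat>" for K :: "(real \<times> 'j) set" and u v ix
  proof -
    have "expectation (\<lambda>\<omega>. g (e (ix k) (v k)) \<omega> * g (e (ix l) (v l)) \<omega>)
        = R (Q (ix k) (v k)) (Q (ix l) (v l)) $ ix k $ ix l" if "k \<in> K" "l \<in> K" for k l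
      unfolding g_def idx using rat v that by (simp add: covariance_below)
    then show ?thesis
      using centered_normal_reindex[OF \<xi> K, of u "\<lambda>k. e (ix k) (v k)"] by (simp add: y_def)
  qed
  define D where "D i \<omega> l = incr_bound (\<lambda>v. y i v \<omega>) l" for i \<omega> l
  have incr_moment: "integrable N (\<lambda>\<omega>. (y i w \<omega> - y i v \<omega>) ^ 4)"
     "N.expectation (\<lambda>\<omega>. (y i w \<omega> - y i v \<omega>) ^ 4) \<le> 3 * (w - v)\<^sup>2"
    if "0 \<le> v" "v \<le> w" "v \<in> \<rat>" "w \<in> \<rat>" for i v w
  proof -
    interpret q: quantile "F i" "Q i" T by (rule quantile_Q)
    define a where "a = F i (Q i v)"
    define b where "b = F i (Q i w)"
    have QQ: "Q i v \<le> Q i w" using that by (intro q.Q_mono)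
    have j: "joint_df M (\<rho> 0) i i t s = F i (min t s)" for t s
      unfolding joint_df_def marginal_df_def by (intro arg_cong[where f = prob]) auto
    \<comment> \<open>The labels \<open>(1, i)\<close> and \<open>(0, i)\<close> carry the weights 1
      and -1. The variance comes out as \<open>(b - a) - (b - a)^2\<close>, that of a Brownian
      bridge increment over mass \<open>b - a\<close>.\<close>
    have "centered_normal N (\<lambda>\<omega>. y i w \<omega> - y i v \<omega>)
      (R (Q i w) (Q i w) $ i $ i - R (Q i w) (Q i v) $ i $ i - (R (Q i v) (Q i w) $ i $ i - R (Q i v) (Q i v) $ i $ i))"
      using normal[of "{(1, i), (0, i)}" "\<lambda>k. if fst k = 1 then w else v" "\<lambda>k. if fst k = 1 then 1 else - 1" "\<lambda>_. i"] that
      by (simp add: if_distrib[of "\<lambda>v. y i v _"] algebra_simps)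
    moreover have "R (Q i w) (Q i w) $ i $ i - R (Q i w) (Q i v) $ i $ i - (R (Q i v) (Q i w) $ i $ i - R (Q i v) (Q i v) $ i $ i)
      = (b - a) - (b - a)\<^sup>2"
      using QQ by (simp add: R_eq j min_absorb1 min_absorb2 flip: a_def b_def)
        (simp add: power2_eq_square algebra_simps)
    ultimately have n: "centered_normal N (\<lambda>\<omega>. y i w \<omega> - y i v \<omega>) ((b - a) - (b - a)\<^sup>2)" by simp
    show "integrable N (\<lambda>\<omega>. (y i w \<omega> - y i v \<omega>) ^ 4)"
      by (rule N.centered_normal_moments(1)[OF n])
    have "0 \<le> (b - a) - (b - a)\<^sup>2" using n by (simp add: centered_normal_def)
    moreover have "b - a \<le> w - v" unfolding a_def b_def using that by (intro q.F_Q_diff)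
    ultimately have "((b - a) - (b - a)\<^sup>2)\<^sup>2 \<le> (w - v)\<^sup>2"
      using zero_le_power2[of "b - a"] by (intro power_mono) linarith+
    then show "N.expectation (\<lambda>\<omega>. (y i w \<omega> - y i v \<omega>) ^ 4) \<le> 3 * (w - v)\<^sup>2"
      using N.centered_normal_moments(4)[OF n] by simp
  qed
  have D: "integrable N (\<lambda>\<omega>. D i \<omega> l)" "N.expectation (\<lambda>\<omega>. D i \<omega> l) \<le> 17 * chain_rate ^ l" for i l
  proof -
    have w: "integrable N (\<lambda>\<omega>. (y i ((real k + 1) / 2 ^ l) \<omega> - y i (real k / 2 ^ l) \<omega>) ^ 4)"
      "N.expectation (\<lambda>\<omega>. (y i ((real k + 1) / 2 ^ l) \<omega> - y i (real k / 2 ^ l) \<omega>) ^ 4)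
        \<le> 3 * ((real k + 1) / 2 ^ l - real k / 2 ^ l)\<^sup>2" for k
      by (rule incr_moment; simp add: divide_right_mono)+
    have "3 * ((real k + 1) / 2 ^ l - real k / 2 ^ l)\<^sup>2 \<le> 4 / 4 ^ l" for k
      by (simp add: diff_divide_distrib[symmetric] power_divide power2_eq_square power_mult_distrib[symmetric] divide_right_mono)
    then have "N.expectation (\<lambda>\<omega>. (y i ((real k + 1) / 2 ^ l) \<omega> - y i (real k / 2 ^ l) \<omega>) ^ 4) \<le> 4 / 4 ^ l" for k
      using w(2)[of k] by (rule order_trans[rotated])
    then show "integrable N (\<lambda>\<omega>. D i \<omega> l)" "N.expectation (\<lambda>\<omega>. D i \<omega> l) \<le> 17 * chain_rate ^ l"
      unfolding D_def using w(1)
      by (auto intro!: N.expectation_incr_bound[where Y = "\<lambda>\<omega> v. y i v \<omega>"])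
  qed
  have D_nonneg: "0 \<le> D i \<omega> l" for i \<omega> l
    unfolding D_def using incr_bound[of 0 l "\<lambda>v. y i v \<omega>"] by simp
  have "AE \<omega> in N. summable (D i \<omega>)" for i
  proof (rule AE_summable_of_summable_integral[OF D(1) D_nonneg])
    show "summable (\<lambda>l. N.expectation (\<lambda>\<omega>. D i \<omega> l))"
    proof (rule summable_comparison_test'[OF summable_chain_rate])
      show "norm (N.expectation (\<lambda>\<omega>. D i \<omega> l)) \<le> 17 * chain_rate ^ l" for l
        using D(2)[of i l] Bochner_Integration.integral_nonneg[of N "\<lambda>\<omega>. D i \<omega> l"] D_nonneg by simp
    qed
  qed
  then have "AE \<omega> in N. \<forall>i\<in>UNIV. summable (D i \<omega>)"
    by (intro AE_finite_allI) auto
  then obtain Z where Z: "{\<omega> \<in> space N. \<not> (\<forall>i\<in>UNIV. summable (D i \<omega>))} \<subseteq> Z" "Z \<in> null_sets N"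
    by (auto elim!: AE_E simp: null_sets_def)
  have Zm[measurable]: "Z \<in> sets N" using Z by auto
  \<comment> \<open>On the null set \<open>Z\<close>, where the chain need not converge, the path is
    set to 0: \<open>is_bridge\<close> asks for continuity at every point of the space.\<close>
  define W where "W t \<omega> = (\<chi> i. if \<omega> \<in> Z then 0 else lim (\<lambda>l. y i (dyad l (F i t)) \<omega>))" for t \<omega>
  have incr: "\<bar>y i ((real k + 1) / 2 ^ l) \<omega> - y i (real k / 2 ^ l) \<omega>\<bar> \<le> D i \<omega> l" if "k \<le> 2 ^ l" for i \<omega> l k
    unfolding D_def by (rule incr_bound[OF that])
  have good: "summable (D i \<omega>)" if "\<omega> \<in> space N" "\<omega> \<notin> Z" for i \<omega>
    using Z(1) that by auto
  have cont_W: "continuous_on {0..} (\<lambda>t. W t \<omega>)" if "\<omega> \<in> space N" for \<omega>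
  proof (cases "\<omega> \<in> Z")
    case False
    have "continuous_on {0..} (\<lambda>t. lim (\<lambda>l. y i (dyad l (F i t)) \<omega>))" for i
      by (rule continuous_on_compose2[OF continuous_on_chain_limit[of "\<lambda>v. y i v \<omega>", OF incr good[OF that False]] cont])
         (use F_range in auto)
    then show ?thesis unfolding W_def using False by (simp add: continuous_on_vec_lambda)
  qed (simp add: W_def)
  have lim_W: "AE \<omega> in N. (\<lambda>l. y i (dyad l (F i t)) \<omega>) \<longlonglongrightarrow> W t \<omega> $ i" for t i
  proof (rule AE_mp[OF AE_not_in[OF Z(2)] AE_I2], intro impI)
    fix \<omega> assume \<omega>: "\<omega> \<in> space N" "\<omega> \<notin> Z"
    have "convergent (\<lambda>l. y i (dyad l (F i t)) \<omega>)"
      by (rule chain_convergent[of "\<lambda>v. y i v \<omega>", OF incr good[OF \<omega>]]) (use F_range[of i t] in auto)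
    then show "(\<lambda>l. y i (dyad l (F i t)) \<omega>) \<longlonglongrightarrow> W t \<omega> $ i"
      using \<omega> by (simp add: W_def convergent_LIMSEQ_iff)
  qed
  have mWi: "(\<lambda>\<omega>. W t \<omega> $ i) \<in> borel_measurable N" for t i
  proof -
    have [measurable]: "(\<lambda>\<omega>. lim (\<lambda>l. y i (dyad l (F i t)) \<omega>)) \<in> borel_measurable N"
      by (rule borel_measurable_lim_metric) measurable
    show ?thesis unfolding W_def by simp
  qed
  have mW: "W t \<in> borel_measurable N" for t
  proof -
    have "W t \<omega> = (\<Sum>i\<in>UNIV. W t \<omega> $ i *\<^sub>R axis i 1)" for \<omega>
      by (simp add: vec_eq_iff axis_def if_distrib[of "\<lambda>x. _ * x"] cong: if_cong)
    moreover have "(\<lambda>\<omega>. \<Sum>i\<in>UNIV. W t \<omega> $ i *\<^sub>R (axis i 1 :: real ^ 'j)) \<in> borel_measurable N"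
      by (intro borel_measurable_sum borel_measurable_scaleR mWi borel_measurable_const)
    ultimately show ?thesis by (simp only: flip: fun_eq_iff)
  qed
  have nW: "centered_normal N (\<lambda>\<omega>. \<Sum>k\<in>K. u k * W (tm k) \<omega> $ ix k)
      (\<Sum>k\<in>K. \<Sum>l\<in>K. u k * u l * R (tm k) (tm l) $ ix k $ ix l)"
    if K: "finite K" and tm: "\<And>k. k \<in> K \<Longrightarrow> 0 \<le> tm k" for K :: "(real \<times> 'j) set" and u tm ix
  proof (rule N.centered_normal_limit)
    let ?v = "\<lambda>n k. dyad n (F (ix k) (tm k))"
    show "centered_normal N (\<lambda>\<omega>. \<Sum>k\<in>K. u k * y (ix k) (?v n k) \<omega>)
      (\<Sum>k\<in>K. \<Sum>l\<in>K. u k * u l * R (Q (ix k) (?v n k)) (Q (ix l) (?v n l)) $ ix k $ ix l)" for n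
      by (rule normal[OF K dyad_rat])
    show "(\<lambda>\<omega>. \<Sum>k\<in>K. u k * W (tm k) \<omega> $ ix k) \<in> borel_measurable N" using mWi by simp
    have "AE \<omega> in N. \<forall>k\<in>K. (\<lambda>n. y (ix k) (?v n k) \<omega>) \<longlonglongrightarrow> W (tm k) \<omega> $ ix k"
      by (rule AE_finite_allI[OF K lim_W])
    then show "AE \<omega> in N. (\<lambda>n. \<Sum>k\<in>K. u k * y (ix k) (?v n k) \<omega>) \<longlonglongrightarrow> (\<Sum>k\<in>K. u k * W (tm k) \<omega> $ ix k)"
      by eventually_elim (intro tendsto_sum tendsto_mult tendsto_const, blast)
    show "(\<lambda>n. \<Sum>k\<in>K. \<Sum>l\<in>K. u k * u l * R (Q (ix k) (?v n k)) (Q (ix l) (?v n l)) $ ix k $ ix l)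
      \<longlonglongrightarrow> (\<Sum>k\<in>K. \<Sum>l\<in>K. u k * u l * R (tm k) (tm l) $ ix k $ ix l)"
      by (intro tendsto_sum tendsto_mult tendsto_const R_Q_dyad_tendsto tm)
  qed
  have single: "centered_normal N (\<lambda>\<omega>. W t \<omega> $ i) (R t t $ i $ i)" if "0 \<le> t" for t i
    using nW[of "{(0, i)}" "\<lambda>_. t" "\<lambda>_. 1" "\<lambda>_. i"] that by simp
  have sq: "integrable N (\<lambda>\<omega>. (W t \<omega> $ i)\<^sup>2)" if "0 \<le> t" for t i
    by (rule N.centered_normal_moments(1)[OF single[OF that]])
  have "gaussian_process N W"
    unfolding gaussian_process_def
  proof (intro conjI allI impI)
    fix I :: "real set" and c :: "real \<Rightarrow> real ^ 'j" assume I: "finite I \<and> I \<subseteq> {0..}"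
    have "(\<Sum>t\<in>I. c t \<bullet> W t \<omega>) = (\<Sum>k\<in>I \<times> UNIV. c (fst k) $ snd k * W (fst k) \<omega> $ snd k)" for \<omega>
      by (simp add: inner_vec_def sum.cartesian_product case_prod_beta)
    moreover have "gaussian_rv N (\<lambda>\<omega>. \<Sum>k\<in>I \<times> (UNIV :: 'j set). c (fst k) $ snd k * W (fst k) \<omega> $ snd k)"
      by (rule N.centered_normal_imp_gaussian_rv[OF nW]) (use I in auto)
    ultimately show "gaussian_rv N (\<lambda>\<omega>. \<Sum>t\<in>I. c t \<bullet> W t \<omega>)" by simp
  qed (use N mW in auto)
  moreover have "N.expectation (\<lambda>\<omega>. W t \<omega> $ i * W s \<omega> $ j) = R t s $ i $ j" if "0 \<le> t" "t \<le> s" for t s i j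
  proof -
    \<comment> \<open>Polarisation: the covariance is recovered from the variances of the sum and of
      its two terms.\<close>
    have n: "centered_normal N (\<lambda>\<omega>. W t \<omega> $ i + W s \<omega> $ j)
        (R t t $ i $ i + 2 * R t s $ i $ j + R s s $ j $ j)"
      using nW[of "{(1, i), (0, i)}" "\<lambda>k. if fst k = 1 then t else s" "\<lambda>_. 1" "\<lambda>k. if fst k = 1 then i else j"]
        that R_sym[of s t j i] by (simp add: algebra_simps)
    have "W t \<omega> $ i * W s \<omega> $ j = ((W t \<omega> $ i + W s \<omega> $ j)\<^sup>2 - (W t \<omega> $ i)\<^sup>2 - (W s \<omega> $ j)\<^sup>2) / 2" for \<omega>
      by (simp add: power2_sum)
    then have "N.expectation (\<lambda>\<omega>. W t \<omega> $ i * W s \<omega> $ j)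
      = N.expectation (\<lambda>\<omega>. ((W t \<omega> $ i + W s \<omega> $ j)\<^sup>2 - (W t \<omega> $ i)\<^sup>2 - (W s \<omega> $ j)\<^sup>2) / 2)"
      by (simp only:)
    also have "\<dots> = (N.expectation (\<lambda>\<omega>. (W t \<omega> $ i + W s \<omega> $ j)\<^sup>2) - N.expectation (\<lambda>\<omega>. (W t \<omega> $ i)\<^sup>2) - N.expectation (\<lambda>\<omega>. (W s \<omega> $ j)\<^sup>2)) / 2"
      using sq[of t i] sq[of s j] N.centered_normal_moments(1)[OF n, of 2] that by simp
    finally show ?thesis
      using N.centered_normal_moments(3)[OF n] N.centered_normal_moments(3)[OF single[of t i]]
        N.centered_normal_moments(3)[OF single[of s j]] that by simp
  qed
  moreover have "N.expectation (\<lambda>\<omega>. W t \<omega> $ i) = 0" if "0 \<le> t" for t i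
    by (rule N.centered_normal_moments(2)[OF single[OF that]])
  ultimately have "is_bridge N W R"
    using cont_W by (auto simp: is_bridge_def)
  then show ?thesis by blast
qed

end

section \<open>Convergence of the empirical process\<close>

context arrival_sample
begin

lemma rcll_emp: "(\<lambda>t. emp_path n t \<omega>) \<in> rcll_paths"
proof (rule rcll_paths_vec)
  fix i
  have "(\<lambda>t. (1 / sqrt n) *\<^sub>R (\<Sum>m<n. of_bool (\<rho> m \<omega> $ i \<le> t)) - sqrt n *\<^sub>R F i t) \<in> rcll_paths"
    using rcll_paths_continuous[OF cont[of i]]
    by (intro rcll_paths_diff rcll_paths_scaleR rcll_paths_sum rcll_paths_of_bool) assumption+
  then show "(\<lambda>t. emp n (below i t) \<omega>) \<in> rcll_paths"
    unfolding emp_below below_def by simp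
qed

lemma weakly_converges_emp:
  assumes W: "is_bridge N W R"
  shows "weakly_converges_ucc M emp_path N W"
proof -
  interpret N: prob_space N using W by (simp add: is_bridge_def gaussian_process_def)
  have zero: "AE \<omega> in N. \<forall>t\<ge>T. W t \<omega> = W T \<omega>"
    using bridge_zero_after[OF W]
  proof eventually_elim
    case (elim \<omega>)
    show ?case using elim[rule_format, of T] elim by auto
  qed
  interpret D: ucc_weak_convergence M N emp_path W T
  proof
    fix n and t :: real
    have "(\<lambda>\<omega>. emp_path n t \<omega>) = (\<lambda>\<omega>. \<Sum>i\<in>UNIV. emp n (below i t) \<omega> *\<^sub>R (axis i 1 :: real ^ 'j))"
      by (simp add: fun_eq_iff vec_eq_iff axis_def if_distrib[of "\<lambda>x. _ * x"] cong: if_cong)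
    also have "\<dots> \<in> borel_measurable M"
      by (intro borel_measurable_sum borel_measurable_scaleR emp_measurable below_measurable borel_measurable_const)
    finally show "(\<lambda>\<omega>. emp_path n t \<omega>) \<in> borel_measurable M" .
  next
    fix h :: "(nat \<times> 'j \<Rightarrow> real) \<Rightarrow> real" and m :: nat and B :: real
    assume "continuous_on UNIV h" "\<And>x. \<bar>h x\<bar> \<le> B"
      "\<And>x y. (\<And>k i. k \<le> m * m \<Longrightarrow> x (k, i) = y (k, i)) \<Longrightarrow> h x = h y"
    from fidi[OF W this]
    show "(\<lambda>n. expectation (\<lambda>\<omega>. h (\<lambda>(k, i). (\<chi> i. emp n (below i (real k / real m)) \<omega>) $ i)))
       \<longlonglongrightarrow> N.expectation (\<lambda>\<omega>. h (\<lambda>(k, i). W (real k / real m) \<omega> $ i))"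
      by simp
  next
    show "0 \<le> T" using T by simp
    show "(\<lambda>t. emp_path n t \<omega>) \<in> rcll_paths" for n \<omega> by (rule rcll_emp)
    show "W t \<in> borel_measurable N" if "0 \<le> t" for t
      using W that by (simp add: is_bridge_def gaussian_process_def)
    show "continuous_on {0..} (\<lambda>t. W t \<omega>)" if "\<omega> \<in> space N" for \<omega>
      using W that by (simp add: is_bridge_def)
    show "emp_path n t \<omega> = emp_path n T \<omega>" if "\<omega> \<in> space M" "T \<le> t" for n t \<omega>
      using that by (simp add: emp_below_top)
    show "AE \<omega> in N. \<forall>t\<ge>T. W t \<omega> = W T \<omega>" by (rule zero)
    show "\<forall>\<^sub>F m in sequentially. modulus_dominated M emp_path T m \<epsilon>"
      if "0 < \<epsilon>" for \<epsilon>
      by (rule tight[OF that])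
  qed
  show ?thesis by (rule D.weakly_converges_ucc)
qed

end

theorem theorem1:
  fixes M :: "'a measure" and T :: real
    and \<tau> :: "nat \<Rightarrow> 'a \<Rightarrow> real^'j"
  assumes "prob_space M"
    and "T > 0"
    and "prob_space.indep_vars M (\<lambda>_. borel) \<tau> {1..}"
    and "\<forall>m\<ge>1. distr M borel (\<tau> m) = distr M borel (\<tau> 1)"
    and "\<forall>m\<ge>1. \<forall>\<omega>\<in>space M. \<forall>j. \<tau> m \<omega> $ j \<in> {0..T}"
    and "\<forall>j. continuous_on {0..} (marginal_df M (\<tau> 1) j)"
  shows "(AE \<omega> in M. ucc_tendsto (\<lambda>n t. (1 / real n) *\<^sub>R arrivals \<tau> n t \<omega>) (vec_df M (\<tau> 1))) \<and>
    (\<exists>(N :: (real \<Rightarrow> real^'j) measure) W. is_bridge N W (bridge_cov M (\<tau> 1))) \<and>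
    (\<forall>(N :: 'b measure) W. is_bridge N W (bridge_cov M (\<tau> 1)) \<longrightarrow>
       weakly_converges_ucc M (scaled_arrivals M \<tau>) N W)"
proof -
  interpret prob_space M by fact
  \<comment> \<open>The given sample starts at index 1, \<open>iid_sample\<close> at index 0, so
    everything is shifted by \<open>Suc\<close>.\<close>
  have "indep_vars (\<lambda>_. borel) \<tau> (Suc ` UNIV)"
    using assms(3) by (rule indep_vars_subset) auto
  then have indep: "indep_vars (\<lambda>_. borel) (\<lambda>m. \<tau> (Suc m)) UNIV"
    by (rule indep_vars_reindex[rotated]) simp
  have ident: "distr M borel (\<tau> (Suc m)) = distr M borel (\<tau> (Suc 0))" for m
    using assms(4)[rule_format, of "Suc m"] by simp
  have range: "\<tau> (Suc m) \<omega> $ j \<in> {0..T}" if "\<omega> \<in> space M" for m \<omega> j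
    by (rule assms(5)[rule_format, OF _ that]) simp
  have cont: "continuous_on {0..} (marginal_df M (\<tau> (Suc 0)) j)" for j
    using assms(6)[rule_format, of j] by simp
  interpret arrival_sample M "\<lambda>m. \<tau> (Suc m)" T
    by (unfold_locales; fact indep ident range cont assms(2))
  have arrivals: "arrivals \<tau> n t \<omega> $ i = (\<Sum>m<n. below i t (\<tau> (Suc m) \<omega>))" for n t \<omega> i
    by (simp add: arrivals_def arrival_def below_def sum.atLeast1_atMost_eq)
  have scaled: "scaled_arrivals M \<tau> = emp_path"
    by (simp add: fun_eq_iff vec_eq_iff scaled_arrivals_def arrivals emp_def mean_below vec_df_def
        sum_subtractf)
  have "AE \<omega> in M. ucc_tendsto (\<lambda>n t. (1 / real n) *\<^sub>R arrivals \<tau> n t \<omega>) (vec_df M (\<tau> 1))"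
    using glivenko_cantelli
  proof eventually_elim
    case (elim \<omega>)
    show ?case
      unfolding ucc_tendsto_def
    proof (intro allI impI uniform_limitI)
      fix K :: "real set" and e :: real assume K: "compact K \<and> K \<subseteq> {0..}" and e: "0 < e"
      \<comment> \<open>At \<open>n = 0\<close> the identity with the empirical process below fails:
        its left-hand side is then minus the vector of marginals and its right-hand side 0.\<close>
      have "\<forall>\<^sub>F n in sequentially. 0 < n" by (rule eventually_gt_at_top)
      with uniform_limitD[OF elim e]
      show "\<forall>\<^sub>F n in sequentially. \<forall>t\<in>K. dist ((1 / real n) *\<^sub>R arrivals \<tau> n t \<omega>) (vec_df M (\<tau> 1) t) < e"
      proof eventually_elim
        case (elim n)
        have "(1 / real n) *\<^sub>R arrivals \<tau> n t \<omega> - vec_df M (\<tau> 1) t = (\<chi> i. emp n (below i t) \<omega> / sqrt n)" for t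
          using elim(2) by (simp add: vec_eq_iff arrivals vec_df_def emp_below diff_divide_distrib)
        then show ?case using elim(1) K by (force simp: dist_norm)
      qed
    qed
  qed
  moreover have "\<exists>(N :: (real \<Rightarrow> real^'j) measure) W. is_bridge N W (bridge_cov M (\<tau> 1))"
    using bridge_exists by simp
  moreover have "weakly_converges_ucc M (scaled_arrivals M \<tau>) N W"
    if "is_bridge N W (bridge_cov M (\<tau> 1))" for N :: "'b measure" and W
    unfolding scaled using that by (intro weakly_converges_emp) simp
  ultimately show ?thesis by blast
qed

end
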